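(* Let $\alpha\in(0,1)$ and $\beta>2$. Suppose that $P_{\mathrm e}=\sigma P_\sigma+\kappa P_\kappa$ and the (sufficiently small) constants $\sigma,\kappa>0$ match one of the hypotheses (H1)-(H4) of the context, and let $\dot\xi=\dot\xi(\sigma,\kappa)\in(0,L)$ be the corresponding location described there. Then there exists a solution $(\dot U_-,\dot U_+;\dot\psi',\dot\xi)$ to the linearized problem (LP) of the context. Moreover, $$\|\dot U_-\|_{C^{2,\alpha}(\dot\Omega_-)}+\|\dot U_+\|_{(\dot\Omega_+;\dot\Gamma_s)}+\|\dot\psi'\|_{W_\beta^{1-1/\beta}(\dot\Gamma_s)}\le\dot C(\sigma+\kappa),$$ where the constant $\dot C$ depends on $\bar U_\pm,L,\dot\xi,\alpha$ and $\beta$ (and on the fixed data).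
   Context: **Gas.** Fixed constants: $\gamma>1$, $c_{\mathrm v}>0$, $\mathcal R=(\gamma-1)c_{\mathrm v}$, $q_{\mathrm e}>0$, $T_0,a,\mathcal E,\mathcal R_0>0$, $L>0$. A state is $U=(p,\theta,q,S,Z)^\top$, $u_1=q\cos\theta$, $u_2=q\sin\theta$; $\rho$ is given by $p=(\gamma-1)e^{S/c_{\mathrm v}}\rho^\gamma$, $T=p/(\mathcal R\rho)$, $c=\sqrt{\gamma p/\rho}$, $M=q/c$. $\phi(T)=T^ae^{-\mathcal E/(\mathcal R_0(T-T_0))}$ for $T>T_0$, $\phi(T)=0$ for $T\le T_0$. **Background.** $\bar U_-=(\bar p_-,0,\bar q_-,\bar S_-,\bar Z)^\top$ is a constant supersonic state ($\bar M_->1$), $\bar T_->T_0$, $0<\bar Z\le1$; $\bar U_+=(\bar p_+,0,\bar q_+,\bar S_+,\bar Z)^\top$ is the unique constant subsonic state ($\bar M_+<1$) with $[\bar\rho\bar q]=0$, $[\bar\rho\bar q^2+\bar p]=0$, $[\frac12\bar q^2+\frac{\gamma\bar p}{(\gamma-1)\bar\rho}]=0$, $[w]=w_+-w_-$. Normalization $\bar\rho_\pm\bar q_\pm=1$. **Data.** $\Theta\in C^{2,\alpha}[0,L]$ with $\Theta(0)=\Theta'(0)=\Theta''(0)=0$; $P_\sigma,P_\kappa\in C^{2,\alpha}([0,\infty))$, independent of $\sigma,\kappa$. **Solvability functions.** $\bar f_1^\pm=\frac1{\gamma c_{\mathrm v}}\frac1{\bar\rho_\pm\bar q_\pm^2}\frac{\phi(\bar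 T_\pm)}{\bar T_\pm}q_{\mathrm e}\bar Z$, $\bar f_4^\pm=\frac1{\bar q_\pm}\frac{\phi(\bar T_\pm)}{\bar T_\pm}q_{\mathrm e}\bar Z$, $\bar f_5^\pm=\frac{\phi(\bar T_\pm)}{\bar q_\pm}\bar Z$, $\dot K_1=[\bar p](\frac{\gamma-1}{\gamma\bar p_+}+\frac1{\bar\rho_+\bar q_+^2})>0$, $\dot K_2=\frac1{\gamma c_{\mathrm v}}\frac1{\bar T_+}q_{\mathrm e}\bar Z(\frac{\phi(\bar T_+)}{\bar\rho_+\bar q_+^2}-\frac{\phi(\bar T_-)}{\bar\rho_-\bar q_-^2})>0$, $R_\sigma(\xi)=\int_0^L\Theta-\dot K_1\int_0^\xi\Theta$, $R_\kappa(\xi)=-\bar f_1^+L+\dot K_2\xi$. For a function $P$ put $P_*=\frac1{\bar\rho_+\bar q_+}\frac{1-\bar M_+^2}{\bar\rho_+\bar q_+^2}\int_0^1P\,dy_2$ (giving $P_{\sigma*},P_{\kappa*}$, and $P_{A*}$ for $P_A=AP_\sigma+P_\kappa$); $R_A=AR_\sigma+R_\kappa$; underlines/overlines denote inf/sup over $(0,L)$. Solvability equation: $(\ast)$ $\sigma R_\sigma(\dot\xi)+\kappa R_\kappa(\dot\xi)=\sigma P_{\sigma*}+\kappa P_{\kappa*}$. **Hypotheses and $\dot\xi$.** (H1) $\kappa=A_1\sigma^s$, $s>1$, $A_1>0$; $P_{\sigma*}\in(\underline{R_\sigma},\overline{R_\sigma})$; $\bar\xi_*\in(0,L)$ solves $R_\sigma(\bar\xi_*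 )=P_{\sigma*}$, $\Theta(\bar\xi_* )\ne0$; $\dot\xi(\sigma,\kappa)$ is the solution of $(\ast)$ (existing for small $\sigma$) with $|\dot\xi-\bar\xi_*|\le C\sigma^{s-1}$. (H2) $\sigma=A_2\kappa^s$, $s>1$, $A_2>0$; $P_{\kappa*}\in(\underline{R_\kappa},\overline{R_\kappa})$; $\bar\xi_*\in(0,L)$ solves $R_\kappa(\bar\xi_* )=P_{\kappa*}$; $\dot\xi(\sigma,\kappa)$ is the solution of $(\ast)$ (existing for small $\kappa$) with $|\dot\xi-\bar\xi_*|\le C\kappa^{s-1}$. (H3) $\sigma=A\kappa$, $A>0$; $P_{A*}\in(\underline{R_A},\overline{R_A})$; $\bar\xi_*\in(0,L)$ solves $R_A(\bar\xi_* )=P_{A*}$, $\Theta(\bar\xi_* )\ne\dot K_2/(A\dot K_1)$; $\dot\xi\equiv\bar\xi_*$. (H4) $(P_{\sigma*},P_{\kappa*})=(R_\sigma(\bar\xi_* ),R_\kappa(\bar\xi_* ))$ for some $\bar\xi_*\in(0,L)$; $\dot\xi\equiv\bar\xi_*$; and $|\kappa\dot K_2-\sigma\dot K_1\Theta(\dot\xi)|\ge\beta_0(\sigma+\kappa)$ for some constant $\beta_0>0$. **Linearized problem (LP).** $\dot\Omega_-=(0,\dot\xi)\times(0,1)$, $\dot\Omega_+=(\dot\xi,L)\times(0,1)$, $\dot\Gamma_s=\{\dot\xi\}\times(0,1)$. Unknowns $\dot U_\pm=(\dot p_\pm,\dot\theta_\pm,\dot q_\pm,\dot S_\pm,\dot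 Z_\pm)^\top$ and a function $\dot\psi'$ on $\dot\Gamma_s$. (1) In $\dot\Omega_-$: $\partial_{y_2}\dot p_-+\bar q_-\partial_{y_1}\dot\theta_-=0$, $\partial_{y_2}\dot\theta_--\frac1{\bar\rho_-\bar q_-}\frac{1-\bar M_-^2}{\bar\rho_-\bar q_-^2}\partial_{y_1}\dot p_-=\kappa\bar f_1^-$, $\bar\rho_-\bar q_-\partial_{y_1}\dot q_-+\partial_{y_1}\dot p_-=0$, $\partial_{y_1}\dot S_-=\kappa\bar f_4^-$, $\partial_{y_1}\dot Z_-=-\kappa\bar f_5^-$; $\dot U_-=0$ on $y_1=0$, $\dot\theta_-=0$ on $y_2=0$, $\dot\theta_-=\sigma\Theta(y_1)$ on $y_2=1$. (2) In $\dot\Omega_+$ (in the sense of distributions where derivatives are not classical): $\partial_{y_2}\dot p_++\bar q_+\partial_{y_1}\dot\theta_+=0$, $\partial_{y_2}\dot\theta_+-\frac1{\bar\rho_+\bar q_+}\frac{1-\bar M_+^2}{\bar\rho_+\bar q_+^2}\partial_{y_1}\dot p_+=\kappa\bar f_1^+$, $\partial_{y_1}(\bar q_+\dot q_++\frac1{\bar\rho_+}\dot p_++\bar T_+\dot S_++q_{\mathrm e}\dot Z_+)=0$, $\partial_{y_1}\dot S_+=\kappa\bar f_4^+$, $\partial_{y_1}\dot Z_+=-\kappa\bar f_5^+$; $\dot p_+=\sigma P_\sigma(y_2)+\kappa P_\kappa(y_2)$ on $y_1=L$, $\dot\theta_+=0$ on $y_2=0$, $\dot\theta_+=\sigma\Theta(y_1)$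 on $y_2=1$. (3) On $\dot\Gamma_s$: $\beta_j^+\cdot\dot U_++\beta_j^-\cdot\dot U_-=0$ ($j=1,\dots,4$), $\beta_5^+\cdot\dot U_++\beta_5^-\cdot\dot U_--[\bar p]\dot\psi'=0$, where $\beta_j^\pm=\nabla_{U_\pm}G_j$ at $(\bar U_+,\bar U_-)$ (with $\psi'=0$ for $j=5$) and $G_1=[\frac1{\rho u_1}][p]+[\frac{u_2}{u_1}][u_2]$, $G_2=[u_1+\frac p{\rho u_1}][p]+[\frac{pu_2}{u_1}][u_2]$, $G_3=[\frac12q^2+\frac{\gamma p}{(\gamma-1)\rho}]$, $G_4=[Z]$, $G_5=[u_2]-\psi'[p]$. **Norm.** $\|U\|_{(\dot\Omega_+;\dot\Gamma_s)}=\|p\|_{W^1_\beta(\dot\Omega_+)}+\|\theta\|_{W^1_\beta(\dot\Omega_+)}+\|(q,S,Z)\|_{C(\overline{\dot\Omega_+})}+\|(q,S,Z)\|_{W_\beta^{1-1/\beta}(\dot\Gamma_s)}$, with $W_\beta^k$ the $L^\beta$-based Sobolev(-Slobodeckij) space. *)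

theory Defs
  imports "HOL-Analysis.Analysis"
begin

text \<open>
  All norms take values in \<^typ>\<open>ennreal\<close>; the value \<^term>\<open>top\<close> means that
  the function is not in the space, so a finite upper bound contains membership.
\<close>

section \<open>Function spaces\<close>

definition dir_deriv :: "'a::euclidean_space \<Rightarrow> ('a \<Rightarrow> real) \<Rightarrow> 'a \<Rightarrow> real" where
  "dir_deriv e f x = deriv (\<lambda>t. f (x + t *\<^sub>R e)) 0"

definition has_dir_deriv_on :: "'a::euclidean_space \<Rightarrow> ('a \<Rightarrow> real) \<Rightarrow> 'a set \<Rightarrow> bool" where
  "has_dir_deriv_on e f \<Omega> \<longleftrightarrow> (\<forall>x\<in>\<Omega>. (\<lambda>t. f (x + t *\<^sub>R e)) differentiable (at 0))"

definition sup_norm :: "'a set \<Rightarrow> ('a \<Rightarrow> real) \<Rightarrow> ennreal" where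
  "sup_norm \<Omega> f = (SUP x\<in>\<Omega>. ennreal \<bar>f x\<bar>)"

definition C0_norm :: "'a::topological_space set \<Rightarrow> ('a \<Rightarrow> real) \<Rightarrow> ennreal" where
  "C0_norm K f = (if continuous_on K f then sup_norm K f else top)"

definition holder_seminorm :: "real \<Rightarrow> 'a::metric_space set \<Rightarrow> ('a \<Rightarrow> real) \<Rightarrow> ennreal" where
  "holder_seminorm \<alpha> \<Omega> f =
     (SUP (x, y)\<in>{(x, y). x \<in> \<Omega> \<and> y \<in> \<Omega> \<and> x \<noteq> y}. ennreal (\<bar>f x - f y\<bar> / dist x y powr \<alpha>))"

text \<open>
  The norm of \<open>C\<^bsup>k,\<alpha>\<^esup>(\<Omega>)\<close> for open \<open>\<Omega>\<close>: the sum of the sup norms of all partial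
  derivatives of order at most \<open>k\<close> and of the Hoelder seminorms of those of order \<open>k\<close>.  The
  sum runs over sequences of coordinate directions rather than multi-indices, so a mixed
  derivative is counted with its multiplicity.
\<close>

fun holder_norm :: "nat \<Rightarrow> real \<Rightarrow> 'a::euclidean_space set \<Rightarrow> ('a \<Rightarrow> real) \<Rightarrow> ennreal" where
  "holder_norm 0 \<alpha> \<Omega> f = sup_norm \<Omega> f + holder_seminorm \<alpha> \<Omega> f"
| "holder_norm (Suc k) \<alpha> \<Omega> f =
     (if \<forall>e\<in>Basis. has_dir_deriv_on e f \<Omega>
      then sup_norm \<Omega> f + (\<Sum>e\<in>Basis. holder_norm k \<alpha> \<Omega> (dir_deriv e f))
      else top)"

text \<open>
  \<open>f \<in> C\<^bsup>2,\<alpha>\<^esup>(I)\<close> for a closed, possibly unbounded interval \<open>I\<close>, with first and second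
  derivatives \<open>f'\<close> and \<open>f''\<close> (one-sided at the end points): \<open>f''\<close> is uniformly
  Hoelder continuous on \<open>I\<close>; no boundedness is required at infinity.
\<close>

definition C2_holder :: "real \<Rightarrow> real set \<Rightarrow> (real \<Rightarrow> real) \<Rightarrow> (real \<Rightarrow> real) \<Rightarrow> (real \<Rightarrow> real) \<Rightarrow> bool" where
  "C2_holder \<alpha> I f f' f'' \<longleftrightarrow>
     (\<forall>x\<in>I. (f has_real_derivative f' x) (at x within I)) \<and>
     (\<forall>x\<in>I. (f' has_real_derivative f'' x) (at x within I)) \<and>
     (\<exists>H. \<forall>x\<in>I. \<forall>y\<in>I. \<bar>f'' x - f'' y\<bar> \<le> H * \<bar>x - y\<bar> powr \<alpha>)"

fun Ck :: "nat \<Rightarrow> ('a::euclidean_space \<Rightarrow> real) \<Rightarrow> bool" where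
  "Ck 0 f \<longleftrightarrow> continuous_on UNIV f"
| "Ck (Suc k) f \<longleftrightarrow> continuous_on UNIV f \<and>
     (\<forall>e\<in>Basis. has_dir_deriv_on e f UNIV \<and> Ck k (dir_deriv e f))"

definition test_function :: "'a::euclidean_space set \<Rightarrow> ('a \<Rightarrow> real) \<Rightarrow> bool" where
  "test_function \<Omega> \<eta> \<longleftrightarrow> (\<forall>k. Ck k \<eta>) \<and>
     compact (closure {x. \<eta> x \<noteq> 0}) \<and> closure {x. \<eta> x \<noteq> 0} \<subseteq> \<Omega>"

definition loc_integrable :: "'a::euclidean_space set \<Rightarrow> ('a \<Rightarrow> real) \<Rightarrow> bool" where
  "loc_integrable \<Omega> f \<longleftrightarrow> (\<forall>K. compact K \<and> K \<subseteq> \<Omega> \<longrightarrow> set_integrable lebesgue K f)"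

definition weak_deriv :: "'a::euclidean_space set \<Rightarrow> 'a \<Rightarrow> ('a \<Rightarrow> real) \<Rightarrow> ('a \<Rightarrow> real) \<Rightarrow> bool" where
  "weak_deriv \<Omega> e f g \<longleftrightarrow> loc_integrable \<Omega> f \<and> loc_integrable \<Omega> g \<and>
     (\<forall>\<eta>. test_function \<Omega> \<eta> \<longrightarrow>
        (LINT x:\<Omega>|lebesgue. f x * dir_deriv e \<eta> x) = - (LINT x:\<Omega>|lebesgue. g x * \<eta> x))"

definition ennreal_root :: "real \<Rightarrow> ennreal \<Rightarrow> ennreal" where
  "ennreal_root p x = (if x = top then top else ennreal (enn2real x powr (1 / p)))"

definition Lp_norm :: "real \<Rightarrow> 'a::euclidean_space set \<Rightarrow> ('a \<Rightarrow> real) \<Rightarrow> ennreal" where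
  "Lp_norm p \<Omega> f =
     (if set_borel_measurable lebesgue \<Omega> f
      then ennreal_root p (\<integral>\<^sup>+x\<in>\<Omega>. ennreal (\<bar>f x\<bar> powr p) \<partial>lebesgue)
      else top)"

text \<open>
  Weak derivatives are unique almost everywhere, so the infimum is over functions with the same
  norm; it is \<^term>\<open>top\<close> if there is no weak derivative.
\<close>

definition sobolev_norm :: "real \<Rightarrow> 'a::euclidean_space set \<Rightarrow> ('a \<Rightarrow> real) \<Rightarrow> ennreal" where
  "sobolev_norm p \<Omega> f =
     Lp_norm p \<Omega> f + (\<Sum>e\<in>Basis. INF g\<in>{g. weak_deriv \<Omega> e f g}. Lp_norm p \<Omega> g)"

definition slobodeckij_norm :: "real \<Rightarrow> real \<Rightarrow> 'a::euclidean_space set \<Rightarrow> ('a \<Rightarrow> real) \<Rightarrow> ennreal" where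
  "slobodeckij_norm s p \<Omega> g = Lp_norm p \<Omega> g +
     ennreal_root p (\<integral>\<^sup>+x\<in>\<Omega>. (\<integral>\<^sup>+y\<in>\<Omega>.
        ennreal (\<bar>g x - g y\<bar> powr p / dist x y powr (real DIM('a) + s * p)) \<partial>lebesgue) \<partial>lebesgue)"

abbreviation d1 :: "(real \<times> real \<Rightarrow> real) \<Rightarrow> real \<times> real \<Rightarrow> real" where
  "d1 \<equiv> dir_deriv (1, 0)"

abbreviation d2 :: "(real \<times> real \<Rightarrow> real) \<Rightarrow> real \<times> real \<Rightarrow> real" where
  "d2 \<equiv> dir_deriv (0, 1)"

text \<open>\<open>\<partial>\<^sub>1 F\<^sub>1 + \<partial>\<^sub>2 F\<^sub>2 = h\<close> in the sense of distributions on \<open>\<Omega>\<close>, for constant \<open>h\<close>.\<close>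

definition distr_div :: "(real \<times> real) set \<Rightarrow> (real \<times> real \<Rightarrow> real) \<Rightarrow> (real \<times> real \<Rightarrow> real) \<Rightarrow> real \<Rightarrow> bool" where
  "distr_div \<Omega> F1 F2 h \<longleftrightarrow> loc_integrable \<Omega> F1 \<and> loc_integrable \<Omega> F2 \<and>
     (\<forall>\<eta>. test_function \<Omega> \<eta> \<longrightarrow>
        - (LINT y:\<Omega>|lebesgue. F1 y * d1 \<eta> y + F2 y * d2 \<eta> y) = (LINT y:\<Omega>|lebesgue. h * \<eta> y))"

section \<open>Gas, background and data\<close>

text \<open>A state \<open>U = (p, \<theta>, q, S, Z)\<close>; note that \<open>5 = 0\<close> in the index type.\<close>

type_synonym state = "real ^ 5"

abbreviation pr :: "state \<Rightarrow> real" where "pr U \<equiv> U $ 1"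
abbreviation th :: "state \<Rightarrow> real" where "th U \<equiv> U $ 2"
abbreviation sp :: "state \<Rightarrow> real" where "sp U \<equiv> U $ 3"
abbreviation en :: "state \<Rightarrow> real" where "en U \<equiv> U $ 4"
abbreviation mf :: "state \<Rightarrow> real" where "mf U \<equiv> U $ 5"

record nozzle =
  gam :: real   \<comment> \<open>adiabatic exponent\<close>
  cv :: real    \<comment> \<open>specific heat at constant volume\<close>
  qe :: real    \<comment> \<open>heat release\<close>
  T0 :: real    \<comment> \<open>ignition temperature\<close>
  aexp :: real  \<comment> \<open>exponent \<open>a\<close> in the reaction rate\<close>
  Eact :: real  \<comment> \<open>activation energy\<close>
  R0 :: real    \<comment> \<open>gas constant in the reaction rate\<close>
  len :: real   \<comment> \<open>nozzle length \<open>L\<close>\<close>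
  bgm :: state  \<comment> \<open>supersonic background state ahead of the shock\<close>
  bgp :: state  \<comment> \<open>subsonic background state behind the shock\<close>
  Theta :: "real \<Rightarrow> real"
  Psig :: "real \<Rightarrow> real"
  Pkap :: "real \<Rightarrow> real"

definition rho :: "nozzle \<Rightarrow> state \<Rightarrow> real" where
  "rho N U = (pr U / ((gam N - 1) * exp (en U / cv N))) powr (1 / gam N)"

lemma rho_state_equation:
  assumes "gam N > 1" "pr U > 0"
  shows "rho N U > 0" "pr U = (gam N - 1) * exp (en U / cv N) * rho N U powr gam N"
  using assms by (simp_all add: rho_def powr_powr)

definition temp :: "nozzle \<Rightarrow> state \<Rightarrow> real" where
  "temp N U = pr U / ((gam N - 1) * cv N * rho N U)"

definition sound :: "nozzle \<Rightarrow> state \<Rightarrow> real" where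
  "sound N U = sqrt (gam N * pr U / rho N U)"

definition mach :: "nozzle \<Rightarrow> state \<Rightarrow> real" where
  "mach N U = sp U / sound N U"

definition u1 :: "state \<Rightarrow> real" where "u1 U = sp U * cos (th U)"
definition u2 :: "state \<Rightarrow> real" where "u2 U = sp U * sin (th U)"

definition bernoulli :: "nozzle \<Rightarrow> state \<Rightarrow> real" where
  "bernoulli N U = (sp U)\<^sup>2 / 2 + gam N * pr U / ((gam N - 1) * rho N U)"

definition phi :: "nozzle \<Rightarrow> real \<Rightarrow> real" where
  "phi N T = (if T > T0 N then T powr aexp N * exp (- (Eact N / (R0 N * (T - T0 N)))) else 0)"

definition gas :: "nozzle \<Rightarrow> bool" where
  "gas N \<longleftrightarrow> gam N > 1 \<and> cv N > 0 \<and> qe N > 0 \<and> T0 N > 0 \<and> aexp N > 0 \<and> Eact N > 0 \<and>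
     R0 N > 0 \<and> len N > 0"

definition background :: "nozzle \<Rightarrow> bool" where
  "background N \<longleftrightarrow>
     pr (bgm N) > 0 \<and> th (bgm N) = 0 \<and> mach N (bgm N) > 1 \<and> temp N (bgm N) > T0 N \<and>
     0 < mf (bgm N) \<and> mf (bgm N) \<le> 1 \<and>
     pr (bgp N) > 0 \<and> th (bgp N) = 0 \<and> mach N (bgp N) < 1 \<and> mf (bgp N) = mf (bgm N) \<and>
     rho N (bgm N) * sp (bgm N) = rho N (bgp N) * sp (bgp N) \<and>
     rho N (bgm N) * (sp (bgm N))\<^sup>2 + pr (bgm N) = rho N (bgp N) * (sp (bgp N))\<^sup>2 + pr (bgp N) \<and>
     bernoulli N (bgm N) = bernoulli N (bgp N) \<and>
     rho N (bgm N) * sp (bgm N) = 1 \<and> rho N (bgp N) * sp (bgp N) = 1"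

definition boundary_data :: "real \<Rightarrow> nozzle \<Rightarrow> bool" where
  "boundary_data \<alpha> N \<longleftrightarrow>
     (\<exists>\<Theta>' \<Theta>''. C2_holder \<alpha> {0..len N} (Theta N) \<Theta>' \<Theta>'' \<and> Theta N 0 = 0 \<and> \<Theta>' 0 = 0 \<and> \<Theta>'' 0 = 0) \<and>
     (\<exists>P' P''. C2_holder \<alpha> {0..} (Psig N) P' P'') \<and>
     (\<exists>P' P''. C2_holder \<alpha> {0..} (Pkap N) P' P'')"

section \<open>Solvability functions and the location of the shock\<close>

text \<open>The coefficients \<open>f\<^sub>1, f\<^sub>4, f\<^sub>5\<close> and \<open>(1 - M\<^sup>2) / (\<rho> q \<cdot> \<rho> q\<^sup>2)\<close> at a background state \<open>V\<close>.\<close>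

definition f1 :: "nozzle \<Rightarrow> state \<Rightarrow> real" where
  "f1 N V = 1 / (gam N * cv N) * (1 / (rho N V * (sp V)\<^sup>2)) * (phi N (temp N V) / temp N V) * qe N * mf V"

definition f4 :: "nozzle \<Rightarrow> state \<Rightarrow> real" where
  "f4 N V = 1 / sp V * (phi N (temp N V) / temp N V) * qe N * mf V"

definition f5 :: "nozzle \<Rightarrow> state \<Rightarrow> real" where
  "f5 N V = phi N (temp N V) / sp V * mf V"

definition acoef :: "nozzle \<Rightarrow> state \<Rightarrow> real" where
  "acoef N V = 1 / (rho N V * sp V) * ((1 - (mach N V)\<^sup>2) / (rho N V * (sp V)\<^sup>2))"

definition K1 :: "nozzle \<Rightarrow> real" where
  "K1 N = (pr (bgp N) - pr (bgm N)) *
     ((gam N - 1) / (gam N * pr (bgp N)) + 1 / (rho N (bgp N) * (sp (bgp N))\<^sup>2))"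

definition K2 :: "nozzle \<Rightarrow> real" where
  "K2 N = 1 / (gam N * cv N) * (1 / temp N (bgp N)) * qe N * mf (bgm N) *
     (phi N (temp N (bgp N)) / (rho N (bgp N) * (sp (bgp N))\<^sup>2) -
      phi N (temp N (bgm N)) / (rho N (bgm N) * (sp (bgm N))\<^sup>2))"

definition Rsig :: "nozzle \<Rightarrow> real \<Rightarrow> real" where
  "Rsig N \<xi> = integral {0..len N} (Theta N) - K1 N * integral {0..\<xi>} (Theta N)"

definition Rkap :: "nozzle \<Rightarrow> real \<Rightarrow> real" where
  "Rkap N \<xi> = - f1 N (bgp N) * len N + K2 N * \<xi>"

definition star :: "nozzle \<Rightarrow> (real \<Rightarrow> real) \<Rightarrow> real" where
  "star N P = acoef N (bgp N) * integral {0..1} P"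

definition RA :: "nozzle \<Rightarrow> real \<Rightarrow> real \<Rightarrow> real" where
  "RA N A \<xi> = A * Rsig N \<xi> + Rkap N \<xi>"

definition PA :: "nozzle \<Rightarrow> real \<Rightarrow> real \<Rightarrow> real" where
  "PA N A y = A * Psig N y + Pkap N y"

definition in_range :: "nozzle \<Rightarrow> (real \<Rightarrow> real) \<Rightarrow> real \<Rightarrow> bool" where
  "in_range N R x \<longleftrightarrow> (INF \<xi>\<in>{0<..<len N}. R \<xi>) < x \<and> x < (SUP \<xi>\<in>{0<..<len N}. R \<xi>)"

definition solvability_eq :: "nozzle \<Rightarrow> real \<Rightarrow> real \<Rightarrow> real \<Rightarrow> bool" where
  "solvability_eq N \<sigma> \<kappa> \<xi> \<longleftrightarrow>
     \<sigma> * Rsig N \<xi> + \<kappa> * Rkap N \<xi> = \<sigma> * star N (Psig N) + \<kappa> * star N (Pkap N)"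

text \<open>
  The four regimes with their parameters, which do not depend on \<open>\<sigma>\<close> and \<open>\<kappa>\<close>:
  \<open>H1 A\<^sub>1 s \<xi>\<^sub>* C\<close>, \<open>H2 A\<^sub>2 s \<xi>\<^sub>* C\<close>, \<open>H3 A \<xi>\<^sub>*\<close> and \<open>H4 \<xi>\<^sub>* \<beta>\<^sub>0\<close>, where \<open>C\<close> is the constant
  in the bound on the distance from \<open>\<xi>\<close> to \<open>\<xi>\<^sub>*\<close>.
\<close>

datatype regime =
    H1 real real real real
  | H2 real real real real
  | H3 real real
  | H4 real real

text \<open>\<open>matches N r \<sigma> \<kappa> \<xi>\<close>: \<open>\<sigma>, \<kappa>\<close> are in the regime \<open>r\<close> with the shock location \<open>\<xi>(\<sigma>, \<kappa>) = \<xi>\<close>.\<close>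

fun matches :: "nozzle \<Rightarrow> regime \<Rightarrow> real \<Rightarrow> real \<Rightarrow> real \<Rightarrow> bool" where
  "matches N (H1 A1 s \<xi>s C) \<sigma> \<kappa> \<xi> \<longleftrightarrow>
     s > 1 \<and> A1 > 0 \<and> \<kappa> = A1 * \<sigma> powr s \<and>
     in_range N (Rsig N) (star N (Psig N)) \<and>
     0 < \<xi>s \<and> \<xi>s < len N \<and> Rsig N \<xi>s = star N (Psig N) \<and> Theta N \<xi>s \<noteq> 0 \<and>
     0 < \<xi> \<and> \<xi> < len N \<and> solvability_eq N \<sigma> \<kappa> \<xi> \<and> \<bar>\<xi> - \<xi>s\<bar> \<le> C * \<sigma> powr (s - 1)"
| "matches N (H2 A2 s \<xi>s C) \<sigma> \<kappa> \<xi> \<longleftrightarrow>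
     s > 1 \<and> A2 > 0 \<and> \<sigma> = A2 * \<kappa> powr s \<and>
     in_range N (Rkap N) (star N (Pkap N)) \<and>
     0 < \<xi>s \<and> \<xi>s < len N \<and> Rkap N \<xi>s = star N (Pkap N) \<and>
     0 < \<xi> \<and> \<xi> < len N \<and> solvability_eq N \<sigma> \<kappa> \<xi> \<and> \<bar>\<xi> - \<xi>s\<bar> \<le> C * \<kappa> powr (s - 1)"
| "matches N (H3 A \<xi>s) \<sigma> \<kappa> \<xi> \<longleftrightarrow>
     A > 0 \<and> \<sigma> = A * \<kappa> \<and>
     in_range N (RA N A) (star N (PA N A)) \<and>
     0 < \<xi>s \<and> \<xi>s < len N \<and> RA N A \<xi>s = star N (PA N A) \<and> Theta N \<xi>s \<noteq> K2 N / (A * K1 N) \<and>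
     \<xi> = \<xi>s"
| "matches N (H4 \<xi>s \<beta>0) \<sigma> \<kappa> \<xi> \<longleftrightarrow>
     0 < \<xi>s \<and> \<xi>s < len N \<and> star N (Psig N) = Rsig N \<xi>s \<and> star N (Pkap N) = Rkap N \<xi>s \<and>
     \<xi> = \<xi>s \<and> \<beta>0 > 0 \<and> \<bar>\<kappa> * K2 N - \<sigma> * K1 N * Theta N \<xi>\<bar> \<ge> \<beta>0 * (\<sigma> + \<kappa>)"

section \<open>The linearized problem\<close>

text \<open>Shock relations for \<open>V\<close> behind and \<open>W\<close> ahead of the shock.\<close>

definition jump :: "(state \<Rightarrow> real) \<Rightarrow> state \<Rightarrow> state \<Rightarrow> real" where
  "jump w V W = w V - w W"

definition G1 :: "nozzle \<Rightarrow> state \<Rightarrow> state \<Rightarrow> real" where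
  "G1 N V W = jump (\<lambda>U. 1 / (rho N U * u1 U)) V W * jump pr V W +
     jump (\<lambda>U. u2 U / u1 U) V W * jump u2 V W"

definition G2 :: "nozzle \<Rightarrow> state \<Rightarrow> state \<Rightarrow> real" where
  "G2 N V W = jump (\<lambda>U. u1 U + pr U / (rho N U * u1 U)) V W * jump pr V W +
     jump (\<lambda>U. pr U * u2 U / u1 U) V W * jump u2 V W"

definition G3 :: "nozzle \<Rightarrow> state \<Rightarrow> state \<Rightarrow> real" where
  "G3 N V W = jump (bernoulli N) V W"

definition G4 :: "state \<Rightarrow> state \<Rightarrow> real" where
  "G4 V W = jump mf V W"

definition G5 :: "real \<Rightarrow> state \<Rightarrow> state \<Rightarrow> real" where
  "G5 \<psi>' V W = jump u2 V W - \<psi>' * jump pr V W"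

definition grad :: "(real ^ 'n \<Rightarrow> real) \<Rightarrow> real ^ 'n \<Rightarrow> real ^ 'n" where
  "grad f x = (\<chi> i. frechet_derivative f (at x) (axis i 1))"

text \<open>\<open>\<beta>\<^sub>+ \<cdot> V + \<beta>\<^sub>- \<cdot> W\<close> for the gradients \<open>\<beta>\<^sub>\<plusminus>\<close> of \<open>G\<close> at the background states.\<close>

definition lin_jump :: "nozzle \<Rightarrow> (state \<Rightarrow> state \<Rightarrow> real) \<Rightarrow> state \<Rightarrow> state \<Rightarrow> real" where
  "lin_jump N G V W =
     grad (\<lambda>X. G X (bgm N)) (bgp N) \<bullet> V + grad (\<lambda>X. G (bgp N) X) (bgm N) \<bullet> W"

definition Omega_m :: "real \<Rightarrow> (real \<times> real) set" where
  "Omega_m \<xi> = {0<..<\<xi>} \<times> {0<..<1}"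

definition Omega_p :: "nozzle \<Rightarrow> real \<Rightarrow> (real \<times> real) set" where
  "Omega_p N \<xi> = {\<xi><..<len N} \<times> {0<..<1}"

text \<open>
  The unknowns are total functions, but they are continuous up to the boundary of their rectangle,
  so that the boundary values below are genuine one-sided limits.
\<close>

definition supersonic_problem :: "nozzle \<Rightarrow> real \<Rightarrow> real \<Rightarrow> real \<Rightarrow> (real \<times> real \<Rightarrow> state) \<Rightarrow> bool" where
  "supersonic_problem N \<sigma> \<kappa> \<xi> U \<longleftrightarrow>
     (let V = bgm N; \<Omega> = Omega_m \<xi>;
          p = (\<lambda>y. pr (U y)); \<theta> = (\<lambda>y. th (U y)); q = (\<lambda>y. sp (U y));
          S = (\<lambda>y. en (U y)); Z = (\<lambda>y. mf (U y)) in
      continuous_on (closure \<Omega>) U \<and> U differentiable_on \<Omega> \<and>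
      (\<forall>y\<in>\<Omega>. d2 p y + sp V * d1 \<theta> y = 0 \<and>
              d2 \<theta> y - acoef N V * d1 p y = \<kappa> * f1 N V \<and>
              rho N V * sp V * d1 q y + d1 p y = 0 \<and>
              d1 S y = \<kappa> * f4 N V \<and>
              d1 Z y = - \<kappa> * f5 N V) \<and>
      (\<forall>y2\<in>{0<..<1}. U (0, y2) = 0) \<and>
      (\<forall>y1\<in>{0<..<\<xi>}. \<theta> (y1, 0) = 0 \<and> \<theta> (y1, 1) = \<sigma> * Theta N y1))"

text \<open>
  For \<open>\<beta> > 2\<close> functions in \<open>W\<^sup>1\<^sub>\<beta>\<close> of a rectangle are continuous up to the boundary, and their traces
  are the boundary values of the continuous representative.
\<close>

definition subsonic_problem :: "nozzle \<Rightarrow> real \<Rightarrow> real \<Rightarrow> real \<Rightarrow> (real \<times> real \<Rightarrow> state) \<Rightarrow> bool" where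
  "subsonic_problem N \<sigma> \<kappa> \<xi> U \<longleftrightarrow>
     (let V = bgp N; \<Omega> = Omega_p N \<xi>;
          p = (\<lambda>y. pr (U y)); \<theta> = (\<lambda>y. th (U y)); q = (\<lambda>y. sp (U y));
          S = (\<lambda>y. en (U y)); Z = (\<lambda>y. mf (U y)) in
      continuous_on (closure \<Omega>) U \<and>
      distr_div \<Omega> (\<lambda>y. sp V * \<theta> y) p 0 \<and>
      distr_div \<Omega> (\<lambda>y. - acoef N V * p y) \<theta> (\<kappa> * f1 N V) \<and>
      distr_div \<Omega> (\<lambda>y. sp V * q y + 1 / rho N V * p y + temp N V * S y + qe N * Z y) (\<lambda>y. 0) 0 \<and>
      distr_div \<Omega> S (\<lambda>y. 0) (\<kappa> * f4 N V) \<and>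
      distr_div \<Omega> Z (\<lambda>y. 0) (- \<kappa> * f5 N V) \<and>
      (\<forall>y2\<in>{0<..<1}. p (len N, y2) = \<sigma> * Psig N y2 + \<kappa> * Pkap N y2) \<and>
      (\<forall>y1\<in>{\<xi><..<len N}. \<theta> (y1, 0) = 0 \<and> \<theta> (y1, 1) = \<sigma> * Theta N y1))"

definition shock_conditions ::
  "nozzle \<Rightarrow> real \<Rightarrow> (real \<times> real \<Rightarrow> state) \<Rightarrow> (real \<times> real \<Rightarrow> state) \<Rightarrow> (real \<Rightarrow> real) \<Rightarrow> bool" where
  "shock_conditions N \<xi> Um Up \<psi>' \<longleftrightarrow>
     (\<forall>y2\<in>{0<..<1}. let V = Up (\<xi>, y2); W = Um (\<xi>, y2) in
        lin_jump N (G1 N) V W = 0 \<and> lin_jump N (G2 N) V W = 0 \<and> lin_jump N (G3 N) V W = 0 \<and>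
        lin_jump N G4 V W = 0 \<and>
        lin_jump N (G5 0) V W - jump pr (bgp N) (bgm N) * \<psi>' y2 = 0)"

definition linearized_problem ::
  "nozzle \<Rightarrow> real \<Rightarrow> real \<Rightarrow> real \<Rightarrow> (real \<times> real \<Rightarrow> state) \<Rightarrow> (real \<times> real \<Rightarrow> state) \<Rightarrow> (real \<Rightarrow> real) \<Rightarrow> bool" where
  "linearized_problem N \<sigma> \<kappa> \<xi> Um Up \<psi>' \<longleftrightarrow>
     supersonic_problem N \<sigma> \<kappa> \<xi> Um \<and> subsonic_problem N \<sigma> \<kappa> \<xi> Up \<and> shock_conditions N \<xi> Um Up \<psi>'"

definition norm_m :: "real \<Rightarrow> real \<Rightarrow> (real \<times> real \<Rightarrow> state) \<Rightarrow> ennreal" where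
  "norm_m \<alpha> \<xi> U = (\<Sum>i\<in>UNIV. holder_norm 2 \<alpha> (Omega_m \<xi>) (\<lambda>y. U y $ i))"

text \<open>Functions on the shock \<open>{\<xi>} \<times> (0, 1)\<close> are identified with functions of \<open>y\<^sub>2\<close>.\<close>

definition norm_shock :: "real \<Rightarrow> (real \<Rightarrow> real) \<Rightarrow> ennreal" where
  "norm_shock \<beta> g = slobodeckij_norm (1 - 1 / \<beta>) \<beta> {0<..<1} g"

definition norm_p :: "nozzle \<Rightarrow> real \<Rightarrow> real \<Rightarrow> (real \<times> real \<Rightarrow> state) \<Rightarrow> ennreal" where
  "norm_p N \<beta> \<xi> U =
     sobolev_norm \<beta> (Omega_p N \<xi>) (\<lambda>y. pr (U y)) + sobolev_norm \<beta> (Omega_p N \<xi>) (\<lambda>y. th (U y)) +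
     (\<Sum>i\<in>{3, 4, 5}. C0_norm (closure (Omega_p N \<xi>)) (\<lambda>y. U y $ i)) +
     (\<Sum>i\<in>{3, 4, 5}. norm_shock \<beta> (\<lambda>y2. U (\<xi>, y2) $ i))"

end

theory Submission
  imports Defs
begin

text \<open>
  The three parts of the linearized problem can be solved one after the other, each of them by explicit formulas.

  Ahead of the shock the equations for pressure and angle are hyperbolic.  The solution consists of a term linear in
  \<open>y\<^sub>1\<close> for the heat source and of finitely many waves that the upper wall emits and the walls reflect.  It is of class
  \<open>C\<^bsup>2,\<alpha>\<^esup>\<close> because the wall profile vanishes to second order at the entrance (\<open>supersonic_exists\<close>).

  On the shock four of the linearized relations determine pressure, speed, entropy and reactant behind the shock from the
  state ahead of it, and the fifth one determines the slope of the shock once the angle behind it is known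
  (\<open>linearized_shock_relations\<close>).

  Behind the shock the equations for pressure and angle are elliptic, a stretched Cauchy-Riemann system in a rectangle, with
  the pressure given on the vertical edges and the angle on the horizontal ones.  This amounts to a Neumann problem, which is
  solvable when one condition on the mean values of the data holds.  With the mean supersonic pressure inserted, that
  condition is precisely the solvability equation for the location of the shock.  An affine flow accounts for
  the mean values, and the rest is a sum of three flows, each with data on a single edge and each given by a
  trigonometric series (\<open>edge_flow_exists\<close>, \<open>channel_flow_exists\<close>).

  The boundary data have two derivatives but do not match at the corners, so the coefficients of these series decay like
  \<open>1 / n\<^sup>2\<close> and no faster, and the gradient has logarithmic singularities.  Instead of general \<open>L\<^sup>p\<close> theory an elementary
  estimate is enough.  At distance \<open>t\<close> from the edge the \<open>n\<close>-th mode has decayed by \<open>exp (- n \<pi> t) \<le> (n \<pi> t)\<^bsup>-e\<^esup>\<close>,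
  so the gradient is at most a constant times \<open>t\<^bsup>-e\<^esup>\<close> for any \<open>e > 0\<close>.  With \<open>e = 1 / (2 \<beta>)\<close> its \<open>\<beta>\<close>-th power is
  integrable (\<open>Lp_norm_edge_weight\<close>).  By the same series pressure and angle are Hoelder continuous with exponent
  \<open>1 - e\<close>, which puts their traces into the Slobodeckij space on the shock (\<open>norm_shock_le\<close>).

  All constants are linear in the data and depend on the location of the shock only through a lower bound for its distance
  to the exit.
\<close>

section \<open>Bounds for the norms\<close>

lemma Basis_real2: "(Basis :: (real \<times> real) set) = {(1, 0), (0, 1)}"
  by (auto simp: Basis_prod_def)

lemma sup_norm_le: "(\<And>x. x \<in> \<Omega> \<Longrightarrow> \<bar>f x\<bar> \<le> B) \<Longrightarrow> sup_norm \<Omega> f \<le> ennreal B"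
  unfolding sup_norm_def by (intro SUP_least ennreal_leI)

lemma C0_norm_le:
  "continuous_on K f \<Longrightarrow> (\<And>x. x \<in> K \<Longrightarrow> \<bar>f x\<bar> \<le> B) \<Longrightarrow> C0_norm K f \<le> ennreal B"
  unfolding C0_norm_def by (simp add: sup_norm_le)

lemma holder_seminorm_le:
  assumes "\<And>x y. x \<in> \<Omega> \<Longrightarrow> y \<in> \<Omega> \<Longrightarrow> \<bar>f x - f y\<bar> \<le> B * dist x y powr \<alpha>"
  shows "holder_seminorm \<alpha> \<Omega> f \<le> ennreal B"
  unfolding holder_seminorm_def
proof (intro SUP_least, clarsimp, intro ennreal_leI)
  fix x y assume "x \<in> \<Omega>" "y \<in> \<Omega>" "x \<noteq> y"
  then show "\<bar>f x - f y\<bar> / dist x y powr \<alpha> \<le> B"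
    using assms[of x y] by (simp add: pos_divide_le_eq)
qed

text \<open>
  Only the values near a point matter for a directional derivative, so a formula that holds on an open
  set may be differentiated there, whatever the function is elsewhere.
\<close>

lemma has_dir_deriv_transfer:
  fixes f g :: "'a::euclidean_space \<Rightarrow> real"
  assumes "open \<Omega>" "x \<in> \<Omega>" "\<And>y. y \<in> \<Omega> \<Longrightarrow> f y = g y"
    and "((\<lambda>t. f (x + t *\<^sub>R e)) has_real_derivative D) (at 0)"
  shows "((\<lambda>t. g (x + t *\<^sub>R e)) has_real_derivative D) (at 0)"
proof (rule has_field_derivative_transform_within_open[OF assms(4)])
  show "open ((\<lambda>t. x + t *\<^sub>R e) -` \<Omega>)"
    by (rule open_vimage[OF assms(1)]) (intro continuous_intros)
qed (use assms in auto)

lemma dir_deriv_eq: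
  "((\<lambda>t. f (x + t *\<^sub>R e)) has_real_derivative D) (at 0) \<Longrightarrow> dir_deriv e f x = D"
  unfolding dir_deriv_def by (rule DERIV_imp_deriv)

text \<open>
  The recursion of the norm differentiates \<open>dir_deriv e f\<close>, of which only the values on \<open>\<Omega>\<close> are
  controlled; there it equals the explicit derivative \<open>F e\<close>.  The factor is \<open>11 = 1 + 2 (1 + 2 (1 + 1))\<close>: one
  term of order 0, two of order 1, and four of order 2 with a sup norm and a seminorm each.
\<close>

lemma holder_norm_2_le:
  fixes f :: "real \<times> real \<Rightarrow> real"
  assumes O: "open \<Omega>" and B: "0 \<le> B"
    and d1: "\<And>e x. e \<in> Basis \<Longrightarrow> x \<in> \<Omega> \<Longrightarrow> ((\<lambda>t. f (x + t *\<^sub>R e)) has_real_derivative F e x) (at 0)"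
    and d2: "\<And>e e' x. e \<in> Basis \<Longrightarrow> e' \<in> Basis \<Longrightarrow> x \<in> \<Omega> \<Longrightarrow>
       ((\<lambda>t. F e (x + t *\<^sub>R e')) has_real_derivative G e e' x) (at 0)"
    and b0: "\<And>x. x \<in> \<Omega> \<Longrightarrow> \<bar>f x\<bar> \<le> B"
    and b1: "\<And>e x. e \<in> Basis \<Longrightarrow> x \<in> \<Omega> \<Longrightarrow> \<bar>F e x\<bar> \<le> B"
    and b2: "\<And>e e' x. e \<in> Basis \<Longrightarrow> e' \<in> Basis \<Longrightarrow> x \<in> \<Omega> \<Longrightarrow> \<bar>G e e' x\<bar> \<le> B"
    and b3: "\<And>e e' x y. e \<in> Basis \<Longrightarrow> e' \<in> Basis \<Longrightarrow> x \<in> \<Omega> \<Longrightarrow> y \<in> \<Omega> \<Longrightarrow>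
       \<bar>G e e' x - G e e' y\<bar> \<le> B * dist x y powr \<alpha>"
  shows "holder_norm 2 \<alpha> \<Omega> f \<le> ennreal (11 * B)"
proof -
  have sum2: "(\<Sum>e\<in>Basis. a e) \<le> ennreal (2 * K)"
    if "\<And>e. e \<in> Basis \<Longrightarrow> a e \<le> ennreal K" "0 \<le> K" for a :: "real \<times> real \<Rightarrow> ennreal" and K
  proof -
    have "(\<Sum>e\<in>Basis. a e) \<le> of_nat (card (Basis :: (real \<times> real) set)) * ennreal K"
      by (rule sum_bounded_above) (rule that(1))
    then show ?thesis by (simp add: Basis_real2 ennreal_mult')
  qed
  have f1: "dir_deriv e f x = F e x" if "e \<in> Basis" "x \<in> \<Omega>" for e x
    by (rule dir_deriv_eq) (rule d1[OF that])
  have d2': "((\<lambda>t. dir_deriv e f (x + t *\<^sub>R e')) has_real_derivative G e e' x) (at 0)"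
    if "e \<in> Basis" "e' \<in> Basis" "x \<in> \<Omega>" for e e' x
    by (rule has_dir_deriv_transfer[OF O that(3) _ d2[OF that]]) (simp add: f1 that)
  have f2: "dir_deriv e' (dir_deriv e f) x = G e e' x" if "e \<in> Basis" "e' \<in> Basis" "x \<in> \<Omega>" for e e' x
    by (rule dir_deriv_eq) (rule d2'[OF that])
  have h0: "holder_norm 0 \<alpha> \<Omega> (dir_deriv e' (dir_deriv e f)) \<le> ennreal (2 * B)"
    if "e \<in> Basis" "e' \<in> Basis" for e e'
  proof -
    have "holder_norm 0 \<alpha> \<Omega> (dir_deriv e' (dir_deriv e f)) \<le> ennreal B + ennreal B"
      unfolding holder_norm.simps
      by (intro add_mono sup_norm_le holder_seminorm_le) (simp_all add: f2 that b2 b3)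
    then show ?thesis using B by (simp add: ennreal_plus[symmetric] del: ennreal_plus)
  qed
  have h1: "holder_norm (Suc 0) \<alpha> \<Omega> (dir_deriv e f) \<le> ennreal (5 * B)" if e: "e \<in> Basis" for e
  proof -
    have "\<forall>e'\<in>Basis. has_dir_deriv_on e' (dir_deriv e f) \<Omega>"
      unfolding has_dir_deriv_on_def using d2'[OF e] unfolding real_differentiable_def by blast
    then have "holder_norm (Suc 0) \<alpha> \<Omega> (dir_deriv e f) =
       sup_norm \<Omega> (dir_deriv e f) + (\<Sum>e'\<in>Basis. holder_norm 0 \<alpha> \<Omega> (dir_deriv e' (dir_deriv e f)))"
      unfolding holder_norm.simps(2) by (rule if_P)
    also have "\<dots> \<le> ennreal B + ennreal (2 * (2 * B))"
      using B by (intro add_mono sup_norm_le sum2 h0 e) (simp_all add: f1 e b1)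
    finally show ?thesis using B by (simp add: ennreal_plus[symmetric] del: ennreal_plus)
  qed
  have "\<forall>e\<in>Basis. has_dir_deriv_on e f \<Omega>"
    unfolding has_dir_deriv_on_def using d1 unfolding real_differentiable_def by blast
  then have "holder_norm 2 \<alpha> \<Omega> f = sup_norm \<Omega> f + (\<Sum>e\<in>Basis. holder_norm (Suc 0) \<alpha> \<Omega> (dir_deriv e f))"
    unfolding holder_norm.simps(2) numeral_2_eq_2 by (rule if_P)
  also have "\<dots> \<le> ennreal B + ennreal (2 * (5 * B))"
    using B by (intro add_mono sup_norm_le sum2 h1) (simp_all add: b0)
  finally show ?thesis using B by (simp add: ennreal_plus[symmetric] del: ennreal_plus)
qed

lemma ennreal_root_le:
  assumes "x \<le> ennreal I" "0 \<le> I" "0 < p"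
  shows "ennreal_root p x \<le> ennreal (I powr (1 / p))"
proof -
  obtain r where r: "x = ennreal r" "0 \<le> r"
    using assms(1) by (cases x) (auto simp: top_unique)
  then have "r \<le> I" using assms by (simp add: ennreal_le_iff)
  then show ?thesis using r assms by (auto simp: ennreal_root_def intro!: ennreal_leI powr_mono2)
qed

lemma Lp_norm_le:
  assumes "set_borel_measurable lebesgue \<Omega> f" "0 < p" "0 \<le> I"
    and "(\<integral>\<^sup>+x\<in>\<Omega>. ennreal (\<bar>f x\<bar> powr p) \<partial>lebesgue) \<le> ennreal I"
  shows "Lp_norm p \<Omega> f \<le> ennreal (I powr (1 / p))"
  unfolding Lp_norm_def using assms by (simp add: ennreal_root_le)

lemma set_borel_measurable_continuous:
  fixes f :: "'a::euclidean_space \<Rightarrow> real"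
  assumes "open \<Omega>" "continuous_on \<Omega> f"
  shows "set_borel_measurable lebesgue \<Omega> f"
proof -
  have "set_borel_measurable borel \<Omega> f"
    by (rule set_measurable_continuous_on) (use assms in auto)
  then show ?thesis unfolding set_borel_measurable_def
    by (metis borel_measurable_if_lebesgue_on measurable_completion measurable_lborel2)
qed

text \<open>
  The exponent \<open>- 1 / 2\<close> is the one to which all singular integrals below reduce.
\<close>

lemma nn_integral_inv_sqrt_left:
  fixes a b :: real assumes "a \<le> b"
  shows "(\<integral>\<^sup>+x. ennreal ((x - a) powr (- (1 / 2)) * indicator {a<..<b} x) \<partial>lborel) = ennreal (2 * sqrt (b - a))"
proof -
  have "((\<lambda>x. (x - a) powr (- (1 / 2))) has_integral (2 * sqrt (b - a) - 2 * sqrt (a - a))) {a..b}"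
  proof (rule fundamental_theorem_of_calculus_interior)
    fix x assume x: "x \<in> {a<..<b}"
    then have "((\<lambda>x. 2 * sqrt (x - a)) has_real_derivative 2 * (inverse (sqrt (x - a)) / 2)) (at x)"
      by (auto intro!: derivative_eq_intros)
    also have "2 * (inverse (sqrt (x - a)) / 2) = (x - a) powr (- (1 / 2))"
      using x by (simp add: powr_minus powr_half_sqrt)
    finally show "((\<lambda>x. 2 * sqrt (x - a)) has_vector_derivative (x - a) powr (- (1 / 2))) (at x)"
      by (simp add: has_real_derivative_iff_has_vector_derivative)
  qed (use assms in \<open>auto intro!: continuous_intros\<close>)
  then have "((\<lambda>x. (x - a) powr (- (1 / 2))) has_integral 2 * sqrt (b - a)) {a<..<b}"
    by (simp add: has_integral_Icc_iff_Ioo)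
  from nn_integral_has_integral_lebesgue'[OF _ this] show ?thesis
    by (simp add: ennreal_mult'' ennreal_indicator)
qed

lemma nn_integral_inv_sqrt_right:
  fixes a b :: real assumes "a \<le> b"
  shows "(\<integral>\<^sup>+x. ennreal ((b - x) powr (- (1 / 2)) * indicator {a<..<b} x) \<partial>lborel) = ennreal (2 * sqrt (b - a))"
proof -
  have "((\<lambda>x. (b - x) powr (- (1 / 2))) has_integral (- 2 * sqrt (b - b) - (- 2 * sqrt (b - a)))) {a..b}"
  proof (rule fundamental_theorem_of_calculus_interior)
    fix x assume x: "x \<in> {a<..<b}"
    then have "((\<lambda>x. - 2 * sqrt (b - x)) has_real_derivative 2 * (inverse (sqrt (b - x)) / 2)) (at x)"
      by (auto intro!: derivative_eq_intros)
    also have "2 * (inverse (sqrt (b - x)) / 2) = (b - x) powr (- (1 / 2))"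
      using x by (simp add: powr_minus powr_half_sqrt)
    finally show "((\<lambda>x. - 2 * sqrt (b - x)) has_vector_derivative (b - x) powr (- (1 / 2))) (at x)"
      by (simp add: has_real_derivative_iff_has_vector_derivative)
  qed (use assms in \<open>auto intro!: continuous_intros\<close>)
  then have "((\<lambda>x. (b - x) powr (- (1 / 2))) has_integral 2 * sqrt (b - a)) {a<..<b}"
    by (simp add: has_integral_Icc_iff_Ioo)
  from nn_integral_has_integral_lebesgue'[OF _ this] show ?thesis
    by (simp add: ennreal_mult'' ennreal_indicator)
qed

lemma nn_integral_rectangle:
  fixes f g :: "real \<Rightarrow> real"
  assumes [measurable]: "f \<in> borel_measurable borel" "g \<in> borel_measurable borel"
    and "\<And>x. 0 \<le> f x" "\<And>x. 0 \<le> g x"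
    and f: "(\<integral>\<^sup>+x. ennreal (f x * indicator {a<..<b} x) \<partial>lborel) = ennreal I"
    and g: "(\<integral>\<^sup>+x. ennreal (g x * indicator {c<..<d} x) \<partial>lborel) = ennreal J" and "0 \<le> I"
  shows "(\<integral>\<^sup>+y. ennreal (f (fst y) * g (snd y)) * indicator ({a<..<b} \<times> {c<..<d}) y \<partial>lborel) = ennreal (I * J)"
proof -
  define F where "F b' x = ennreal (if b' = (1, 0) then f x * indicator {a<..<b} x else g x * indicator {c<..<d} x)"
    for b' :: "real \<times> real" and x
  have "(\<integral>\<^sup>+y. (\<Prod>b\<in>Basis. F b (y \<bullet> b)) \<partial>lborel) = (\<Prod>b\<in>Basis. (\<integral>\<^sup>+x. F b x \<partial>lborel))"
  proof (rule nn_integral_lborel_prod)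
    show "F b' \<in> borel_measurable borel" for b' unfolding F_def[abs_def] by (cases "b' = (1, 0)") auto
  qed auto
  moreover have "(\<Prod>b\<in>Basis. (\<integral>\<^sup>+x. F b x \<partial>lborel)) = ennreal (I * J)"
    using f g assms by (simp add: Basis_real2 F_def ennreal_mult')
  moreover have "(\<Prod>b\<in>Basis. F b (y \<bullet> b)) = ennreal (f (fst y) * g (snd y)) * indicator ({a<..<b} \<times> {c<..<d}) y" for y
    by (cases y) (auto simp: Basis_real2 F_def indicator_def ennreal_mult' assms)
  ultimately show ?thesis by simp
qed

lemma continuous_on_holder:
  fixes f :: "'a::metric_space \<Rightarrow> real"
  assumes h: "\<And>x y. x \<in> S \<Longrightarrow> y \<in> S \<Longrightarrow> \<bar>f x - f y\<bar> \<le> M * dist x y powr \<alpha>" and \<alpha>: "\<alpha> > 0"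
  shows "continuous_on S f"
proof (rule continuous_onI)
  fix x and d :: real assume x: "x \<in> S" and d: "0 < d"
  define r where "r = (d / (\<bar>M\<bar> + 1)) powr (1 / \<alpha>)"
  have r: "r > 0" using d by (simp add: r_def)
  have "dist (f y) (f x) \<le> d" if y: "y \<in> S" "dist y x < r" for y
  proof -
    have "dist y x powr \<alpha> \<le> r powr \<alpha>"
      using y \<alpha> by (intro powr_mono2) auto
    also have "\<dots> = d / (\<bar>M\<bar> + 1)" using \<alpha> d by (simp add: r_def powr_powr)
    finally have "\<bar>M\<bar> * dist y x powr \<alpha> \<le> \<bar>M\<bar> * (d / (\<bar>M\<bar> + 1))" by (rule mult_left_mono) simp
    also have "\<dots> \<le> d" using d by (simp add: field_simps)
    finally have "\<bar>M\<bar> * dist y x powr \<alpha> \<le> d" .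
    moreover have "M * dist y x powr \<alpha> \<le> \<bar>M\<bar> * dist y x powr \<alpha>" by (intro mult_right_mono) auto
    ultimately show ?thesis using h[OF y(1) x] by (simp add: dist_real_def)
  qed
  then show "\<exists>r>0. \<forall>y\<in>S. dist y x < r \<longrightarrow> dist (f y) (f x) \<le> d" using r by blast
qed

text \<open>
  The growth that is allowed for gradients on \<open>(a, b) \<times> (0, 1)\<close>: they may blow up like a small negative power
  of the distance to the left, right and upper edge, which carry boundary data.  The data on the lower edge are
  homogeneous.  The summand 1 lets the weight majorize bounded functions as well.
\<close>

definition edge_weight :: "real \<Rightarrow> real \<Rightarrow> real \<Rightarrow> real \<times> real \<Rightarrow> real" where
  "edge_weight e a b y = 1 + (fst y - a) powr (- e) + (b - fst y) powr (- e) + (1 - snd y) powr (- e)"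

lemma edge_weight_ge_1: "1 \<le> edge_weight e a b y"
  by (simp add: edge_weight_def)

lemma powr_sum4_le:
  fixes a b c d p :: real
  assumes "0 \<le> a" "0 \<le> b" "0 \<le> c" "0 \<le> d" "0 < p"
  shows "(a + b + c + d) powr p \<le> 4 powr p * (a powr p + b powr p + c powr p + d powr p)"
proof -
  define m where "m = max (max a b) (max c d)"
  have "(a + b + c + d) powr p \<le> (4 * m) powr p"
    using assms by (intro powr_mono2) (auto simp: m_def)
  also have "\<dots> = 4 powr p * m powr p" using assms by (simp add: powr_mult m_def)
  also have "m powr p \<le> a powr p + b powr p + c powr p + d powr p"
    using powr_ge_zero[of a p] powr_ge_zero[of b p] powr_ge_zero[of c p] powr_ge_zero[of d p]
    by (auto simp: m_def max_def simp del: powr_ge_zero)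
  finally show ?thesis by simp
qed

text \<open>
  For the exponent \<open>1 / (2 \<beta>)\<close> the \<open>\<beta>\<close>-th power of a distance term is the distance to the power \<open>- 1 / 2\<close>,
  which is integrable.  The constant depends on an upper bound for the width only.
\<close>

lemma Lp_norm_edge_weight:
  fixes \<beta> L :: real
  assumes \<beta>: "\<beta> > 0" and L: "L > 0"
  obtains K where "0 \<le> K"
    "\<And>a b f M. a \<le> b \<Longrightarrow> b - a \<le> L \<Longrightarrow> 0 \<le> M \<Longrightarrow> continuous_on ({a<..<b} \<times> {0<..<1}) f \<Longrightarrow>
       (\<And>y. y \<in> {a<..<b} \<times> {0<..<1} \<Longrightarrow> \<bar>f y\<bar> \<le> M * edge_weight (1 / (2 * \<beta>)) a b y) \<Longrightarrow>
       Lp_norm \<beta> ({a<..<b} \<times> {0<..<1}) f \<le> ennreal (K * M)"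
proof -
  define e where "e = 1 / (2 * \<beta>)"
  define J where "J = L + 2 * sqrt L + 2 * sqrt L + L * 2"
  have J0: "0 \<le> J" using L by (simp add: J_def)
  show ?thesis
  proof (rule that[of "4 * J powr (1 / \<beta>)"])
    show "0 \<le> 4 * J powr (1 / \<beta>)" by simp
    fix a b f M
    assume ab: "a \<le> b" "b - a \<le> L" and M: "0 \<le> M" and cont: "continuous_on ({a<..<b} \<times> {0<..<1}) f"
      and bd: "\<And>y. y \<in> {a<..<b} \<times> {0<..<1} \<Longrightarrow> \<bar>f y\<bar> \<le> M * edge_weight (1 / (2 * \<beta>)) a b y"
    let ?\<Omega> = "{a<..<b} \<times> {0::real<..<1}"
    define \<gamma> where "\<gamma> = - (1 / 2 :: real)"
    have e\<beta>: "(- e) * \<beta> = \<gamma>" using \<beta> by (simp add: e_def \<gamma>_def)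
    define A where "A = M powr \<beta> * 4 powr \<beta>"
    define g1 where "g1 y = 1 * (1::real)" for y :: "real \<times> real"
    define g2 where "g2 y = (fst y - a) powr \<gamma> * 1" for y :: "real \<times> real"
    define g3 where "g3 y = (b - fst y) powr \<gamma> * 1" for y :: "real \<times> real"
    define g4 where "g4 y = 1 * (1 - snd y) powr \<gamma>" for y :: "real \<times> real"
    have A0: "A \<ge> 0" by (simp add: A_def)
    have pw: "\<bar>f y\<bar> powr \<beta> \<le> A * (g1 y + g2 y + g3 y + g4 y)" if y: "y \<in> ?\<Omega>" for y
    proof -
      have "\<bar>f y\<bar> powr \<beta> \<le> (M * edge_weight e a b y) powr \<beta>"
        using bd[OF y] \<beta> by (intro powr_mono2) (auto simp: e_def)
      also have "\<dots> = M powr \<beta> * edge_weight e a b y powr \<beta>"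
        using M edge_weight_ge_1[of e a b y] by (simp add: powr_mult)
      also have "edge_weight e a b y powr \<beta> \<le> 4 powr \<beta> * (g1 y + g2 y + g3 y + g4 y)"
        using powr_sum4_le[of 1 "(fst y - a) powr (- e)" "(b - fst y) powr (- e)" "(1 - snd y) powr (- e)" \<beta>] \<beta>
        unfolding edge_weight_def powr_powr e\<beta> g1_def g2_def g3_def g4_def by simp
      finally show ?thesis using M by (simp add: A_def mult_left_mono mult.assoc)
    qed
    have one: "(\<integral>\<^sup>+x. ennreal (1 * indicator {c<..<d} x) \<partial>lborel) = ennreal (d - c)" if "c \<le> d" for c d :: real
      using that by (simp add: ennreal_indicator)
    have [measurable]: "g1 \<in> borel_measurable borel" "g2 \<in> borel_measurable borel" 
      "g3 \<in> borel_measurable borel" "g4 \<in> borel_measurable borel"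
      unfolding g1_def[abs_def] g2_def[abs_def] g3_def[abs_def] g4_def[abs_def]
      by (auto simp: borel_prod[symmetric])
    have \<Omega>m [measurable]: "?\<Omega> \<in> sets borel" by (intro borel_open open_Times) auto
    have I1: "(\<integral>\<^sup>+y. ennreal (g1 y) * indicator ?\<Omega> y \<partial>lborel) = ennreal ((b - a) * (1 - 0))"
      unfolding g1_def by (rule nn_integral_rectangle) (use ab one in auto)
    have I2: "(\<integral>\<^sup>+y. ennreal (g2 y) * indicator ?\<Omega> y \<partial>lborel) = ennreal (2 * sqrt (b - a) * (1 - 0))"
      unfolding g2_def by (rule nn_integral_rectangle) (use ab one nn_integral_inv_sqrt_left[of a b] in \<open>auto simp: \<gamma>_def\<close>)
    have I3: "(\<integral>\<^sup>+y. ennreal (g3 y) * indicator ?\<Omega> y \<partial>lborel) = ennreal (2 * sqrt (b - a) * (1 - 0))"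
      unfolding g3_def by (rule nn_integral_rectangle) (use ab one nn_integral_inv_sqrt_right[of a b] in \<open>auto simp: \<gamma>_def\<close>)
    have I4: "(\<integral>\<^sup>+y. ennreal (g4 y) * indicator ?\<Omega> y \<partial>lborel) = ennreal ((b - a) * (2 * sqrt (1 - 0)))"
      unfolding g4_def by (rule nn_integral_rectangle) (use ab one nn_integral_inv_sqrt_right[of 0 1] in \<open>auto simp: \<gamma>_def\<close>)
    have "(\<integral>\<^sup>+y\<in>?\<Omega>. ennreal (\<bar>f y\<bar> powr \<beta>) \<partial>lebesgue) \<le>
      (\<integral>\<^sup>+y. ennreal A * (ennreal (g1 y) * indicator ?\<Omega> y + ennreal (g2 y) * indicator ?\<Omega> y +
          ennreal (g3 y) * indicator ?\<Omega> y + ennreal (g4 y) * indicator ?\<Omega> y) \<partial>lborel)"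
      unfolding nn_integral_completion
    proof (rule nn_integral_mono)
      fix y :: "real \<times> real"
      have g0: "g1 y \<ge> 0" "g2 y \<ge> 0" "g3 y \<ge> 0" "g4 y \<ge> 0" by (auto simp: g1_def g2_def g3_def g4_def)
      show "ennreal (\<bar>f y\<bar> powr \<beta>) * indicator ?\<Omega> y \<le> ennreal A * (ennreal (g1 y) * indicator ?\<Omega> y +
        ennreal (g2 y) * indicator ?\<Omega> y + ennreal (g3 y) * indicator ?\<Omega> y + ennreal (g4 y) * indicator ?\<Omega> y)"
      proof (cases "y \<in> ?\<Omega>")
        case True
        have "ennreal (\<bar>f y\<bar> powr \<beta>) \<le> ennreal (A * (g1 y + g2 y + g3 y + g4 y))"
          by (rule ennreal_leI[OF pw[OF True]])
        also have "\<dots> = ennreal A * (ennreal (g1 y) + ennreal (g2 y) + ennreal (g3 y) + ennreal (g4 y))"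
          using A0 g0 by (simp add: ennreal_mult)
        finally show ?thesis using True by simp
      qed simp
    qed
    also have "\<dots> = ennreal A * (ennreal ((b - a) * (1 - 0)) + ennreal (2 * sqrt (b - a) * (1 - 0)) +
        ennreal (2 * sqrt (b - a) * (1 - 0)) + ennreal ((b - a) * (2 * sqrt (1 - 0))))"
      by (subst nn_integral_cmult, measurable) (simp add: nn_integral_add I1 I2 I3 I4)
    also have "\<dots> = ennreal (A * ((b - a) + 2 * sqrt (b - a) + 2 * sqrt (b - a) + (b - a) * 2))"
    proof -
      have "ennreal A * (ennreal x1 + ennreal x2 + ennreal x3 + ennreal x4) = ennreal (A * (x1 + x2 + x3 + x4))"
        if "0 \<le> x1" "0 \<le> x2" "0 \<le> x3" "0 \<le> x4" for x1 x2 x3 x4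
        using that A0 by (simp add: ennreal_mult)
      from this[of "b - a" "2 * sqrt (b - a)" "2 * sqrt (b - a)" "(b - a) * 2"] show ?thesis
        using ab by simp
    qed
    also have "\<dots> \<le> ennreal (A * J)"
      using ab A0 unfolding J_def by (intro ennreal_leI mult_left_mono add_mono mult_right_mono real_sqrt_le_mono) auto
    finally have "Lp_norm \<beta> ?\<Omega> f \<le> ennreal ((A * J) powr (1 / \<beta>))"
      by (intro Lp_norm_le set_borel_measurable_continuous cont open_Times) (use \<beta> A0 J0 in auto)
    also have "(A * J) powr (1 / \<beta>) = 4 * J powr (1 / \<beta>) * M"
      using \<beta> M J0 by (simp add: A_def powr_mult powr_powr)
    finally show "Lp_norm \<beta> ?\<Omega> f \<le> ennreal (4 * J powr (1 / \<beta>) * M)" .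
  qed
qed

text \<open>
  The kernel of the Slobodeckij seminorm of order \<open>1 - 1 / \<beta>\<close> is \<open>\<bar>x - y\<bar>\<close> to the power \<open>- \<beta>\<close>, and Hoelder
  continuity with exponent \<open>1 - e\<close> supplies the power \<open>(1 - e) \<beta>\<close>.  For \<open>e = 1 / (2 \<beta>)\<close> the power \<open>- 1 / 2\<close>
  is left, whose integral over the unit interval is at most 4.
\<close>

lemma norm_shock_le:
  fixes \<beta> :: real
  assumes \<beta>: "\<beta> > 1"
  defines "e \<equiv> 1 / (2 * \<beta>)"
  assumes M: "0 \<le> M" and bd: "\<And>x. x \<in> {0<..<1} \<Longrightarrow> \<bar>g x\<bar> \<le> M"
    and h: "\<And>x y. x \<in> {0<..<1} \<Longrightarrow> y \<in> {0<..<1} \<Longrightarrow> \<bar>g x - g y\<bar> \<le> M * \<bar>x - y\<bar> powr (1 - e)"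
  shows "norm_shock \<beta> g \<le> ennreal ((1 + 4 powr (1 / \<beta>)) * M)"
proof -
  have e: "0 < e" "e < 1" "e * \<beta> = 1 / 2" using \<beta> by (auto simp: e_def field_simps)
  have cont: "continuous_on {0<..<1} g"
    by (rule continuous_on_holder[where M = M and \<alpha> = "1 - e"]) (use h e in \<open>auto simp: dist_real_def\<close>)
  have "Lp_norm \<beta> {0<..<1} g \<le> ennreal ((M powr \<beta>) powr (1 / \<beta>))"
  proof (rule Lp_norm_le[OF set_borel_measurable_continuous[OF _ cont]])
    have "(\<integral>\<^sup>+x\<in>{0<..<1}. ennreal (\<bar>g x\<bar> powr \<beta>) \<partial>lebesgue) \<le>
      (\<integral>\<^sup>+x. ennreal (M powr \<beta>) * indicator {0<..<1::real} x \<partial>lborel)"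
      unfolding nn_integral_completion
      by (rule nn_integral_mono)
         (use \<beta> bd in \<open>auto simp: indicator_def intro!: ennreal_leI powr_mono2\<close>)
    also have "\<dots> = ennreal (M powr \<beta>)"
      by (subst nn_integral_cmult_indicator) auto
    finally show "(\<integral>\<^sup>+x\<in>{0<..<1}. ennreal (\<bar>g x\<bar> powr \<beta>) \<partial>lebesgue) \<le> ennreal (M powr \<beta>)" .
  qed (use \<beta> in auto)
  then have 1: "Lp_norm \<beta> {0<..<1} g \<le> ennreal M" using \<beta> M by (simp add: powr_powr)
  define \<gamma> where "\<gamma> = - (1 / 2 :: real)"
  have pt: "\<bar>g x - g y\<bar> powr \<beta> / dist x y powr (real DIM(real) + (1 - 1 / \<beta>) * \<beta>) \<le> M powr \<beta> * \<bar>x - y\<bar> powr \<gamma>"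
    if "x \<in> {0<..<1}" "y \<in> {0<..<1}" for x y
  proof (cases "x = y")
    case False
    have ex: "real DIM(real) + (1 - 1 / \<beta>) * \<beta> = \<beta>" using \<beta> by (simp add: field_simps)
    have "\<bar>g x - g y\<bar> powr \<beta> \<le> (M * \<bar>x - y\<bar> powr (1 - e)) powr \<beta>"
      using h[OF that] \<beta> by (intro powr_mono2) auto
    also have "\<dots> = M powr \<beta> * \<bar>x - y\<bar> powr ((1 - e) * \<beta>)" using M by (simp add: powr_mult powr_powr)
    also have "(1 - e) * \<beta> = \<gamma> + \<beta>" using e by (simp add: \<gamma>_def algebra_simps)
    finally show ?thesis unfolding ex using False by (simp add: powr_add dist_real_def pos_divide_le_eq)
  qed (use \<beta> in auto)
  have inner: "(\<integral>\<^sup>+y\<in>{0<..<1}. ennreal (\<bar>g x - g y\<bar> powr \<beta> / dist x y powr (real DIM(real) + (1 - 1 / \<beta>) * \<beta>)) \<partial>lebesgue)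
     \<le> ennreal (4 * M powr \<beta>)" if x: "x \<in> {0<..<1}" for x
  proof -
    have "(\<integral>\<^sup>+y\<in>{0<..<1}. ennreal (\<bar>g x - g y\<bar> powr \<beta> / dist x y powr (real DIM(real) + (1 - 1 / \<beta>) * \<beta>)) \<partial>lebesgue)
      \<le> (\<integral>\<^sup>+y. ennreal (M powr \<beta>) * (ennreal ((x - y) powr \<gamma> * indicator {0<..<x} y) +
            ennreal ((y - x) powr \<gamma> * indicator {x<..<1} y)) \<partial>lborel)"
      unfolding nn_integral_completion
    proof (rule nn_integral_mono)
      fix y :: real
      show "ennreal (\<bar>g x - g y\<bar> powr \<beta> / dist x y powr (real DIM(real) + (1 - 1 / \<beta>) * \<beta>)) * indicator {0<..<1} y \<le>
         ennreal (M powr \<beta>) * (ennreal ((x - y) powr \<gamma> * indicator {0<..<x} y) +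
            ennreal ((y - x) powr \<gamma> * indicator {x<..<1} y))"
      proof (cases "y \<in> {0<..<1}")
        case True
        have "ennreal (\<bar>g x - g y\<bar> powr \<beta> / dist x y powr (real DIM(real) + (1 - 1 / \<beta>) * \<beta>)) \<le>
           ennreal (M powr \<beta> * ((x - y) powr \<gamma> * indicator {0<..<x} y + (y - x) powr \<gamma> * indicator {x<..<1} y))"
        proof (rule ennreal_leI, rule order_trans[OF pt[OF x True]], rule mult_left_mono)
          show "\<bar>x - y\<bar> powr \<gamma> \<le> (x - y) powr \<gamma> * indicator {0<..<x} y + (y - x) powr \<gamma> * indicator {x<..<1} y"
            using True x by (cases x y rule: linorder_cases) auto
        qed simp
        also have "\<dots> = ennreal (M powr \<beta>) * (ennreal ((x - y) powr \<gamma> * indicator {0<..<x} y) +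
            ennreal ((y - x) powr \<gamma> * indicator {x<..<1} y))"
          by (subst ennreal_mult) (auto intro!: ennreal_plus)
        finally show ?thesis using True by simp
      qed simp
    qed
    also have "\<dots> = ennreal (M powr \<beta>) * (ennreal (2 * sqrt (x - 0)) + ennreal (2 * sqrt (1 - x)))"
      using x nn_integral_inv_sqrt_right[of 0 x] nn_integral_inv_sqrt_left[of x 1]
      by (subst nn_integral_cmult, measurable) (subst nn_integral_add, auto simp: \<gamma>_def)
    also have "\<dots> = ennreal (M powr \<beta> * (2 * sqrt x + 2 * sqrt (1 - x)))"
      using x by (simp add: ennreal_mult)
    also have "\<dots> \<le> ennreal (M powr \<beta> * 4)"
    proof (intro ennreal_leI mult_left_mono)
      have "sqrt x \<le> 1" "sqrt (1 - x) \<le> 1" using x by auto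
      then show "2 * sqrt x + 2 * sqrt (1 - x) \<le> 4" by linarith
    qed simp
    finally show ?thesis by (simp add: mult.commute)
  qed
  have "(\<integral>\<^sup>+x\<in>{0<..<1}. (\<integral>\<^sup>+y\<in>{0<..<1}.
        ennreal (\<bar>g x - g y\<bar> powr \<beta> / dist x y powr (real DIM(real) + (1 - 1 / \<beta>) * \<beta>)) \<partial>lebesgue) \<partial>lebesgue)
    \<le> (\<integral>\<^sup>+x. ennreal (4 * M powr \<beta>) * indicator {0<..<1::real} x \<partial>lborel)"
    unfolding nn_integral_completion[of lborel "\<lambda>x. _ x * indicator _ x"]
    by (rule nn_integral_mono) (use inner in \<open>auto simp: indicator_def nn_integral_completion\<close>)
  also have "\<dots> = ennreal (4 * M powr \<beta>)" by (subst nn_integral_cmult_indicator) auto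
  finally have "ennreal_root \<beta> (\<integral>\<^sup>+x\<in>{0<..<1}. (\<integral>\<^sup>+y\<in>{0<..<1}.
        ennreal (\<bar>g x - g y\<bar> powr \<beta> / dist x y powr (real DIM(real) + (1 - 1 / \<beta>) * \<beta>)) \<partial>lebesgue) \<partial>lebesgue)
    \<le> ennreal ((4 * M powr \<beta>) powr (1 / \<beta>))"
    using \<beta> by (intro ennreal_root_le) auto
  also have "(4 * M powr \<beta>) powr (1 / \<beta>) = 4 powr (1 / \<beta>) * M"
    using M \<beta> by (simp add: powr_mult powr_powr)
  finally have "norm_shock \<beta> g \<le> ennreal M + ennreal (4 powr (1 / \<beta>) * M)"
    unfolding norm_shock_def slobodeckij_norm_def using 1 by (intro add_mono)
  then show ?thesis using M by (simp add: ennreal_plus[symmetric] algebra_simps del: ennreal_plus)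
qed

section \<open>Weak derivatives of classically differentiable functions\<close>

lemma dir_deriv_at:
  fixes f :: "'a::euclidean_space \<Rightarrow> real"
  assumes "has_dir_deriv_on e f UNIV"
  shows "((\<lambda>t. f (x + t *\<^sub>R e)) has_real_derivative dir_deriv e f x) (at 0)"
  using assms unfolding has_dir_deriv_on_def dir_deriv_def real_differentiable_def
  by (metis DERIV_imp_deriv UNIV_I)

lemma partial_derivative_shift:
  fixes H :: "real \<times> real \<Rightarrow> real"
  shows "((\<lambda>t. H ((x, y) + t *\<^sub>R (1, 0))) has_real_derivative D) (at 0) \<longleftrightarrow>
      ((\<lambda>x. H (x, y)) has_real_derivative D) (at x)"
    and "((\<lambda>t. H ((x, y) + t *\<^sub>R (0, 1))) has_real_derivative D) (at 0) \<longleftrightarrow>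
      ((\<lambda>y. H (x, y)) has_real_derivative D) (at y)"
  using DERIV_shift[of "\<lambda>x. H (x, y)" D 0 x] DERIV_shift[of "\<lambda>y. H (x, y)" D 0 y]
  by (simp_all add: add.commute)

text \<open>
  Integrating first along \<open>e\<close>, the fundamental theorem of calculus leaves the boundary values of \<open>H\<close>.
\<close>

lemma integral_partial_derivative_zero:
  fixes H h :: "real \<times> real \<Rightarrow> real"
  assumes e: "e \<in> Basis" and h: "continuous_on UNIV h"
    and d: "\<And>z. ((\<lambda>t. H (z + t *\<^sub>R e)) has_real_derivative h z) (at 0)"
    and z: "\<And>z. z \<notin> box (-R, -R) (R, R) \<Longrightarrow> H z = 0" and R: "R > 0"
  shows "integral (cbox (-R, -R) (R, R)) h = 0"
proof -
  have hc: "continuous_on (cbox (-R, -R) (R, R)) h" by (rule continuous_on_subset[OF h]) simp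
  have bnd: "H (-R, y) = 0" "H (R, y) = 0" "H (y, -R) = 0" "H (y, R) = 0" for y
    using R by (auto intro!: z simp: mem_box Basis_real2)
  consider "e = (1, 0)" | "e = (0, 1)" using e by (auto simp: Basis_real2)
  then show ?thesis
  proof cases
    case 1
    have "((\<lambda>x. h (x, y)) has_integral (H (R, y) - H (-R, y))) {-R..R}" for y
      using R d[of "(_, y)"] unfolding 1 partial_derivative_shift
      by (intro fundamental_theorem_of_calculus)
         (auto simp: has_real_derivative_iff_has_vector_derivative[symmetric]
               intro: has_field_derivative_at_within)
    then have inner: "integral (cbox (-R) R) (\<lambda>x. h (x, y)) = 0" for y
      by (simp add: bnd integral_unique)
    have "integral (cbox (-R, -R) (R, R)) h = integral (cbox (-R) R) (\<lambda>x. integral (cbox (-R) R) (\<lambda>y. h (x, y)))"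
      by (rule integral_prod_continuous[OF hc])
    also have "\<dots> = integral (cbox (-R) R) (\<lambda>y. integral (cbox (-R) R) (\<lambda>x. h (x, y)))"
      using integral_swap_continuous[of "-R" "-R" R R "\<lambda>x y. h (x, y)"] hc by (simp add: case_prod_eta)
    finally show ?thesis unfolding inner by simp
  next
    case 2
    have "((\<lambda>y. h (x, y)) has_integral (H (x, R) - H (x, -R))) {-R..R}" for x
      using R d[of "(x, _)"] unfolding 2 partial_derivative_shift
      by (intro fundamental_theorem_of_calculus)
         (auto simp: has_real_derivative_iff_has_vector_derivative[symmetric]
               intro: has_field_derivative_at_within)
    then have inner: "integral (cbox (-R) R) (\<lambda>y. h (x, y)) = 0" for x
      by (simp add: bnd integral_unique)
    have "integral (cbox (-R, -R) (R, R)) h = integral (cbox (-R) R) (\<lambda>x. integral (cbox (-R) R) (\<lambda>y. h (x, y)))"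
      by (rule integral_prod_continuous[OF hc])
    then show ?thesis unfolding inner by simp
  qed
qed

text \<open>
  \<open>\<Omega>\<close> and the complement of \<open>S\<close> are open and cover the space, and the extension is continuous on each.
\<close>

lemma continuous_extension_by_zero:
  fixes f \<psi> :: "'a::euclidean_space \<Rightarrow> real"
  assumes "open \<Omega>" "closed S" "S \<subseteq> \<Omega>" and f: "continuous_on \<Omega> f" and \<psi>: "continuous_on UNIV \<psi>"
    and z: "\<And>x. x \<notin> S \<Longrightarrow> \<psi> x = 0"
  shows "continuous_on UNIV (\<lambda>x. if x \<in> \<Omega> then f x * \<psi> x else 0)"
proof -
  have 1: "continuous_on \<Omega> (\<lambda>x. if x \<in> \<Omega> then f x * \<psi> x else 0)"
    by (rule continuous_on_eq[where f = "\<lambda>x. f x * \<psi> x"])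
       (auto intro!: continuous_intros f continuous_on_subset[OF \<psi>])
  have 2: "continuous_on (- S) (\<lambda>x. if x \<in> \<Omega> then f x * \<psi> x else 0)"
    by (rule continuous_on_eq[where f = "\<lambda>x. 0"]) (auto simp: z)
  have "continuous_on (\<Omega> \<union> - S) (\<lambda>x. if x \<in> \<Omega> then f x * \<psi> x else 0)"
    using assms 1 2 by (intro continuous_on_open_Un) auto
  moreover have "\<Omega> \<union> - S = UNIV" using assms by auto
  ultimately show ?thesis by simp
qed

lemma set_integrable_extension_by_zero:
  fixes f \<psi> :: "real \<times> real \<Rightarrow> real"
  assumes "continuous_on UNIV (\<lambda>x. if x \<in> \<Omega> then f x * \<psi> x else 0)"
    and z: "\<And>x. x \<notin> cbox a b \<Longrightarrow> \<psi> x = 0"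
  shows "set_integrable lebesgue \<Omega> (\<lambda>x. f x * \<psi> x)"
    and "(LINT x:\<Omega>|lebesgue. f x * \<psi> x) = integral (cbox a b) (\<lambda>x. if x \<in> \<Omega> then f x * \<psi> x else 0)"
proof -
  let ?h = "\<lambda>x. if x \<in> \<Omega> then f x * \<psi> x else 0"
  have int: "set_integrable lebesgue (cbox a b) ?h"
    by (rule absolutely_integrable_continuous) (rule continuous_on_subset[OF assms(1)], simp)
  have eq: "indicator \<Omega> x *\<^sub>R (f x * \<psi> x) = indicator (cbox a b) x *\<^sub>R ?h x" for x
    using z[of x] by (auto simp: indicator_def)
  show "set_integrable lebesgue \<Omega> (\<lambda>x. f x * \<psi> x)"
    using int unfolding set_integrable_def eq .
  show "(LINT x:\<Omega>|lebesgue. f x * \<psi> x) = integral (cbox a b) ?h"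
    unfolding set_lebesgue_integral_eq_integral(2)[OF int, symmetric] set_lebesgue_integral_def eq ..
qed

lemma loc_integrable_continuous:
  fixes f :: "'a::euclidean_space \<Rightarrow> real"
  assumes "continuous_on \<Omega> f"
  shows "loc_integrable \<Omega> f"
  unfolding loc_integrable_def
proof (intro allI impI)
  fix K assume K: "compact K \<and> K \<subseteq> \<Omega>"
  then have "set_integrable lborel K f"
    unfolding set_integrable_def
    by (intro borel_integrable_compact continuous_on_subset[OF assms]) auto
  moreover have "(\<lambda>x. indicator K x *\<^sub>R f x) \<in> borel_measurable borel"
    using K by (intro borel_measurable_continuous_on_indicator continuous_on_subset[OF assms])
      (auto intro: compact_imp_closed borel_closed)
  ultimately show "set_integrable lebesgue K f"
    unfolding set_integrable_def by (simp add: integrable_completion)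
qed

text \<open>
  The product of \<open>f\<close> with the test function, extended by zero, is differentiable along \<open>e\<close> on the whole plane and
  has compact support; the integral of its derivative therefore vanishes.
\<close>

lemma integration_by_parts_test_function:
  fixes f g \<eta> :: "real \<times> real \<Rightarrow> real"
  assumes O: "open \<Omega>" and e: "e \<in> Basis" and f: "continuous_on \<Omega> f" and g: "continuous_on \<Omega> g"
    and d: "\<And>x. x \<in> \<Omega> \<Longrightarrow> ((\<lambda>t. f (x + t *\<^sub>R e)) has_real_derivative g x) (at 0)"
    and \<eta>: "test_function \<Omega> \<eta>"
  shows "set_integrable lebesgue \<Omega> (\<lambda>x. f x * dir_deriv e \<eta> x)"
    and "set_integrable lebesgue \<Omega> (\<lambda>x. g x * \<eta> x)"
    and "(LINT x:\<Omega>|lebesgue. f x * dir_deriv e \<eta> x) = - (LINT x:\<Omega>|lebesgue. g x * \<eta> x)"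
proof -
  define S where "S = closure {x. \<eta> x \<noteq> 0}"
  have Ck: "Ck (Suc 0) \<eta>" and S: "compact S" "closed S" "S \<subseteq> \<Omega>"
    using \<eta> by (auto simp: test_function_def S_def)
  have \<eta>c: "continuous_on UNIV \<eta>" and \<eta>d: "has_dir_deriv_on e \<eta> UNIV" and \<eta>dc: "continuous_on UNIV (dir_deriv e \<eta>)"
    using Ck e by auto
  have \<eta>0: "\<eta> x = 0" if "x \<notin> S" for x using that closure_subset[of "{x. \<eta> x \<noteq> 0}"] by (auto simp: S_def)
  have \<eta>d0: "dir_deriv e \<eta> x = 0" if "x \<notin> S" for x
  proof (rule dir_deriv_eq, rule has_dir_deriv_transfer[where \<Omega> = "- S" and f = "\<lambda>x. 0"])
    show "open (- S)" using S by auto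
  qed (use that \<eta>0 in auto)
  obtain R where R: "R > 0" "S \<subseteq> box (-R, -R) (R, R)"
  proof -
    obtain B where B: "\<And>x. x \<in> S \<Longrightarrow> norm x \<le> B" using compact_imp_bounded[OF S(1)] by (auto simp: bounded_iff)
    have "S \<subseteq> box (- (\<bar>B\<bar> + 1), - (\<bar>B\<bar> + 1)) (\<bar>B\<bar> + 1, \<bar>B\<bar> + 1)"
    proof
      fix z assume z: "z \<in> S"
      have "\<bar>fst z\<bar> \<le> B" "\<bar>snd z\<bar> \<le> B"
        using B[OF z] norm_fst_le[of "fst z" "snd z"] norm_snd_le[of "snd z" "fst z"] by auto
      then show "z \<in> box (- (\<bar>B\<bar> + 1), - (\<bar>B\<bar> + 1)) (\<bar>B\<bar> + 1, \<bar>B\<bar> + 1)"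
        by (cases z) (auto simp: mem_box Basis_real2)
    qed
    then show thesis by (intro that[of "\<bar>B\<bar> + 1"]) auto
  qed
  have nb: "x \<notin> S" if "x \<notin> cbox (-R, -R) (R, R)" for x using that R(2) box_subset_cbox by blast
  define H where "H x = (if x \<in> \<Omega> then f x * \<eta> x else 0)" for x
  define h1 where "h1 x = (if x \<in> \<Omega> then f x * dir_deriv e \<eta> x else 0)" for x
  define h2 where "h2 x = (if x \<in> \<Omega> then g x * \<eta> x else 0)" for x
  have h1c: "continuous_on UNIV h1" unfolding h1_def[abs_def]
    by (rule continuous_extension_by_zero[OF O S(2,3) f \<eta>dc \<eta>d0])
  have h2c: "continuous_on UNIV h2" unfolding h2_def[abs_def]
    by (rule continuous_extension_by_zero[OF O S(2,3) g \<eta>c \<eta>0])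
  have I1: "set_integrable lebesgue \<Omega> (\<lambda>x. f x * dir_deriv e \<eta> x)"
      "(LINT x:\<Omega>|lebesgue. f x * dir_deriv e \<eta> x) = integral (cbox (-R, -R) (R, R)) h1"
    unfolding h1_def[abs_def]
    by (rule set_integrable_extension_by_zero[OF h1c[unfolded h1_def[abs_def]]], rule \<eta>d0, erule nb)+
  have I2: "set_integrable lebesgue \<Omega> (\<lambda>x. g x * \<eta> x)"
      "(LINT x:\<Omega>|lebesgue. g x * \<eta> x) = integral (cbox (-R, -R) (R, R)) h2"
    unfolding h2_def[abs_def]
    by (rule set_integrable_extension_by_zero[OF h2c[unfolded h2_def[abs_def]]], rule \<eta>0, erule nb)+
  show "set_integrable lebesgue \<Omega> (\<lambda>x. f x * dir_deriv e \<eta> x)" by (rule I1(1))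
  show "set_integrable lebesgue \<Omega> (\<lambda>x. g x * \<eta> x)" by (rule I2(1))
  have "integral (cbox (-R, -R) (R, R)) (\<lambda>x. h1 x + h2 x) = 0"
  proof (rule integral_partial_derivative_zero[OF e, where H = H])
    show "continuous_on UNIV (\<lambda>x. h1 x + h2 x)" by (intro continuous_intros h1c h2c)
    show "H z = 0" if "z \<notin> box (-R, -R) (R, R)" for z
    proof -
      have "z \<notin> S" using that R(2) by blast
      then show ?thesis by (simp add: H_def \<eta>0)
    qed
    show "((\<lambda>t. H (z + t *\<^sub>R e)) has_real_derivative h1 z + h2 z) (at 0)" for z
    proof (cases "z \<in> \<Omega>")
      case True
      show ?thesis
      proof (rule has_dir_deriv_transfer[OF O True, where f = "\<lambda>x. f x * \<eta> x"])
        have "((\<lambda>t. f (z + t *\<^sub>R e) * \<eta> (z + t *\<^sub>R e)) has_real_derivative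
            g z * \<eta> (z + 0 *\<^sub>R e) + dir_deriv e \<eta> z * f (z + 0 *\<^sub>R e)) (at 0)"
          by (intro DERIV_mult d[OF True] dir_deriv_at \<eta>d)
        then show "((\<lambda>t. f (z + t *\<^sub>R e) * \<eta> (z + t *\<^sub>R e)) has_real_derivative h1 z + h2 z) (at 0)"
          using True by (simp add: h1_def h2_def algebra_simps)
      qed (simp add: H_def)
    next
      case False
      then have "z \<in> - S" using S by auto
      then show ?thesis
        by (rule has_dir_deriv_transfer[where \<Omega> = "- S" and f = "\<lambda>x. 0", rotated])
           (use S False \<eta>0 in \<open>auto simp: H_def h1_def h2_def\<close>)
    qed
  qed (use R in auto)
  also have "integral (cbox (-R, -R) (R, R)) (\<lambda>x. h1 x + h2 x) =
      integral (cbox (-R, -R) (R, R)) h1 + integral (cbox (-R, -R) (R, R)) h2"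
    by (intro integral_add integrable_continuous continuous_on_subset[OF h1c] continuous_on_subset[OF h2c]) auto
  finally show "(LINT x:\<Omega>|lebesgue. f x * dir_deriv e \<eta> x) = - (LINT x:\<Omega>|lebesgue. g x * \<eta> x)"
    unfolding I1(2) I2(2) by simp
qed

lemma weak_deriv_classical:
  fixes f g :: "real \<times> real \<Rightarrow> real"
  assumes "open \<Omega>" "e \<in> Basis" "continuous_on \<Omega> f" "continuous_on \<Omega> g"
    and "\<And>x. x \<in> \<Omega> \<Longrightarrow> ((\<lambda>t. f (x + t *\<^sub>R e)) has_real_derivative g x) (at 0)"
  shows "weak_deriv \<Omega> e f g"
  unfolding weak_deriv_def
  using loc_integrable_continuous[OF assms(3)] loc_integrable_continuous[OF assms(4)]
    integration_by_parts_test_function(3)[OF assms] by blast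

lemma distr_div_classical:
  fixes F1 F2 :: "real \<times> real \<Rightarrow> real"
  assumes O: "open \<Omega>" and c: "continuous_on \<Omega> F1" "continuous_on \<Omega> F2" "continuous_on \<Omega> g1" "continuous_on \<Omega> g2"
    and d1: "\<And>x. x \<in> \<Omega> \<Longrightarrow> ((\<lambda>t. F1 (x + t *\<^sub>R (1, 0))) has_real_derivative g1 x) (at 0)"
    and d2: "\<And>x. x \<in> \<Omega> \<Longrightarrow> ((\<lambda>t. F2 (x + t *\<^sub>R (0, 1))) has_real_derivative g2 x) (at 0)"
    and h: "\<And>x. x \<in> \<Omega> \<Longrightarrow> g1 x + g2 x = h"
  shows "distr_div \<Omega> F1 F2 h"
  unfolding distr_div_def
proof (intro conjI allI impI loc_integrable_continuous c)
  fix \<eta> assume \<eta>: "test_function \<Omega> \<eta>"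
  have e: "(1, 0) \<in> (Basis :: (real \<times> real) set)" "(0, 1) \<in> (Basis :: (real \<times> real) set)"
    by (auto simp: Basis_real2)
  have i1: "set_integrable lebesgue \<Omega> (\<lambda>y. F1 y * d1 \<eta> y)" "set_integrable lebesgue \<Omega> (\<lambda>y. g1 y * \<eta> y)"
      "(LINT y:\<Omega>|lebesgue. F1 y * d1 \<eta> y) = - (LINT y:\<Omega>|lebesgue. g1 y * \<eta> y)"
    by (rule integration_by_parts_test_function[OF O e(1) c(1) c(3) _ \<eta>], erule d1)+
  have i2: "set_integrable lebesgue \<Omega> (\<lambda>y. F2 y * d2 \<eta> y)" "set_integrable lebesgue \<Omega> (\<lambda>y. g2 y * \<eta> y)"
      "(LINT y:\<Omega>|lebesgue. F2 y * d2 \<eta> y) = - (LINT y:\<Omega>|lebesgue. g2 y * \<eta> y)"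
    by (rule integration_by_parts_test_function[OF O e(2) c(2) c(4) _ \<eta>], erule d2)+
  have "(LINT y:\<Omega>|lebesgue. F1 y * d1 \<eta> y + F2 y * d2 \<eta> y) = - ((LINT y:\<Omega>|lebesgue. g1 y * \<eta> y) + (LINT y:\<Omega>|lebesgue. g2 y * \<eta> y))"
    unfolding set_integral_add(2)[OF i1(1) i2(1)] i1(3) i2(3) by simp
  also have "(LINT y:\<Omega>|lebesgue. g1 y * \<eta> y) + (LINT y:\<Omega>|lebesgue. g2 y * \<eta> y) =
     (LINT y:\<Omega>|lebesgue. g1 y * \<eta> y + g2 y * \<eta> y)"
    by (rule set_integral_add(2)[OF i1(2) i2(2), symmetric])
  also have "\<dots> = (LINT y:\<Omega>|lebesgue. h * \<eta> y)"
    unfolding set_lebesgue_integral_def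
    by (rule Bochner_Integration.integral_cong) (auto simp: indicator_def h[symmetric] algebra_simps)
  finally show "- (LINT y:\<Omega>|lebesgue. F1 y * d1 \<eta> y + F2 y * d2 \<eta> y) = (LINT y:\<Omega>|lebesgue. h * \<eta> y)"
    by simp
qed

section \<open>Cosine series of functions with two derivatives\<close>

lemma cos_pi_integral:
  fixes n :: nat
  shows "integral {0..1} (\<lambda>s. cos (real n * pi * s)) = (if n = 0 then 1 else 0)"
proof (cases "n = 0")
  case False
  have "((\<lambda>s. cos (real n * pi * s)) has_integral
      (sin (real n * pi * 1) / (real n * pi) - sin (real n * pi * 0) / (real n * pi))) {0..1}"
    using False
    by (intro fundamental_theorem_of_calculus)
       (auto intro!: derivative_eq_intros simp: has_real_derivative_iff_has_vector_derivative[symmetric])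
  then show ?thesis using False by (simp add: integral_unique)
qed auto

lemma cos_pi_orthogonal:
  fixes m n :: nat
  shows "integral {0..1} (\<lambda>s. cos (real m * pi * s) * cos (real n * pi * s)) =
    (if m = n then if n = 0 then 1 else 1 / 2 else 0)"
proof -
  have *: "cos (real m * pi * s) * cos (real n * pi * s) =
      (1/2) * (cos (real (m + n) * pi * s) + cos (real (if m \<le> n then n - m else m - n) * pi * s))" for s
  proof -
    have "cos (real (if m \<le> n then n - m else m - n) * pi * s) = cos (real m * pi * s - real n * pi * s)"
      by (cases "m \<le> n") (auto simp: of_nat_diff algebra_simps cos_diff)
    then show ?thesis by (simp add: cos_diff cos_add algebra_simps)
  qed
  have "integral {0..1} (\<lambda>s. cos (real m * pi * s) * cos (real n * pi * s)) =
     (1/2) * (integral {0..1} (\<lambda>s. cos (real (m + n) * pi * s)) +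
      integral {0..1} (\<lambda>s. cos (real (if m \<le> n then n - m else m - n) * pi * s)))"
    unfolding * by (subst integral_mult_right, subst integral_add)
       (auto intro!: integrable_continuous_real continuous_intros)
  also have "\<dots> = (if m = n then if n = 0 then 1 else 1 / 2 else 0)"
    by (subst (1 2) cos_pi_integral) auto
  finally show ?thesis .
qed

text \<open>
  Multiplication by \<open>cos (\<pi> s)\<close> shifts the frequency by one in both directions, so \<open>h\<close> is orthogonal to all
  polynomials in \<open>cos (\<pi> s)\<close>.  By the Weierstrass theorem, applied in the variable \<open>cos (\<pi> s)\<close>, these
  approximate \<open>h\<close> uniformly, and so \<open>h\<close> is orthogonal to itself.
\<close>

lemma cos_coeffs_determine:
  fixes h :: "real \<Rightarrow> real"
  assumes h: "continuous_on {0..1} h"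
    and z: "\<And>n::nat. integral {0..1} (\<lambda>s. h s * cos (real n * pi * s)) = 0"
    and s: "s \<in> {0..1}"
  shows "h s = 0"
proof -
  have int: "(\<lambda>s. h s * f s) integrable_on {0..1}" if "continuous_on {0..1} f" for f :: "real \<Rightarrow> real"
    by (intro integrable_continuous_real continuous_intros h that)
  have pow: "integral {0..1} (\<lambda>s. h s * (cos (pi * s) ^ k * cos (real n * pi * s))) = 0" for k n :: nat
  proof (induction k arbitrary: n)
    case 0
    then show ?case using z by simp
  next
    case (Suc k)
    show ?case
    proof (cases n)
      case 0
      then show ?thesis using Suc[of 1] by (simp add: mult.commute)
    next
      case (Suc m)
      have *: "h s * (cos (pi * s) ^ Suc k * cos (real n * pi * s)) =
         (1/2) * (h s * (cos (pi * s) ^ k * cos (real (Suc n) * pi * s)) +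
                  h s * (cos (pi * s) ^ k * cos (real m * pi * s)))" for s
      proof -
        have "cos (real (Suc n) * pi * s) = cos (real n * pi * s + pi * s)"
             "cos (real m * pi * s) = cos (real n * pi * s - pi * s)"
          using Suc by (auto simp: algebra_simps)
        then show ?thesis by (simp add: cos_add cos_diff algebra_simps)
      qed
      show ?thesis unfolding *
        by (subst integral_mult_right, subst integral_add)
           (use Suc.IH[of "Suc n"] Suc.IH[of m] in \<open>auto intro!: int continuous_intros\<close>)
    qed
  qed
  have poly: "integral {0..1} (\<lambda>s. h s * f (cos (pi * s))) = 0"
    if f: "real_polynomial_function f" for f
  proof -
    obtain a n where f: "f = (\<lambda>x. \<Sum>i\<le>n. a i * x ^ i)"
      using f by (auto simp: real_polynomial_function_iff_sum)
    have "integral {0..1} (\<lambda>s. h s * f (cos (pi * s))) =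
       integral {0..1} (\<lambda>s. \<Sum>i\<le>n. a i * (h s * (cos (pi * s) ^ i * cos (real 0 * pi * s))))"
      by (simp add: f sum_distrib_left algebra_simps)
    also have "\<dots> = (\<Sum>i\<le>n. integral {0..1} (\<lambda>s. a i * (h s * (cos (pi * s) ^ i * cos (real 0 * pi * s)))))"
      by (subst integral_sum)
         (auto intro!: integrable_continuous_real continuous_intros h)
    also have "\<dots> = 0"
      by (subst integral_mult_right) (simp only: pow, simp)
    finally show ?thesis .
  qed
  \<comment> \<open>the variable \<open>x = cos (\<pi> s)\<close>\<close>
  have "continuous_on {-1..1} (\<lambda>x. h (arccos x / pi))"
    by (rule continuous_on_compose2[OF h])
       (auto intro!: continuous_intros continuous_on_arccos' simp: arccos_lbound arccos_ubound field_simps)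
  note SW = Stone_Weierstrass_real_polynomial_function[OF _ this]
  have hh: "continuous_on {0..1} (\<lambda>s. h s * h s)" by (intro continuous_intros h)
  obtain M where M: "\<And>s. s \<in> {0..1} \<Longrightarrow> \<bar>h s\<bar> \<le> M"
    using compact_imp_bounded[OF compact_continuous_image[OF h]] unfolding bounded_iff by fastforce
  have M0: "0 \<le> M" using M[of 0] by auto
  have small: "integral {0..1} (\<lambda>s. h s * h s) \<le> M * e" if "e > 0" for e
  proof -
    obtain f where f: "real_polynomial_function f" "\<And>x. x \<in> {-1..1} \<Longrightarrow> \<bar>h (arccos x / pi) - f x\<bar> < e"
      using SW[OF _ \<open>e > 0\<close>] by auto
    have cf: "continuous_on {0..1} (\<lambda>s. f (cos (pi * s)))"
    proof -
      have "continuous_on UNIV f"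
        using f(1) by (simp add: continuous_on_polymonial_function real_polynomial_function_eq)
      moreover have "continuous_on {0..1} (\<lambda>s. cos (pi * s))" by (intro continuous_intros)
      ultimately show ?thesis by (rule continuous_on_compose2) simp
    qed
    have d: "\<bar>h s - f (cos (pi * s))\<bar> \<le> e" if "s \<in> {0..1}" for s
    proof -
      have "arccos (cos (pi * s)) = pi * s" using that by (intro arccos_cos) auto
      then show ?thesis using f(2)[of "cos (pi * s)"] by auto
    qed
    have "integral {0..1} (\<lambda>s. h s * h s) = integral {0..1} (\<lambda>s. h s * h s) - integral {0..1} (\<lambda>s. h s * f (cos (pi * s)))"
      using poly[OF f(1)] by simp
    also have "\<dots> = integral {0..1} (\<lambda>s. h s * (h s - f (cos (pi * s))))"
      unfolding right_diff_distrib by (intro integral_diff[symmetric] int h cf)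
    also have "\<dots> \<le> integral {0..1} (\<lambda>s::real. M * e)"
    proof (rule integral_le)
      fix s :: real assume s: "s \<in> {0..1}"
      have "h s * (h s - f (cos (pi * s))) \<le> \<bar>h s\<bar> * \<bar>h s - f (cos (pi * s))\<bar>"
        by (simp add: abs_mult[symmetric])
      also have "\<dots> \<le> M * e" using M[OF s] d[OF s] by (intro mult_mono) (use M0 in auto)
      finally show "h s * (h s - f (cos (pi * s))) \<le> M * e" .
    qed (auto intro!: int continuous_intros h cf)
    finally show ?thesis by simp
  qed
  have "integral {0..1} (\<lambda>s. h s * h s) \<le> 0"
  proof (rule field_le_epsilon)
    fix e :: real assume "e > 0"
    then have "integral {0..1} (\<lambda>s. h s * h s) \<le> M * (e / (M + 1))"
      using M0 by (intro small) auto
    also have "\<dots> \<le> 0 + e" using M0 \<open>e > 0\<close> by (simp add: field_simps)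
    finally show "integral {0..1} (\<lambda>s. h s * h s) \<le> 0 + e" .
  qed
  moreover have "integral {0..1} (\<lambda>s. h s * h s) \<ge> 0"
    by (intro integral_nonneg integrable_continuous_real hh) auto
  ultimately have "integral (cbox 0 1) (\<lambda>s. h s * h s) = 0" by simp
  moreover have "(\<lambda>s. h s * h s) integrable_on cbox 0 1"
    using integrable_continuous_real[OF hh] by simp
  ultimately have "((\<lambda>s. h s * h s) has_integral 0) (cbox 0 1)"
    by (metis integrable_integral)
  then have "h s * h s = 0"
    using has_integral_0_cbox_imp_0[of 0 1 "\<lambda>s. h s * h s" s] hh s by auto
  then show ?thesis by simp
qed

text \<open>
  At the end points of an interval the derivatives are one-sided.  One number bounds the function and both
  derivatives, so that all later estimates are linear in it.
\<close>

definition C2_bound :: "real set \<Rightarrow> (real \<Rightarrow> real) \<Rightarrow> (real \<Rightarrow> real) \<Rightarrow> (real \<Rightarrow> real) \<Rightarrow> real \<Rightarrow> bool" where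
  "C2_bound I g g' g'' B \<longleftrightarrow>
     (\<forall>s\<in>I. (g has_real_derivative g' s) (at s within I)) \<and>
     (\<forall>s\<in>I. (g' has_real_derivative g'' s) (at s within I)) \<and> continuous_on I g'' \<and>
     (\<forall>s\<in>I. \<bar>g s\<bar> \<le> B \<and> \<bar>g' s\<bar> \<le> B \<and> \<bar>g'' s\<bar> \<le> B)"

definition cos_coeff :: "(real \<Rightarrow> real) \<Rightarrow> nat \<Rightarrow> real" where
  "cos_coeff g n = 2 * integral {0..1} (\<lambda>s. g s * cos (real n * pi * s))"

text \<open>
  Two integrations by parts.  The boundary terms \<open>g' 0\<close> and \<open>g' 1\<close> do not vanish in general, which limits the
  decay to the inverse square: the boundary data do not match at the corners of the rectangle.
\<close>

lemma cos_coeff_bound: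
  assumes g: "C2_bound {0..1} g g' g'' B" and n: "n > 0"
  shows "\<bar>cos_coeff g n\<bar> \<le> B / (real n)\<^sup>2"
proof -
  define w where "w = real n * pi"
  have w: "w > 0" using n by (simp add: w_def)
  have g1: "\<And>s. s \<in> {0..1} \<Longrightarrow> (g has_real_derivative g' s) (at s within {0..1})"
   and g2: "\<And>s. s \<in> {0..1} \<Longrightarrow> (g' has_real_derivative g'' s) (at s within {0..1})"
   and g3: "continuous_on {0..1} g''"
   and b: "\<And>s. s \<in> {0..1} \<Longrightarrow> \<bar>g s\<bar> \<le> B" "\<And>s. s \<in> {0..1} \<Longrightarrow> \<bar>g' s\<bar> \<le> B"
     "\<And>s. s \<in> {0..1} \<Longrightarrow> \<bar>g'' s\<bar> \<le> B"
    using g by (auto simp: C2_bound_def)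
  have gc: "continuous_on {0..1} g" using g1 by (meson DERIV_continuous_on)
  have B0: "B \<ge> 0" using b(1)[of 0] by auto
  have hi1: "((\<lambda>s. g s * cos (w * s) + g'' s * cos (w * s) / w\<^sup>2) has_integral
     ((g 1 * sin (w * 1) / w + g' 1 * cos (w * 1) / w\<^sup>2) -
      (g 0 * sin (w * 0) / w + g' 0 * cos (w * 0) / w\<^sup>2))) {0..1}"
  proof (rule fundamental_theorem_of_calculus)
    fix s :: real assume s: "s \<in> {0..1}"
    have "((\<lambda>s. g s * sin (w * s) / w + g' s * cos (w * s) / w\<^sup>2) has_real_derivative
       (g' s * sin (w * s) + cos (w * s) * w * g s) / w + (g'' s * cos (w * s) + - sin (w * s) * w * g' s) / w\<^sup>2)
       (at s within {0..1})"
    proof -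
      have "((\<lambda>s. sin (w * s)) has_real_derivative cos (w * s) * w) (at s within {0..1})"
           "((\<lambda>s. cos (w * s)) has_real_derivative - sin (w * s) * w) (at s within {0..1})"
        by (auto intro!: derivative_eq_intros)
      then show ?thesis
        by (intro DERIV_add DERIV_cdivide DERIV_mult g1[OF s] g2[OF s])
    qed
    also have "(g' s * sin (w * s) + cos (w * s) * w * g s) / w + (g'' s * cos (w * s) + - sin (w * s) * w * g' s) / w\<^sup>2
       = g s * cos (w * s) + g'' s * cos (w * s) / w\<^sup>2"
      using w by (simp add: add_divide_distrib power2_eq_square diff_divide_distrib)
    finally show "((\<lambda>s. g s * sin (w * s) / w + g' s * cos (w * s) / w\<^sup>2) has_vector_derivative
       g s * cos (w * s) + g'' s * cos (w * s) / w\<^sup>2) (at s within {0..1})"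
      by (simp add: has_real_derivative_iff_has_vector_derivative)
  qed simp
  have hi2: "((\<lambda>s. g'' s * cos (w * s) / w\<^sup>2) has_integral integral {0..1} (\<lambda>s. g'' s * cos (w * s) / w\<^sup>2)) {0..1}"
    by (intro integrable_integral integrable_continuous_real continuous_intros g3) (use w in auto)
  have sin_w: "sin w = 0" by (simp add: w_def)
  have eq: "integral {0..1} (\<lambda>s. g s * cos (w * s)) =
     (g' 1 * cos w - g' 0) / w\<^sup>2 - integral {0..1} (\<lambda>s. g'' s * cos (w * s) / w\<^sup>2)"
    using integral_unique[OF has_integral_diff[OF hi1 hi2]] by (simp add: sin_w diff_divide_distrib)
  have "\<bar>integral {0..1} (\<lambda>s. g'' s * cos (w * s) / w\<^sup>2)\<bar> \<le> B / w\<^sup>2"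
  proof -
    have "norm (g'' s * cos (w * s) / w\<^sup>2) \<le> B / w\<^sup>2" if "s \<in> {0..1}" for s
    proof -
      have "\<bar>g'' s\<bar> * \<bar>cos (w * s)\<bar> \<le> B * 1" using b(3)[OF that] B0 by (intro mult_mono) auto
      then show ?thesis using w by (simp add: abs_mult divide_right_mono)
    qed
    moreover have "continuous_on {0..1} (\<lambda>s. g'' s * cos (w * s) / w\<^sup>2)"
      by (intro continuous_intros g3) (use w in auto)
    ultimately show ?thesis
      using integral_bound[of 0 1 "\<lambda>s. g'' s * cos (w * s) / w\<^sup>2" "B / w\<^sup>2"] by auto
  qed
  moreover have "\<bar>(g' 1 * cos w - g' 0) / w\<^sup>2\<bar> \<le> 2 * B / w\<^sup>2"
  proof -
    have "\<bar>g' 1\<bar> * \<bar>cos w\<bar> \<le> B * 1" using b(2)[of 1] B0 by (intro mult_mono) auto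
    moreover have "\<bar>g' 1 * cos w - g' 0\<bar> \<le> \<bar>g' 1\<bar> * \<bar>cos w\<bar> + \<bar>g' 0\<bar>"
      using abs_triangle_ineq4[of "g' 1 * cos w" "g' 0"] unfolding abs_mult .
    moreover have "\<bar>g' 0\<bar> \<le> B" using b(2)[of 0] by simp
    ultimately have "\<bar>g' 1 * cos w - g' 0\<bar> \<le> 2 * B" by linarith
    then show ?thesis using w by (simp add: divide_right_mono)
  qed
  moreover have "\<bar>2 * (x - y)\<bar> \<le> 2 * (X + Y)" if "\<bar>y\<bar> \<le> Y" "\<bar>x\<bar> \<le> X" for x y X Y :: real
    using that by (auto simp: abs_le_iff)
  ultimately have "\<bar>cos_coeff g n\<bar> \<le> 2 * (2 * B / w\<^sup>2 + B / w\<^sup>2)"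
    unfolding cos_coeff_def eq w_def[symmetric] by blast
  also have "\<dots> = 6 * B / w\<^sup>2" by simp
  \<comment> \<open>\<open>6 \<le> 9 \<le> \<pi>\<^sup>2\<close> absorbs the constant\<close>
  also have "\<dots> \<le> 9 * B / w\<^sup>2" using B0 w by (intro divide_right_mono) auto
  also have "\<dots> \<le> pi\<^sup>2 * B / w\<^sup>2"
    using B0 w pi_gt3 power_mono[of 3 pi 2] by (intro divide_right_mono mult_right_mono) auto
  also have "\<dots> = B / (real n)\<^sup>2" using n by (simp add: w_def power_mult_distrib)
  finally show ?thesis .
qed

lemma summable_inverse_square: "summable (\<lambda>n. B / (real (Suc n))\<^sup>2)"
proof -
  have "summable (\<lambda>n. B * inverse (real (Suc n) ^ 2))"
    using inverse_power_summable[of 2, where ?'a = real] 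
    by (intro summable_mult) (subst summable_Suc_iff, simp)
  then show ?thesis by (simp add: divide_inverse)
qed

text \<open>
  By the quadratic decay the series converges uniformly to a continuous function with the cosine coefficients of
  \<open>g\<close>, and these determine it.
\<close>

lemma cos_series:
  assumes g: "C2_bound {0..1} g g' g'' B" and mean: "integral {0..1} g = 0" and s: "s \<in> {0..1}"
  shows "g s = (\<Sum>n. cos_coeff g (Suc n) * cos (real (Suc n) * pi * s))"
proof -
  define G where "G s = (\<Sum>n. cos_coeff g (Suc n) * cos (real (Suc n) * pi * s))" for s
  have gc: "continuous_on {0..1} g"
    using g unfolding C2_bound_def by (meson DERIV_continuous_on)
  have B0: "B \<ge> 0" using g by (force simp: C2_bound_def)
  have ul: "uniform_limit {0..1} (\<lambda>k s. \<Sum>n<k. cos_coeff g (Suc n) * cos (real (Suc n) * pi * s)) G sequentially"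
    unfolding G_def
  proof (rule Weierstrass_m_test[OF _ summable_inverse_square[of B]])
    fix n and s :: real
    have "\<bar>cos_coeff g (Suc n)\<bar> * \<bar>cos (real (Suc n) * pi * s)\<bar> \<le> B / (real (Suc n))\<^sup>2 * 1"
      using cos_coeff_bound[OF g, of "Suc n"] by (intro mult_mono) auto
    then show "norm (cos_coeff g (Suc n) * cos (real (Suc n) * pi * s)) \<le> B / (real (Suc n))\<^sup>2"
      by (simp add: abs_mult)
  qed
  have Gc: "continuous_on {0..1} G"
    by (rule uniform_limit_theorem[OF _ ul]) (auto intro!: always_eventually continuous_intros)
  have coeff: "integral {0..1} (\<lambda>s. G s * cos (real m * pi * s)) =
      (if m = 0 then 0 else cos_coeff g m / 2)" for m :: nat
  proof -
    have ul': "uniform_limit {0..1} (\<lambda>k s. (\<Sum>n<k. cos_coeff g (Suc n) * cos (real (Suc n) * pi * s)) * cos (real m * pi * s))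
      (\<lambda>s. G s * cos (real m * pi * s)) sequentially"
    proof (rule uniform_lim_mult[OF ul])
      show "bounded (G ` {0..1})"
        by (intro compact_imp_bounded compact_continuous_image Gc) auto
      show "bounded ((\<lambda>s. cos (real m * pi * s)) ` {0..1})"
        by (intro compact_imp_bounded compact_continuous_image continuous_intros) auto
    qed (rule uniform_limit_const)
    obtain I J where IJ: "\<And>k. ((\<lambda>s. (\<Sum>n<k. cos_coeff g (Suc n) * cos (real (Suc n) * pi * s)) * cos (real m * pi * s))
          has_integral I k) {0..1}"
        "((\<lambda>s. G s * cos (real m * pi * s)) has_integral J) {0..1}" "I \<longlonglongrightarrow> J"
    proof (rule uniform_limit_integral[OF ul' _ sequentially_bot])
      show "continuous_on {0..1} (\<lambda>s. (\<Sum>n<k. cos_coeff g (Suc n) * cos (real (Suc n) * pi * s)) * cos (real m * pi * s))" for k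
        by (intro continuous_intros)
    qed (rule that)
    then have "(\<lambda>k. integral {0..1} (\<lambda>s. (\<Sum>n<k. cos_coeff g (Suc n) * cos (real (Suc n) * pi * s)) * cos (real m * pi * s)))
       \<longlonglongrightarrow> integral {0..1} (\<lambda>s. G s * cos (real m * pi * s))"
      unfolding integral_unique[OF IJ(1)] integral_unique[OF IJ(2)] by blast
    moreover have "(\<lambda>k. integral {0..1} (\<lambda>s. (\<Sum>n<k. cos_coeff g (Suc n) * cos (real (Suc n) * pi * s)) * cos (real m * pi * s)))
       \<longlonglongrightarrow> (if m = 0 then 0 else cos_coeff g m / 2)"
    proof (rule tendsto_eventually, rule eventually_sequentiallyI[of m])
      fix k assume k: "m \<le> k"
      have "integral {0..1} (\<lambda>s. (\<Sum>n<k. cos_coeff g (Suc n) * cos (real (Suc n) * pi * s)) * cos (real m * pi * s))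
        = integral {0..1} (\<lambda>s. \<Sum>n<k. cos_coeff g (Suc n) * (cos (real (Suc n) * pi * s) * cos (real m * pi * s)))"
        by (simp add: sum_distrib_right mult.assoc)
      also have "\<dots> = (\<Sum>n<k. cos_coeff g (Suc n) * integral {0..1} (\<lambda>s. cos (real (Suc n) * pi * s) * cos (real m * pi * s)))"
        by (subst integral_sum) (auto intro!: integrable_continuous_real continuous_intros)
      also have "\<dots> = (\<Sum>n<k. if Suc n = m then cos_coeff g m / 2 else 0)"
        by (intro sum.cong refl, subst cos_pi_orthogonal) auto
      also have "\<dots> = (if m = 0 then 0 else cos_coeff g m / 2)"
        using k by (cases m) (auto simp: sum.delta)
      finally show "integral {0..1} (\<lambda>s. (\<Sum>n<k. cos_coeff g (Suc n) * cos (real (Suc n) * pi * s)) * cos (real m * pi * s)) =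
        (if m = 0 then 0 else cos_coeff g m / 2)" .
    qed
    ultimately show ?thesis by (rule LIMSEQ_unique)
  qed
  have "g s - G s = 0"
  proof (rule cos_coeffs_determine[of "\<lambda>s. g s - G s"])
    fix n :: nat
    have "integral {0..1} (\<lambda>s. (g s - G s) * cos (real n * pi * s)) =
       integral {0..1} (\<lambda>s. g s * cos (real n * pi * s)) - integral {0..1} (\<lambda>s. G s * cos (real n * pi * s))"
      unfolding left_diff_distrib
      by (rule integral_diff) (intro integrable_continuous_real continuous_intros gc Gc)+
    also have "\<dots> = 0" unfolding coeff using mean by (auto simp: cos_coeff_def)
    finally show "integral {0..1} (\<lambda>s. (g s - G s) * cos (real n * pi * s)) = 0" .
  qed (use s in \<open>auto intro!: continuous_intros gc Gc\<close>)
  then show ?thesis by (simp add: G_def)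
qed

section \<open>Harmonic flow with data on one edge\<close>

text \<open>
  Exponential decay of the \<open>n\<close>-th mode in the distance \<open>t\<close> from the edge becomes the bound \<open>(n t)\<close> to the power
  \<open>- e\<close>.  The gain in \<open>n\<close>, however small, is what makes the differentiated series converge.
\<close>

lemma exp_minus_le_powr:
  fixes x e :: real
  assumes "0 < x" "0 < e" "e < 1"
  shows "exp (- x) \<le> x powr (- e)"
proof -
  have "x powr e \<le> exp x"
  proof (cases "x \<le> 1")
    case True
    have "x powr e \<le> 1 powr e" using True assms by (intro powr_mono2) auto
    also have "\<dots> \<le> exp x" using assms by simp
    finally show ?thesis .
  next
    case False
    then have "x powr e \<le> x powr 1" using assms by (intro powr_mono) auto
    also have "x powr 1 \<le> exp x" using exp_gt_self[of x] assms by simp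
    finally show ?thesis .
  qed
  then show ?thesis using assms by (simp add: exp_minus powr_minus le_imp_inverse_le)
qed

text \<open>
  Series of products in the distance \<open>t\<close> from an edge and the coordinate \<open>s\<close> along it.  The factors \<open>Xh\<close> and \<open>Yh\<close> are
  the derivatives of \<open>X\<close> and \<open>Y\<close> divided by \<open>- n \<pi>\<close> and \<open>n \<pi>\<close>.  The two components of a harmonic flow are both of this form, with
  \<open>X\<close> and \<open>Xh\<close> exchanged.  The index starts at the frequency 1, hence the successors.
\<close>

locale edge_series =
  fixes c :: "nat \<Rightarrow> real" and B D h e :: real and X Xh Y Yh :: "nat \<Rightarrow> real \<Rightarrow> real"
  assumes e: "0 < e" "e < 1" and D: "0 \<le> D"
    and c: "\<And>n. \<bar>c n\<bar> \<le> B / (real (Suc n))\<^sup>2"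
    and X: "\<And>n t. (X n has_real_derivative - (real (Suc n) * pi) * Xh n t) (at t)"
    and Xh: "\<And>n t. isCont (Xh n) t"
    and Xb: "\<And>n t. 0 \<le> t \<Longrightarrow> t \<le> h \<Longrightarrow> \<bar>X n t\<bar> \<le> D * exp (- (real (Suc n) * pi * t))"
    and Xhb: "\<And>n t. 0 \<le> t \<Longrightarrow> t \<le> h \<Longrightarrow> \<bar>Xh n t\<bar> \<le> D * exp (- (real (Suc n) * pi * t))"
    and Y: "\<And>n s. (Y n has_real_derivative (real (Suc n) * pi) * Yh n s) (at s)"
    and Yhc: "\<And>n s. isCont (Yh n) s"
    and Yb: "\<And>n s. \<bar>Y n s\<bar> \<le> 1" and Yhb: "\<And>n s. \<bar>Yh n s\<bar> \<le> 1"
begin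

definition zeta :: real where "zeta = (\<Sum>n. real (Suc n) powr (- (1 + e)))"

definition f :: "real \<times> real \<Rightarrow> real" where
  "f z = (\<Sum>n. c n * (X n (fst z) * Y n (snd z)))"

definition ft :: "real \<times> real \<Rightarrow> real" where
  "ft z = (\<Sum>n. c n * (- (real (Suc n) * pi) * Xh n (fst z) * Y n (snd z)))"

definition fs :: "real \<times> real \<Rightarrow> real" where
  "fs z = (\<Sum>n. c n * (real (Suc n) * pi * Yh n (snd z) * X n (fst z)))"

lemma B0: "0 \<le> B" using c[of 0] by simp

lemma summable_zeta: "summable (\<lambda>n. real (Suc n) powr (- (1 + e)))"
  using summable_real_powr_iff[of "- (1 + e)"] e by (subst summable_Suc_iff) simp

lemma Xb': "\<bar>X n t\<bar> \<le> D" if "0 \<le> t" "t \<le> h" for n t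
proof -
  have "\<bar>X n t\<bar> \<le> D * exp (- (real (Suc n) * pi * t))" by (rule Xb[OF that])
  also have "\<dots> \<le> D * 1" using that D by (intro mult_left_mono) auto
  finally show ?thesis by simp
qed

lemma Xhb': "\<bar>Xh n t\<bar> \<le> D" if "0 \<le> t" "t \<le> h" for n t
proof -
  have "\<bar>Xh n t\<bar> \<le> D * exp (- (real (Suc n) * pi * t))" by (rule Xhb[OF that])
  also have "\<dots> \<le> D * 1" using that D by (intro mult_left_mono) auto
  finally show ?thesis by simp
qed

text \<open>
  A derivative costs \<open>n \<pi>\<close> and leaves a coefficient of order \<open>1 / n\<close>; the decay in \<open>t\<close> contributes the missing
  \<open>n\<close> to the power \<open>- e\<close>.
\<close>

lemma deriv_term_bound:
  assumes x: "\<bar>x\<bar> \<le> D * exp (- (real (Suc n) * pi * t))" and y: "\<bar>y\<bar> \<le> 1" and t: "0 < t0" "t0 \<le> t"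
  shows "\<bar>c n * (real (Suc n) * pi * (x * y))\<bar> \<le> pi * B * D * t0 powr (- e) * real (Suc n) powr (- (1 + e))"
proof -
  define N where "N = real (Suc n)"
  have N: "N > 0" by (simp add: N_def)
  have "\<bar>x\<bar> \<le> D * exp (- (N * pi * t0))"
  proof -
    have "N * pi * t0 \<le> N * pi * t" using t N by (intro mult_left_mono) auto
    then have "D * exp (- (N * pi * t)) \<le> D * exp (- (N * pi * t0))"
      using D by (intro mult_left_mono) auto
    then show ?thesis using x by (simp add: N_def)
  qed
  also have "\<dots> \<le> D * (N * pi * t0) powr (- e)"
    using D N t e by (intro mult_left_mono exp_minus_le_powr) auto
  also have "\<dots> \<le> D * (N * t0) powr (- e)"
  proof -
    have "N * t0 * 1 \<le> N * t0 * pi" using pi_gt3 N t by (intro mult_left_mono) auto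
    then have "(N * pi * t0) powr (- e) \<le> (N * t0) powr (- e)"
      using N t e by (intro powr_mono2') (auto simp: mult_ac)
    then show ?thesis using D by (rule mult_left_mono)
  qed
  finally have x': "\<bar>x\<bar> \<le> D * (N * t0) powr (- e)" .
  have "\<bar>c n * (N * pi * (x * y))\<bar> = \<bar>c n\<bar> * (N * pi * (\<bar>x\<bar> * \<bar>y\<bar>))"
    using N by (simp add: abs_mult)
  also have "\<dots> \<le> B / N\<^sup>2 * (N * pi * (D * (N * t0) powr (- e) * 1))"
    using c[of n] x' y N B0 D by (intro mult_mono) (auto simp: N_def)
  also have "\<dots> = pi * B * D * t0 powr (- e) * (N powr (- e) / N)"
    using N t by (simp add: powr_mult power2_eq_square field_simps)
  also have "N powr (- e) / N = N powr (- (1 + e))"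
  proof -
    have "- (1 + e) = - e - 1" by simp
    then show ?thesis using N by (simp only: powr_diff powr_one)
  qed
  finally show ?thesis by (simp add: N_def)
qed

lemma ft_term: 
  assumes "0 < t0" "t0 \<le> fst z" "fst z \<le> h"
  shows "norm (c n * (- (real (Suc n) * pi) * Xh n (fst z) * Y n (snd z))) \<le>
    pi * B * D * t0 powr (- e) * real (Suc n) powr (- (1 + e))"
proof -
  have "\<bar>c n * (real (Suc n) * pi * (Xh n (fst z) * Y n (snd z)))\<bar> \<le>
    pi * B * D * t0 powr (- e) * real (Suc n) powr (- (1 + e))"
    by (rule deriv_term_bound[OF Xhb Yb]) (use assms in auto)
  then show ?thesis by (simp add: abs_mult mult_ac)
qed

lemma fs_term: 
  assumes "0 < t0" "t0 \<le> fst z" "fst z \<le> h"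
  shows "norm (c n * (real (Suc n) * pi * Yh n (snd z) * X n (fst z))) \<le>
    pi * B * D * t0 powr (- e) * real (Suc n) powr (- (1 + e))"
proof -
  have "\<bar>c n * (real (Suc n) * pi * (X n (fst z) * Yh n (snd z)))\<bar> \<le>
    pi * B * D * t0 powr (- e) * real (Suc n) powr (- (1 + e))"
    by (rule deriv_term_bound[OF Xb Yhb]) (use assms in auto)
  then show ?thesis by (simp add: abs_mult mult_ac)
qed

lemma summable_maj: "summable (\<lambda>n. K * real (Suc n) powr (- (1 + e)))"
  by (intro summable_mult summable_zeta)

lemma suminf_bound:
  fixes a :: "nat \<Rightarrow> real"
  assumes "\<And>n. norm (a n) \<le> K * real (Suc n) powr (- (1 + e))"
  shows "summable a" "\<bar>suminf a\<bar> \<le> K * zeta"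
proof -
  show "summable a" by (rule summable_comparison_test'[OF summable_maj]) (rule assms)
  have "norm (suminf a) \<le> (\<Sum>n. K * real (Suc n) powr (- (1 + e)))"
    by (rule norm_suminf_le[OF assms summable_maj])
  then show "\<bar>suminf a\<bar> \<le> K * zeta"
    by (simp only: zeta_def suminf_mult[OF summable_zeta] real_norm_def)
qed

lemma deriv_bounds:
  assumes "0 < fst z" "fst z \<le> h"
  shows "\<bar>ft z\<bar> \<le> pi * B * D * fst z powr (- e) * zeta" "\<bar>fs z\<bar> \<le> pi * B * D * fst z powr (- e) * zeta"
proof -
  show "\<bar>ft z\<bar> \<le> pi * B * D * fst z powr (- e) * zeta"
    unfolding ft_def by (rule suminf_bound(2), rule ft_term) (use assms in auto)
  show "\<bar>fs z\<bar> \<le> pi * B * D * fst z powr (- e) * zeta"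
    unfolding fs_def by (rule suminf_bound(2), rule fs_term) (use assms in auto)
qed

text \<open>
  Up to the edge \<open>t = 0\<close> the convergence is not uniform, but it is so on \<open>t \<ge> t0\<close> for every \<open>t0 > 0\<close>.
\<close>

lemma cont_deriv:
  "continuous_on ({0<..<h} \<times> UNIV) ft" "continuous_on ({0<..<h} \<times> UNIV) fs"
proof -
  have "continuous_on ({0<..<h} \<times> UNIV) F"
    if F: "F = (\<lambda>z. \<Sum>n. a n z)" and ca: "\<And>n. continuous_on UNIV (a n)"
     and b: "\<And>n z t0. 0 < t0 \<Longrightarrow> t0 \<le> fst z \<Longrightarrow> fst z \<le> h \<Longrightarrow>
        norm (a n z) \<le> pi * B * D * t0 powr (- e) * real (Suc n) powr (- (1 + e))"
    for F and a :: "nat \<Rightarrow> real \<times> real \<Rightarrow> real"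
  proof (rule continuous_at_imp_continuous_on, rule ballI)
    fix z :: "real \<times> real" assume z: "z \<in> {0<..<h} \<times> UNIV"
    define t0 where "t0 = fst z / 2"
    have t0: "0 < t0" "t0 < fst z" using z by (auto simp: t0_def)
    have "uniform_limit ({t0<..<h} \<times> UNIV) (\<lambda>k z. \<Sum>n<k. a n z) F sequentially"
      unfolding F
      by (rule Weierstrass_m_test[OF _ summable_maj[of "pi * B * D * t0 powr (- e)"]], rule b) (use t0 in auto)
    then have "continuous_on ({t0<..<h} \<times> UNIV) F"
      by (rule uniform_limit_theorem[rotated])
         (auto intro!: always_eventually continuous_on_sum continuous_on_subset[OF ca])
    then show "isCont F z"
      using t0 z by (auto simp: continuous_on_eq_continuous_at open_Times)
  qed
  note * = this
  have Xc: "continuous_on UNIV (X n)" "continuous_on UNIV (Y n)" for n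
    using X Y by (auto intro!: continuous_at_imp_continuous_on DERIV_isCont)
  have Xhc: "continuous_on UNIV (Xh n)" "continuous_on UNIV (Yh n)" for n
    using Xh Yhc by (auto intro!: continuous_at_imp_continuous_on)
  have comp: "continuous_on UNIV (\<lambda>z::real\<times>real. g (fst z))" "continuous_on UNIV (\<lambda>z::real\<times>real. g (snd z))"
    if "continuous_on UNIV g" for g :: "real \<Rightarrow> real"
    using continuous_on_compose2[OF that continuous_on_fst[OF continuous_on_id]]
      continuous_on_compose2[OF that continuous_on_snd[OF continuous_on_id]]
    by auto
  show "continuous_on ({0<..<h} \<times> UNIV) ft"
  proof (rule *)
    show "ft = (\<lambda>z. \<Sum>n. c n * (- (real (Suc n) * pi) * Xh n (fst z) * Y n (snd z)))"
      by (rule ext) (rule ft_def)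
    show "continuous_on UNIV (\<lambda>z::real\<times>real. c n * (- (real (Suc n) * pi) * Xh n (fst z) * Y n (snd z)))" for n
      by (intro continuous_on_mult continuous_on_const comp Xc Xhc)
  qed (rule ft_term)
  show "continuous_on ({0<..<h} \<times> UNIV) fs"
  proof (rule *)
    show "fs = (\<lambda>z. \<Sum>n. c n * (real (Suc n) * pi * Yh n (snd z) * X n (fst z)))"
      by (rule ext) (rule fs_def)
    show "continuous_on UNIV (\<lambda>z::real\<times>real. c n * (real (Suc n) * pi * Yh n (snd z) * X n (fst z)))" for n
      by (intro continuous_on_mult continuous_on_const comp Xc Xhc)
  qed (rule fs_term)
qed

lemma f_term: "norm (c n * (X n t * Y n s)) \<le> B * D * real (Suc n) powr (- (1 + e))"
  if "0 \<le> t" "t \<le> h" for n t s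
proof -
  have "\<bar>c n\<bar> * (\<bar>X n t\<bar> * \<bar>Y n s\<bar>) \<le> B / (real (Suc n))\<^sup>2 * (D * 1)"
    using c[of n] Xb'[OF that] Yb B0 D by (intro mult_mono) auto
  also have "\<dots> = B * D * real (Suc n) powr (- 2)"
    by (simp only: powr_minus powr_numeral divide_inverse mult.assoc mult_1_right) (simp add: mult_ac)
  also have "\<dots> \<le> B * D * real (Suc n) powr (- (1 + e))"
    using B0 D e by (intro mult_left_mono powr_mono) auto
  finally show ?thesis by (simp add: abs_mult)
qed

lemma f_bound: "\<bar>f z\<bar> \<le> B * D * zeta" if "0 \<le> fst z" "fst z \<le> h"
  unfolding f_def by (rule suminf_bound[OF f_term[OF that]])

lemma summable_f: "summable (\<lambda>n. c n * (X n t * Y n s))" if "0 \<le> t" "t \<le> h"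
  by (rule suminf_bound[OF f_term[OF that]])

lemma f_deriv_t:
  assumes "0 < t" "t < h"
  shows "((\<lambda>t. f (t, s)) has_real_derivative ft (t, s)) (at t)"
proof -
  have "((\<lambda>t. \<Sum>n. c n * (X n t * Y n s)) has_real_derivative
      (\<Sum>n. c n * (- (real (Suc n) * pi) * Xh n t * Y n s))) (at t)"
  proof (rule has_field_derivative_series'(2)[where S = "{t/2<..<h}" and ?x0.0 = t])
    show "((\<lambda>t. c n * (X n t * Y n s)) has_real_derivative c n * (- (real (Suc n) * pi) * Xh n x * Y n s))
       (at x within {t/2<..<h})" for n x
      by (intro DERIV_cmult DERIV_cmult_right has_field_derivative_at_within[OF X])
    show "uniformly_convergent_on {t/2<..<h} (\<lambda>m x. \<Sum>n<m. c n * (- (real (Suc n) * pi) * Xh n x * Y n s))"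
      by (rule Weierstrass_m_test'[OF _ summable_maj[of "pi * B * D * (t/2) powr (- e)"]])
         (use ft_term[of "t/2" "(x, s)" for x] assms in auto)
    show "summable (\<lambda>n. c n * (X n t * Y n s))" using assms by (intro summable_f) auto
  qed (use assms in auto)
  then show ?thesis by (simp add: f_def[abs_def] ft_def)
qed

lemma f_deriv_s:
  assumes "0 < t" "t < h"
  shows "((\<lambda>s. f (t, s)) has_real_derivative fs (t, s)) (at s)"
proof -
  have "((\<lambda>s. \<Sum>n. c n * (X n t * Y n s)) has_real_derivative
      (\<Sum>n. c n * (real (Suc n) * pi * Yh n s * X n t))) (at s)"
  proof (rule has_field_derivative_series'(2)[where S = UNIV and ?x0.0 = s])
    show "((\<lambda>s. c n * (X n t * Y n s)) has_real_derivative c n * (real (Suc n) * pi * Yh n x * X n t))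
       (at x within UNIV)" for n x
      by (subst mult.commute[of "X n t"]) (intro DERIV_cmult DERIV_cmult_right Y)
    show "uniformly_convergent_on UNIV (\<lambda>m x. \<Sum>n<m. c n * (real (Suc n) * pi * Yh n x * X n t))"
      by (rule Weierstrass_m_test'[OF _ summable_maj[of "pi * B * D * t powr (- e)"]])
         (use fs_term[of t "(t, x)" for x] assms in auto)
    show "summable (\<lambda>n. c n * (X n t * Y n s))" using assms by (intro summable_f) auto
  qed (use assms in auto)
  then show ?thesis by (simp add: f_def[abs_def] fs_def)
qed

text \<open>
  The \<open>N\<close>-th mode is bounded and has a Lipschitz constant of order \<open>N\<close>; between the two bounds lies a Hoelder
  bound whose constant grows like \<open>N\<close> to the power \<open>1 - e\<close> only, which is summable against \<open>1 / N\<^sup>2\<close>.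
\<close>

lemma holder_of_lipschitz:
  fixes x K N d :: real
  assumes "\<bar>x\<bar> \<le> 2 * K" "\<bar>x\<bar> \<le> N * pi * K * d" "0 \<le> K" "0 < N" "0 \<le> d"
  shows "\<bar>x\<bar> \<le> 2 * pi * K * (N * d) powr (1 - e)"
proof (cases "N * d \<le> 1")
  case True
  have "\<bar>x\<bar> \<le> pi * K * (N * d)" using assms by (simp add: mult_ac)
  also have "\<dots> = pi * K * (N * d) powr 1" using assms by simp
  also have "\<dots> \<le> pi * K * (N * d) powr (1 - e)"
    using True assms e by (intro mult_left_mono) (use powr_mono'[of "1 - e" 1 "N * d"] in auto)
  also have "\<dots> \<le> 2 * pi * K * (N * d) powr (1 - e)" using assms by simp
  finally show ?thesis .
next
  case False
  have "K * 1 \<le> K * pi" using pi_gt3 assms by (intro mult_left_mono) auto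
  then have "2 * K \<le> 2 * pi * K * 1" by (simp add: mult.commute)
  also have "1 \<le> (N * d) powr (1 - e)" using False e by (intro ge_one_powr_ge_zero) auto
  then have "2 * pi * K * 1 \<le> 2 * pi * K * (N * d) powr (1 - e)"
    using assms by (intro mult_left_mono) auto
  finally show ?thesis using assms by linarith
qed

lemma f_holder:
  assumes "0 \<le> t" "t \<le> h" "0 \<le> t'" "t' \<le> h"
  shows "\<bar>f (t, s) - f (t', s')\<bar> \<le>
    2 * pi * B * D * zeta * (\<bar>t - t'\<bar> powr (1 - e) + \<bar>s - s'\<bar> powr (1 - e))"
proof -
  define Q where "Q = \<bar>t - t'\<bar> powr (1 - e) + \<bar>s - s'\<bar> powr (1 - e)"
  have term_bd: "norm (c n * (X n t * Y n s) - c n * (X n t' * Y n s')) \<le> 2 * pi * B * D * Q * real (Suc n) powr (- (1 + e))" for n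
  proof -
    define N where "N = real (Suc n)"
    have N: "N > 0" by (simp add: N_def)
    have x: "\<bar>X n t - X n t'\<bar> \<le> 2 * pi * D * (N * \<bar>t - t'\<bar>) powr (1 - e)"
    proof (rule holder_of_lipschitz)
      show "\<bar>X n t - X n t'\<bar> \<le> 2 * D"
        using Xb'[OF assms(1,2), of n] Xb'[OF assms(3,4), of n] by linarith
      have "norm (X n t - X n t') \<le> (N * pi * D) * norm (t - t')"
      proof (rule field_differentiable_bound[where S = "{0..h}"])
        fix z assume z: "z \<in> {0..h}"
        show "(X n has_real_derivative - (real (Suc n) * pi) * Xh n z) (at z within {0..h})"
          by (rule has_field_derivative_at_within[OF X])
        have "\<bar>Xh n z\<bar> \<le> D" using z by (intro Xhb') auto
        then have "N * pi * \<bar>Xh n z\<bar> \<le> N * pi * D" using N by (intro mult_left_mono) auto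
        then show "norm (- (real (Suc n) * pi) * Xh n z) \<le> N * pi * D" using N by (simp add: abs_mult N_def)
      qed (use assms in auto)
      then show "\<bar>X n t - X n t'\<bar> \<le> N * pi * D * \<bar>t - t'\<bar>" by simp
    qed (use N D in auto)
    have y: "\<bar>Y n s - Y n s'\<bar> \<le> 2 * pi * 1 * (N * \<bar>s - s'\<bar>) powr (1 - e)"
    proof (rule holder_of_lipschitz)
      show "\<bar>Y n s - Y n s'\<bar> \<le> 2 * 1"
        using Yb[of n s] Yb[of n s'] by linarith
      have "norm (Y n s - Y n s') \<le> (N * pi * 1) * norm (s - s')"
      proof (rule field_differentiable_bound[where S = UNIV])
        fix z :: real
        show "(Y n has_real_derivative (real (Suc n) * pi) * Yh n z) (at z within UNIV)"
          by (rule has_field_derivative_at_within[OF Y])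
        have "N * pi * \<bar>Yh n z\<bar> \<le> N * pi * 1" using N Yhb by (intro mult_left_mono) auto
        then show "norm ((real (Suc n) * pi) * Yh n z) \<le> N * pi * 1" using N by (simp add: abs_mult N_def)
      qed auto
      then show "\<bar>Y n s - Y n s'\<bar> \<le> N * pi * 1 * \<bar>s - s'\<bar>" by simp
    qed (use N in auto)
    have "X n t * Y n s - X n t' * Y n s' = (X n t - X n t') * Y n s + X n t' * (Y n s - Y n s')"
      by (simp add: algebra_simps)
    also have "\<bar>\<dots>\<bar> \<le> \<bar>X n t - X n t'\<bar> * \<bar>Y n s\<bar> + \<bar>X n t'\<bar> * \<bar>Y n s - Y n s'\<bar>"
      using abs_triangle_ineq unfolding abs_mult[symmetric] .
    also have "\<dots> \<le> 2 * pi * D * (N * \<bar>t - t'\<bar>) powr (1 - e) * 1 + D * (2 * pi * 1 * (N * \<bar>s - s'\<bar>) powr (1 - e))"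
      using Yb Xb'[OF assms(3,4)] x y D by (intro add_mono mult_mono) auto
    also have "\<dots> = 2 * pi * D * N powr (1 - e) * Q"
      using N by (simp add: Q_def powr_mult algebra_simps)
    finally have d: "\<bar>X n t * Y n s - X n t' * Y n s'\<bar> \<le> 2 * pi * D * N powr (1 - e) * Q" .
    have "\<bar>c n * (X n t * Y n s) - c n * (X n t' * Y n s')\<bar> = \<bar>c n\<bar> * \<bar>X n t * Y n s - X n t' * Y n s'\<bar>"
      by (simp add: abs_mult[symmetric] right_diff_distrib)
    also have "\<dots> \<le> B / N\<^sup>2 * (2 * pi * D * N powr (1 - e) * Q)"
      using c[of n] d B0 by (intro mult_mono) (auto simp: N_def)
    also have "\<dots> = 2 * pi * B * D * Q * (N powr (1 - e) / N powr 2)"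
      using N powr_realpow[of N 2] by simp
    also have "N powr (1 - e) / N powr 2 = N powr (- (1 + e))"
      using powr_diff[of N "1 - e" 2] by simp
    finally show ?thesis by (simp add: N_def)
  qed
  have "f (t, s) - f (t', s') = (\<Sum>n. c n * (X n t * Y n s) - c n * (X n t' * Y n s'))"
    unfolding f_def by (simp add: suminf_diff[OF summable_f summable_f] assms)
  then show ?thesis using suminf_bound(2)[OF term_bd] by (simp add: Q_def mult_ac)
qed

end

text \<open>
  A conjugate harmonic pair on a strip of depth \<open>h\<close>: \<open>u\<close> takes the values \<open>g\<close> on the edge \<open>t = 0\<close> and vanishes on
  the opposite edge, \<open>v\<close> vanishes on the two sides.  The derivatives of \<open>v\<close> are given through those of \<open>u\<close> by the
  Cauchy-Riemann equations \<open>\<partial>\<^sub>t v = \<partial>\<^sub>s u\<close> and \<open>\<partial>\<^sub>s v = - \<partial>\<^sub>t u\<close>.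
\<close>

definition edge_flow :: "real \<Rightarrow> real \<Rightarrow> real \<Rightarrow> (real \<Rightarrow> real) \<Rightarrow> (real \<times> real \<Rightarrow> real) \<Rightarrow>
    (real \<times> real \<Rightarrow> real) \<Rightarrow> (real \<times> real \<Rightarrow> real) \<Rightarrow> (real \<times> real \<Rightarrow> real) \<Rightarrow> bool" where
  "edge_flow h e M g u v ut us \<longleftrightarrow>
     (\<forall>s\<in>{0..1}. u (0, s) = g s \<and> u (h, s) = 0) \<and>
     (\<forall>t\<in>{0..h}. v (t, 0) = 0 \<and> v (t, 1) = 0) \<and>
     (\<forall>t s. 0 < t \<longrightarrow> t < h \<longrightarrow>
        ((\<lambda>t. u (t, s)) has_real_derivative ut (t, s)) (at t) \<and>
        ((\<lambda>s. u (t, s)) has_real_derivative us (t, s)) (at s) \<and>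
        ((\<lambda>t. v (t, s)) has_real_derivative us (t, s)) (at t) \<and>
        ((\<lambda>s. v (t, s)) has_real_derivative - ut (t, s)) (at s) \<and>
        \<bar>ut (t, s)\<bar> \<le> M * t powr (- e) \<and> \<bar>us (t, s)\<bar> \<le> M * t powr (- e)) \<and>
     continuous_on ({0<..<h} \<times> UNIV) ut \<and> continuous_on ({0<..<h} \<times> UNIV) us \<and>
     (\<forall>t\<in>{0..h}. \<forall>s. \<bar>u (t, s)\<bar> \<le> M \<and> \<bar>v (t, s)\<bar> \<le> M) \<and>
     (\<forall>t\<in>{0..h}. \<forall>t'\<in>{0..h}. \<forall>s s'.
        \<bar>u (t, s) - u (t', s')\<bar> \<le> M * (\<bar>t - t'\<bar> powr (1 - e) + \<bar>s - s'\<bar> powr (1 - e)) \<and>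
        \<bar>v (t, s) - v (t', s')\<bar> \<le> M * (\<bar>t - t'\<bar> powr (1 - e) + \<bar>s - s'\<bar> powr (1 - e)))"

text \<open>
  The ratio \<open>sinh x / exp x\<close> increases, so it is bounded below for \<open>x \<ge> \<pi> h0\<close>.  This makes the constant uniform in
  all frequencies and all depths \<open>h \<ge> h0\<close>.
\<close>

lemma sinh_ratio_bounds:
  fixes w h h0 t :: real
  assumes "0 < h0" "h0 \<le> h" "pi \<le> w" "0 \<le> t" "t \<le> h"
  defines "D \<equiv> 1 + 2 / (1 - exp (- (2 * pi * h0)))"
  shows "\<bar>sinh (w * (h - t)) / sinh (w * h)\<bar> \<le> D * exp (- (w * t))"
    and "\<bar>cosh (w * (h - t)) / sinh (w * h)\<bar> \<le> D * exp (- (w * t))"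
proof -
  have w: "w > 0" using assms(3) pi_gt_zero by linarith
  have h: "h > 0" using assms by linarith
  have sp: "sinh (w * h) > 0" using w h by simp
  have E: "exp (- (2 * pi * h0)) < 1" using assms by simp
  have D1: "D \<ge> 1" using E by (simp add: D_def)
  have s: "sinh (w * (h - t)) \<le> exp (- (w * t)) * sinh (w * h)"
  proof -
    have "sinh (w * (h - t)) = sinh (w * h) * cosh (w * t) - cosh (w * h) * sinh (w * t)"
      by (simp add: right_diff_distrib sinh_diff)
    also have "\<dots> \<le> sinh (w * h) * cosh (w * t) - sinh (w * h) * sinh (w * t)"
      using w assms by (intro diff_left_mono mult_right_mono sinh_le_cosh_real) auto
    also have "\<dots> = exp (- (w * t)) * sinh (w * h)"
      by (simp add: cosh_minus_sinh[symmetric] algebra_simps)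
    finally show ?thesis .
  qed
  have s0: "sinh (w * (h - t)) \<ge> 0" using w assms by simp
  have "sinh (w * (h - t)) / sinh (w * h) \<le> exp (- (w * t))"
    using s sp by (simp add: pos_divide_le_eq)
  also have "\<dots> \<le> D * exp (- (w * t))" using D1 by simp
  finally show "\<bar>sinh (w * (h - t)) / sinh (w * h)\<bar> \<le> D * exp (- (w * t))"
    using s0 sp by simp
  define x where "x = w * h"
  have "pi * h0 \<le> x" unfolding x_def using assms w by (intro mult_mono) auto
  then have ex: "exp (- (2 * x)) \<le> exp (- (2 * pi * h0))" by simp
  have "exp x * (1 - exp (- (2 * pi * h0))) \<le> exp x * (1 - exp (- (2 * x)))"
    using ex by (intro mult_left_mono) auto
  also have "\<dots> = 2 * sinh x"
    by (simp add: sinh_def right_diff_distrib exp_add[symmetric])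
  finally have big: "exp x \<le> 2 / (1 - exp (- (2 * pi * h0))) * sinh x"
    using E by (simp add: field_simps)
  \<comment> \<open>the difference between \<open>cosh\<close> and \<open>sinh\<close> is largest at the far edge \<open>t = h\<close>\<close>
  have "exp (- (w * (h - t))) = exp (- (w * t)) * exp (w * t - w * (h - t))"
    by (simp add: exp_add[symmetric])
  also have "\<dots> \<le> exp (- (w * t)) * exp x"
  proof -
    have "w * t \<le> w * h" using w assms by (intro mult_left_mono) auto
    moreover have "w * (h - t) \<ge> 0" using w assms by simp
    ultimately show ?thesis by (simp add: x_def)
  qed
  also have "\<dots> \<le> exp (- (w * t)) * (2 / (1 - exp (- (2 * pi * h0))) * sinh x)"
    using big by (intro mult_left_mono) auto
  finally have e: "exp (- (w * (h - t))) \<le> exp (- (w * t)) * (2 / (1 - exp (- (2 * pi * h0))) * sinh (w * h))"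
    by (simp add: x_def)
  have "cosh (w * (h - t)) = sinh (w * (h - t)) + exp (- (w * (h - t)))"
    by (simp add: cosh_minus_sinh[symmetric])
  also have "\<dots> \<le> exp (- (w * t)) * sinh (w * h) + exp (- (w * t)) * (2 / (1 - exp (- (2 * pi * h0))) * sinh (w * h))"
    using s e by (rule add_mono)
  also have "\<dots> = D * exp (- (w * t)) * sinh (w * h)" by (simp add: D_def algebra_simps)
  finally have "cosh (w * (h - t)) / sinh (w * h) \<le> D * exp (- (w * t))"
    using sp by (simp add: pos_divide_le_eq)
  then show "\<bar>cosh (w * (h - t)) / sinh (w * h)\<bar> \<le> D * exp (- (w * t))"
    using sp by simp
qed

text \<open>
  Separation of variables: the mode \<open>cos (n \<pi> s)\<close> of \<open>g\<close> continues into the strip with the amplitude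
  \<open>sinh (n \<pi> (h - t)) / sinh (n \<pi> h)\<close>, and its conjugate has \<open>cosh\<close> and \<open>sin\<close> instead.  The mean value of \<open>g\<close> must
  vanish because the conjugate of the constant mode does not vanish on both sides.
\<close>

lemma edge_flow_exists:
  fixes h0 e :: real
  assumes h0: "0 < h0" and e: "0 < e" "e < 1"
  obtains C where "0 \<le> C"
    "\<And>h g g' g'' B. h0 \<le> h \<Longrightarrow> C2_bound {0..1} g g' g'' B \<Longrightarrow> integral {0..1} g = 0 \<Longrightarrow>
       \<exists>u v ut us. edge_flow h e (C * B) g u v ut us"
proof -
  define D where "D = 1 + 2 / (1 - exp (- (2 * pi * h0)))"
  have D0: "D \<ge> 0" using h0 by (simp add: D_def)
  define zeta where "zeta = (\<Sum>n. real (Suc n) powr (- (1 + e)))"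
  have "summable (\<lambda>n. real (Suc n) powr (- (1 + e)))"
    using summable_real_powr_iff[of "- (1 + e)"] e by (subst summable_Suc_iff) simp
  then have zeta0: "zeta \<ge> 0" unfolding zeta_def by (intro suminf_nonneg allI powr_ge_zero)
  define C where "C = 2 * pi * D * zeta"
  have C0: "C \<ge> 0" using D0 zeta0 by (simp add: C_def)
  show ?thesis
  proof (rule that[OF C0])
    fix h g g' g'' B
    assume h: "h0 \<le> h" and g: "C2_bound {0..1} g g' g'' B" and mean: "integral {0..1} g = 0"
    have hpos: "h > 0" using h h0 by linarith
    define w where "w n = real (Suc n) * pi" for n
    have w: "w n \<ge> pi" "w n > 0" for n using pi_gt_zero mult_nonneg_nonneg[of pi "real n"] by (auto simp: w_def distrib_right mult.commute)
    have sp: "sinh (w n * h) > 0" for n using w(2)[of n] hpos by simp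
    define c where "c n = cos_coeff g (Suc n)" for n
    define a where "a n t = sinh (w n * (h - t)) / sinh (w n * h)" for n t
    define b where "b n t = cosh (w n * (h - t)) / sinh (w n * h)" for n t
    have da: "(a n has_real_derivative - w n * b n t) (at t)" for n t
      unfolding a_def[abs_def] b_def using sp[of n]
      by (auto intro!: derivative_eq_intros simp: field_simps)
    have db: "(b n has_real_derivative - w n * a n t) (at t)" for n t
      unfolding b_def[abs_def] a_def using sp[of n]
      by (auto intro!: derivative_eq_intros simp: field_simps)
    have dcos: "((\<lambda>s. cos (w n * s)) has_real_derivative w n * - sin (w n * s)) (at s)" for n s
      by (auto intro!: derivative_eq_intros)
    have dsin: "((\<lambda>s. sin (w n * s)) has_real_derivative w n * cos (w n * s)) (at s)" for n s
      by (auto intro!: derivative_eq_intros)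
    have cb: "\<bar>c n\<bar> \<le> B / (real (Suc n))\<^sup>2" for n
      unfolding c_def by (rule cos_coeff_bound[OF g]) simp
    have ab: "\<bar>a n t\<bar> \<le> D * exp (- (w n * t))" "\<bar>b n t\<bar> \<le> D * exp (- (w n * t))"
      if "0 \<le> t" "t \<le> h" for n t
      unfolding a_def b_def D_def
      by (rule sinh_ratio_bounds[OF h0 h w(1) that])+
    have cont: "isCont (a n) t" "isCont (b n) t" "isCont (\<lambda>s. - sin (w n * s)) t" "isCont (\<lambda>s. cos (w n * s)) t" for n t
      using DERIV_isCont[OF da] DERIV_isCont[OF db] by (auto intro!: continuous_intros)
    have trig: "\<bar>cos x\<bar> \<le> 1" "\<bar>sin x\<bar> \<le> 1" "\<bar>- sin x\<bar> \<le> 1" for x :: real by auto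
    interpret U: edge_series c B D h e a b "\<lambda>n s. cos (w n * s)" "\<lambda>n s. - sin (w n * s)"
      by (unfold_locales; (unfold w_def[symmetric])?; (rule e D0 cb da db ab dcos dsin cont trig; assumption?))
    interpret V: edge_series c B D h e b a "\<lambda>n s. sin (w n * s)" "\<lambda>n s. cos (w n * s)"
      by (unfold_locales; (unfold w_def[symmetric])?; (rule e D0 cb da db ab dcos dsin cont trig; assumption?))
    have zU: "U.zeta = zeta" and zV: "V.zeta = zeta"
      by (simp_all only: U.zeta_def V.zeta_def zeta_def)
    have B0: "B \<ge> 0" by (rule U.B0)
    have Vt: "V.ft z = U.fs z" for z
      unfolding V.ft_def U.fs_def by (simp add: mult_ac)
    have Vs: "V.fs z = - U.ft z" if "0 < fst z" "fst z < h" for z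
    proof -
      have "summable (\<lambda>n. c n * (- (real (Suc n) * pi) * b n (fst z) * cos (w n * snd z)))"
        by (rule U.suminf_bound(1), rule U.ft_term) (use that in auto)
      from suminf_minus[OF this] show ?thesis
        unfolding V.fs_def U.ft_def by (simp add: mult_ac)
    qed
    have bd1: "B * D * zeta \<le> C * B" and bd2: "pi * B * D * x * zeta \<le> C * B * x" if "x \<ge> 0" for x
    proof -
      have "B * D * zeta * 1 \<le> B * D * zeta * (2 * pi)"
        using pi_gt3 B0 D0 zeta0 by (intro mult_left_mono) auto
      then show "B * D * zeta \<le> C * B" by (simp add: C_def mult_ac)
      have "pi * B * D * x * zeta * 1 \<le> pi * B * D * x * zeta * 2"
        using pi_gt3 B0 D0 zeta0 that by (intro mult_left_mono) auto
      then show "pi * B * D * x * zeta \<le> C * B * x" by (simp add: C_def mult_ac)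
    qed
    have "edge_flow h e (C * B) g U.f V.f U.ft U.fs"
      unfolding edge_flow_def
    proof (intro conjI ballI allI impI)
      fix s :: real assume s: "s \<in> {0..1}"
      have a0: "a n 0 = 1" for n using w(2)[of n] hpos by (simp add: a_def)
      have "g s = (\<Sum>n. c n * cos (w n * s))"
        using cos_series[OF g mean s] unfolding c_def w_def .
      then show "U.f (0, s) = g s"
        by (subst U.f_def) (simp add: a0)
      show "U.f (h, s) = 0" unfolding U.f_def by (simp add: a_def)
    next
      fix t assume t: "t \<in> {0..h}"
      show "V.f (t, 0) = 0" unfolding V.f_def by simp
      have "sin (w n) = 0" for n unfolding w_def by (rule sin_npi)
      then show "V.f (t, 1) = 0" unfolding V.f_def by simp
    next
      fix t s assume t: "0 < t" "t < h"
      show "((\<lambda>t. U.f (t, s)) has_real_derivative U.ft (t, s)) (at t)"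
        "((\<lambda>s. U.f (t, s)) has_real_derivative U.fs (t, s)) (at s)"
        by (rule U.f_deriv_t U.f_deriv_s, use t in auto)+
      show "((\<lambda>t. V.f (t, s)) has_real_derivative U.fs (t, s)) (at t)"
        using V.f_deriv_t[OF t] unfolding Vt .
      show "((\<lambda>s. V.f (t, s)) has_real_derivative - U.ft (t, s)) (at s)"
        using V.f_deriv_s[OF t, of s] Vs[of "(t, s)"] t by simp
      show "\<bar>U.ft (t, s)\<bar> \<le> C * B * t powr (- e)" "\<bar>U.fs (t, s)\<bar> \<le> C * B * t powr (- e)"
        using U.deriv_bounds[of "(t, s)"] t bd2[of "t powr (- e)"] unfolding zU by auto
    next
      show "continuous_on ({0<..<h} \<times> UNIV) U.ft" "continuous_on ({0<..<h} \<times> UNIV) U.fs"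
        by (rule U.cont_deriv)+
    next
      fix t s :: real assume t: "t \<in> {0..h}"
      show "\<bar>U.f (t, s)\<bar> \<le> C * B" "\<bar>V.f (t, s)\<bar> \<le> C * B"
        using U.f_bound[of "(t, s)"] V.f_bound[of "(t, s)"] t bd1[of 0] unfolding zU zV by auto
    next
      fix t t' s s' :: real assume t: "t \<in> {0..h}" "t' \<in> {0..h}"
      have C: "2 * pi * B * D * zeta = C * B" by (simp add: C_def)
      show "\<bar>U.f (t, s) - U.f (t', s')\<bar> \<le> C * B * (\<bar>t - t'\<bar> powr (1 - e) + \<bar>s - s'\<bar> powr (1 - e))"
        using U.f_holder[of t t' s s'] t unfolding zU C by auto
      show "\<bar>V.f (t, s) - V.f (t', s')\<bar> \<le> C * B * (\<bar>t - t'\<bar> powr (1 - e) + \<bar>s - s'\<bar> powr (1 - e))"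
        using V.f_holder[of t t' s s'] t unfolding zV C by auto
    qed
    then show "\<exists>u v ut us. edge_flow h e (C * B) g u v ut us" by blast
  qed
qed

section \<open>The elliptic system in a rectangle\<close>

lemma C2_bound_nonneg: "C2_bound I g g' g'' B \<Longrightarrow> I \<noteq> {} \<Longrightarrow> 0 \<le> B"
  by (force simp: C2_bound_def)

lemma C2_bound_continuous: "C2_bound I g g' g'' B \<Longrightarrow> continuous_on I g"
  unfolding C2_bound_def by (meson DERIV_continuous_on)

lemma C2_bound_mono: "C2_bound I g g' g'' B \<Longrightarrow> B \<le> B' \<Longrightarrow> C2_bound I g g' g'' B'"
  unfolding C2_bound_def by force

lemma C2_bound_diff_const:
  assumes "C2_bound I g g' g'' B" "\<bar>m\<bar> \<le> B"
  shows "C2_bound I (\<lambda>s. g s - m) g' g'' (2 * B)"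
proof -
  have "\<bar>g s - m\<bar> \<le> 2 * B \<and> \<bar>g' s\<bar> \<le> 2 * B \<and> \<bar>g'' s\<bar> \<le> 2 * B" if "s \<in> I" for s
  proof -
    have "\<bar>g s\<bar> \<le> B" "\<bar>g' s\<bar> \<le> B" "\<bar>g'' s\<bar> \<le> B" using assms(1) that by (auto simp: C2_bound_def)
    then show ?thesis using assms(2) by linarith
  qed
  then show ?thesis using assms(1) unfolding C2_bound_def
    by (auto intro!: derivative_eq_intros)
qed

lemma mean_bound:
  assumes "continuous_on {c..d} g" "\<And>s. s \<in> {c..d} \<Longrightarrow> \<bar>g s\<bar> \<le> B" "c \<le> (d::real)"
  shows "\<bar>integral {c..d} g\<bar> \<le> B * (d - c)"
  using integral_bound[OF assms(3,1)] assms(2) by auto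

text \<open>
  Data on the upper edge live on an interval of length \<open>l\<close>, the cosine series on the unit interval.
\<close>

lemma C2_bound_rescale:
  fixes x0 l :: real
  assumes g: "C2_bound {x0..x0 + l} g g' g'' B" and l: "0 < l" "l \<le> L"
  shows "C2_bound {0..1} (\<lambda>s. g (x0 + l * s)) (\<lambda>s. l * g' (x0 + l * s)) (\<lambda>s. l * (l * g'' (x0 + l * s))) ((1 + L + L * L) * B)"
    and "integral {0..1} (\<lambda>s. g (x0 + l * s)) = integral {x0..x0 + l} g / l"
proof -
  have B0: "B \<ge> 0" using C2_bound_nonneg[OF g] l by simp
  have im: "x0 + l * s \<in> {x0..x0 + l}" if "s \<in> {0..1}" for s
    using that l mult_left_mono[of s 1 l] by auto
  have sub: "(\<lambda>s. x0 + l * s) ` {0..1} \<subseteq> {x0..x0 + l}" using im by auto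
  have chain: "((\<lambda>s. f (x0 + l * s)) has_real_derivative l * f' (x0 + l * s)) (at s within {0..1})"
    if f: "\<And>x. x \<in> {x0..x0 + l} \<Longrightarrow> (f has_real_derivative f' x) (at x within {x0..x0 + l})" and s: "s \<in> {0..1}" for f f' s
  proof -
    have "((\<lambda>s. x0 + l * s) has_real_derivative l) (at s within {0..1})"
      by (auto intro!: derivative_eq_intros)
    from DERIV_image_chain[OF DERIV_subset[OF f[OF im[OF s]] sub] this] show ?thesis
      by (simp add: o_def mult.commute)
  qed
  have d: "\<And>x. x \<in> {x0..x0 + l} \<Longrightarrow> (g has_real_derivative g' x) (at x within {x0..x0 + l})"
    "\<And>x. x \<in> {x0..x0 + l} \<Longrightarrow> (g' has_real_derivative g'' x) (at x within {x0..x0 + l})"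
    "continuous_on {x0..x0 + l} g''"
    "\<And>x. x \<in> {x0..x0 + l} \<Longrightarrow> \<bar>g x\<bar> \<le> B" "\<And>x. x \<in> {x0..x0 + l} \<Longrightarrow> \<bar>g' x\<bar> \<le> B"
    "\<And>x. x \<in> {x0..x0 + l} \<Longrightarrow> \<bar>g'' x\<bar> \<le> B"
    using g by (auto simp: C2_bound_def)
  have LB: "B \<le> (1 + L + L * L) * B" "L * B \<le> (1 + L + L * L) * B" "L * L * B \<le> (1 + L + L * L) * B"
    using B0 l by (auto simp: algebra_simps)
  show "C2_bound {0..1} (\<lambda>s. g (x0 + l * s)) (\<lambda>s. l * g' (x0 + l * s)) (\<lambda>s. l * (l * g'' (x0 + l * s))) ((1 + L + L * L) * B)"
    unfolding C2_bound_def
  proof (intro conjI ballI)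
    fix s :: real assume s: "s \<in> {0..1}"
    show "((\<lambda>s. g (x0 + l * s)) has_real_derivative l * g' (x0 + l * s)) (at s within {0..1})"
      by (rule chain[OF d(1) s])
    show "((\<lambda>s. l * g' (x0 + l * s)) has_real_derivative l * (l * g'' (x0 + l * s))) (at s within {0..1})"
      by (rule DERIV_cmult[OF chain[OF d(2) s]])
    show "\<bar>g (x0 + l * s)\<bar> \<le> (1 + L + L * L) * B" using d(4)[OF im[OF s]] LB by linarith
    have "l * \<bar>g' (x0 + l * s)\<bar> \<le> L * B" using d(5)[OF im[OF s]] l by (intro mult_mono) auto
    then show "\<bar>l * g' (x0 + l * s)\<bar> \<le> (1 + L + L * L) * B" using LB l by (simp add: abs_mult)
    have "(l * l) * \<bar>g'' (x0 + l * s)\<bar> \<le> (L * L) * B" using d(6)[OF im[OF s]] l by (intro mult_mono) auto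
    then show "\<bar>l * (l * g'' (x0 + l * s))\<bar> \<le> (1 + L + L * L) * B" using LB l by (simp add: abs_mult mult.assoc)
  next
    show "continuous_on {0..1} (\<lambda>s. l * (l * g'' (x0 + l * s)))"
      using im by (intro continuous_intros continuous_on_compose2[OF d(3)]) auto
  qed
  have "(g has_integral integral {x0..x0 + l} g) (cbox x0 (x0 + l))"
    using integrable_integral[OF integrable_continuous_real[OF C2_bound_continuous[OF g]]] by simp
  from has_integral_affinity'[OF this l(1), of x0]
  have "((\<lambda>s. g (l * s + x0)) has_integral integral {x0..x0 + l} g / l) {0..1}"
    using l by (simp add: divide_inverse mult.commute)
  then show "integral {0..1} (\<lambda>s. g (x0 + l * s)) = integral {x0..x0 + l} g / l"
    by (simp add: integral_unique add.commute)
qed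

text \<open>
  The regularity that remains at corners where the data do not match: the function is Hoelder continuous with
  exponent \<open>1 - e\<close> up to the boundary, and its first derivatives are controlled by the edge weight.
\<close>

definition channel_regular :: "real \<Rightarrow> real \<Rightarrow> real \<Rightarrow> real \<Rightarrow> (real \<times> real \<Rightarrow> real) \<Rightarrow>
    (real \<times> real \<Rightarrow> real) \<Rightarrow> (real \<times> real \<Rightarrow> real) \<Rightarrow> bool" where
  "channel_regular x0 x1 e M f fx fy \<longleftrightarrow>
     (\<forall>x s. x0 < x \<longrightarrow> x < x1 \<longrightarrow> 0 < s \<longrightarrow> s < 1 \<longrightarrow>
        ((\<lambda>x. f (x, s)) has_real_derivative fx (x, s)) (at x) \<and>
        ((\<lambda>s. f (x, s)) has_real_derivative fy (x, s)) (at s) \<and>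
        \<bar>fx (x, s)\<bar> \<le> M * edge_weight e x0 x1 (x, s) \<and> \<bar>fy (x, s)\<bar> \<le> M * edge_weight e x0 x1 (x, s)) \<and>
     continuous_on ({x0<..<x1} \<times> {0<..<1}) fx \<and> continuous_on ({x0<..<x1} \<times> {0<..<1}) fy \<and>
     (\<forall>x s. x0 \<le> x \<longrightarrow> x \<le> x1 \<longrightarrow> 0 \<le> s \<longrightarrow> s \<le> 1 \<longrightarrow> \<bar>f (x, s)\<bar> \<le> M) \<and>
     (\<forall>x s x' s'. x0 \<le> x \<longrightarrow> x \<le> x1 \<longrightarrow> 0 \<le> s \<longrightarrow> s \<le> 1 \<longrightarrow> x0 \<le> x' \<longrightarrow> x' \<le> x1 \<longrightarrow> 0 \<le> s' \<longrightarrow> s' \<le> 1 \<longrightarrow>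
        \<bar>f (x, s) - f (x', s')\<bar> \<le> M * (\<bar>x - x'\<bar> powr (1 - e) + \<bar>s - s'\<bar> powr (1 - e)))"

text \<open>
  The regularity of one component of an edge flow, in the coordinates of its edge.
\<close>

definition edge_regular :: "real \<Rightarrow> real \<Rightarrow> real \<Rightarrow> (real \<times> real \<Rightarrow> real) \<Rightarrow>
    (real \<times> real \<Rightarrow> real) \<Rightarrow> (real \<times> real \<Rightarrow> real) \<Rightarrow> bool" where
  "edge_regular h e M u ut us \<longleftrightarrow>
     (\<forall>t s. 0 < t \<longrightarrow> t < h \<longrightarrow>
        ((\<lambda>t. u (t, s)) has_real_derivative ut (t, s)) (at t) \<and>
        ((\<lambda>s. u (t, s)) has_real_derivative us (t, s)) (at s) \<and>
        \<bar>ut (t, s)\<bar> \<le> M * t powr (- e) \<and> \<bar>us (t, s)\<bar> \<le> M * t powr (- e)) \<and>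
     continuous_on ({0<..<h} \<times> UNIV) ut \<and> continuous_on ({0<..<h} \<times> UNIV) us \<and>
     (\<forall>t s. 0 \<le> t \<longrightarrow> t \<le> h \<longrightarrow> \<bar>u (t, s)\<bar> \<le> M) \<and>
     (\<forall>t t' s s'. 0 \<le> t \<longrightarrow> t \<le> h \<longrightarrow> 0 \<le> t' \<longrightarrow> t' \<le> h \<longrightarrow>
        \<bar>u (t, s) - u (t', s')\<bar> \<le> M * (\<bar>t - t'\<bar> powr (1 - e) + \<bar>s - s'\<bar> powr (1 - e)))"

lemma edge_flow_regular:
  assumes "edge_flow h e M g u v ut us"
  shows "edge_regular h e M u ut us" "edge_regular h e M v us (\<lambda>z. - ut z)"
  using assms unfolding edge_flow_def edge_regular_def by (auto intro!: continuous_on_minus)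

lemma channel_regular_add:
  assumes f: "channel_regular x0 x1 e M f fx fy" and g: "channel_regular x0 x1 e N g gx gy"
  shows "channel_regular x0 x1 e (M + N) (\<lambda>y. f y + g y) (\<lambda>y. fx y + gx y) (\<lambda>y. fy y + gy y)"
proof -
  have tri: "\<bar>a + b\<bar> \<le> (M + N) * w" if "\<bar>a\<bar> \<le> M * w" "\<bar>b\<bar> \<le> N * w" for a b w
    using that abs_triangle_ineq[of a b] by (simp add: distrib_right)
  have tri': "\<bar>(a + b) - (c + d)\<bar> \<le> (M + N) * w" if "\<bar>a - c\<bar> \<le> M * w" "\<bar>b - d\<bar> \<le> N * w" for a b c d w
    using tri[OF that] by (simp add: algebra_simps)
  show ?thesis
    unfolding channel_regular_def
  proof (intro conjI allI impI)
    fix x s :: real assume xs: "x0 < x" "x < x1" "0 < s" "s < 1"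
    show "((\<lambda>x. f (x, s) + g (x, s)) has_real_derivative fx (x, s) + gx (x, s)) (at x)"
      "((\<lambda>s. f (x, s) + g (x, s)) has_real_derivative fy (x, s) + gy (x, s)) (at s)"
      by (rule DERIV_add; use f g xs in \<open>simp add: channel_regular_def\<close>)+
    show "\<bar>fx (x, s) + gx (x, s)\<bar> \<le> (M + N) * edge_weight e x0 x1 (x, s)"
      "\<bar>fy (x, s) + gy (x, s)\<bar> \<le> (M + N) * edge_weight e x0 x1 (x, s)"
      by (rule tri; use f g xs in \<open>simp add: channel_regular_def\<close>)+
  next
    show "continuous_on ({x0<..<x1} \<times> {0<..<1}) (\<lambda>y. fx y + gx y)" "continuous_on ({x0<..<x1} \<times> {0<..<1}) (\<lambda>y. fy y + gy y)"
      by (rule continuous_on_add; use f g in \<open>simp add: channel_regular_def\<close>)+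
  next
    fix x s :: real assume xs: "x0 \<le> x" "x \<le> x1" "0 \<le> s" "s \<le> 1"
    have "\<bar>f (x, s)\<bar> \<le> M" "\<bar>g (x, s)\<bar> \<le> N" using f g xs by (simp_all add: channel_regular_def)
    then show "\<bar>f (x, s) + g (x, s)\<bar> \<le> M + N" by linarith
  next
    fix x s x' s' :: real assume xs: "x0 \<le> x" "x \<le> x1" "0 \<le> s" "s \<le> 1" "x0 \<le> x'" "x' \<le> x1" "0 \<le> s'" "s' \<le> 1"
    show "\<bar>f (x, s) + g (x, s) - (f (x', s') + g (x', s'))\<bar> \<le> (M + N) * (\<bar>x - x'\<bar> powr (1 - e) + \<bar>s - s'\<bar> powr (1 - e))"
      by (rule tri'; use f g xs in \<open>simp add: channel_regular_def\<close>)
  qed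
qed

lemma channel_regular_scale:
  assumes f: "channel_regular x0 x1 e M f fx fy"
  shows "channel_regular x0 x1 e (\<bar>c\<bar> * M) (\<lambda>y. c * f y) (\<lambda>y. c * fx y) (\<lambda>y. c * fy y)"
proof -
  have sc: "\<bar>c * a\<bar> \<le> \<bar>c\<bar> * M * w" if "\<bar>a\<bar> \<le> M * w" for a w
    using mult_left_mono[OF that, of "\<bar>c\<bar>"] by (simp add: abs_mult mult.assoc)
  show ?thesis
    unfolding channel_regular_def
  proof (intro conjI allI impI)
    fix x s :: real assume xs: "x0 < x" "x < x1" "0 < s" "s < 1"
    show "((\<lambda>x. c * f (x, s)) has_real_derivative c * fx (x, s)) (at x)"
      "((\<lambda>s. c * f (x, s)) has_real_derivative c * fy (x, s)) (at s)"
      by (rule DERIV_cmult; use f xs in \<open>simp add: channel_regular_def\<close>)+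
    show "\<bar>c * fx (x, s)\<bar> \<le> \<bar>c\<bar> * M * edge_weight e x0 x1 (x, s)"
      "\<bar>c * fy (x, s)\<bar> \<le> \<bar>c\<bar> * M * edge_weight e x0 x1 (x, s)"
      by (rule sc; use f xs in \<open>simp add: channel_regular_def\<close>)+
  next
    show "continuous_on ({x0<..<x1} \<times> {0<..<1}) (\<lambda>y. c * fx y)" "continuous_on ({x0<..<x1} \<times> {0<..<1}) (\<lambda>y. c * fy y)"
      by (rule continuous_on_mult_left; use f in \<open>simp add: channel_regular_def\<close>)+
  next
    fix x s :: real assume xs: "x0 \<le> x" "x \<le> x1" "0 \<le> s" "s \<le> 1"
    have "\<bar>f (x, s)\<bar> \<le> M" using f xs by (simp_all add: channel_regular_def)
    then show "\<bar>c * f (x, s)\<bar> \<le> \<bar>c\<bar> * M" by (simp add: abs_mult mult_left_mono)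
  next
    fix x s x' s' :: real assume xs: "x0 \<le> x" "x \<le> x1" "0 \<le> s" "s \<le> 1" "x0 \<le> x'" "x' \<le> x1" "0 \<le> s'" "s' \<le> 1"
    show "\<bar>c * f (x, s) - c * f (x', s')\<bar> \<le> \<bar>c\<bar> * M * (\<bar>x - x'\<bar> powr (1 - e) + \<bar>s - s'\<bar> powr (1 - e))"
      unfolding right_diff_distrib[symmetric] by (rule sc; use f xs in \<open>simp add: channel_regular_def\<close>)
  qed
qed

lemma channel_regular_mono:
  assumes f: "channel_regular x0 x1 e M f fx fy" and M: "M \<le> N"
  shows "channel_regular x0 x1 e N f fx fy"
proof -
  have w: "M * edge_weight e x0 x1 y \<le> N * edge_weight e x0 x1 y" for y
    using M edge_weight_ge_1[of e x0 x1 y] by (intro mult_right_mono) auto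
  have w': "M * (\<bar>x - x'\<bar> powr (1 - e) + \<bar>s - s'\<bar> powr (1 - e)) \<le> N * (\<bar>x - x'\<bar> powr (1 - e) + \<bar>s - s'\<bar> powr (1 - e))" for x x' s s' :: real
    using M by (intro mult_right_mono) auto
  show ?thesis
    unfolding channel_regular_def
  proof (intro conjI allI impI)
    fix x s :: real assume xs: "x0 < x" "x < x1" "0 < s" "s < 1"
    show "((\<lambda>x. f (x, s)) has_real_derivative fx (x, s)) (at x)" "((\<lambda>s. f (x, s)) has_real_derivative fy (x, s)) (at s)"
      using f xs by (simp_all add: channel_regular_def)
    show "\<bar>fx (x, s)\<bar> \<le> N * edge_weight e x0 x1 (x, s)" "\<bar>fy (x, s)\<bar> \<le> N * edge_weight e x0 x1 (x, s)"
      by (rule order_trans[OF _ w]; use f xs in \<open>simp add: channel_regular_def\<close>)+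
  next
    fix x s :: real assume xs: "x0 \<le> x" "x \<le> x1" "0 \<le> s" "s \<le> 1"
    show "\<bar>f (x, s)\<bar> \<le> N"
      by (rule order_trans[OF _ M]; use f xs in \<open>simp add: channel_regular_def\<close>)
  next
    fix x s x' s' :: real assume xs: "x0 \<le> x" "x \<le> x1" "0 \<le> s" "s \<le> 1" "x0 \<le> x'" "x' \<le> x1" "0 \<le> s'" "s' \<le> 1"
    show "\<bar>f (x, s) - f (x', s')\<bar> \<le> N * (\<bar>x - x'\<bar> powr (1 - e) + \<bar>s - s'\<bar> powr (1 - e))"
      by (rule order_trans[OF _ w']; use f xs in \<open>simp add: channel_regular_def\<close>)
  qed (use f in \<open>simp_all add: channel_regular_def\<close>)
qed

lemma le_powr_of_bounded:
  fixes d L e :: real assumes "0 \<le> d" "d \<le> L" "0 < e" "e < 1"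
  shows "d \<le> L powr e * d powr (1 - e)"
proof (cases "d = 0")
  case False
  have "d = d powr e * d powr (1 - e)" using assms False by (simp add: powr_add[symmetric])
  also have "\<dots> \<le> L powr e * d powr (1 - e)"
    using assms by (intro mult_right_mono powr_mono2) auto
  finally show ?thesis .
qed (use assms in auto)

lemma channel_regular_affine:
  assumes L: "x0 \<le> x1" "x1 - x0 \<le> L" and e: "0 < e" "e < 1"
  shows "channel_regular x0 x1 e (\<bar>m\<bar> + \<bar>b\<bar> * (1 + L + L powr e) + \<bar>c\<bar>)
    (\<lambda>y. m + b * (fst y - x0) + c * snd y) (\<lambda>y. b) (\<lambda>y. c)" (is "channel_regular x0 x1 e ?M _ _ _")
  unfolding channel_regular_def
proof (intro conjI allI impI)
  have L0: "L \<ge> 0" using L by linarith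
  have bM: "\<bar>b\<bar> \<le> ?M" "\<bar>c\<bar> \<le> ?M" "\<bar>b\<bar> * L + \<bar>m\<bar> + \<bar>c\<bar> \<le> ?M"
    using L0 by (auto simp: algebra_simps)
  fix x s :: real
  have w: "1 \<le> edge_weight e x0 x1 (x, s)" by (rule edge_weight_ge_1)
  have M0: "0 \<le> ?M" using L0 by simp
  have "?M * 1 \<le> ?M * edge_weight e x0 x1 (x, s)" using w M0 by (rule mult_left_mono)
  then have MW: "?M \<le> ?M * edge_weight e x0 x1 (x, s)" by simp
  show "\<bar>b\<bar> \<le> ?M * edge_weight e x0 x1 (x, s)" by (rule order_trans[OF bM(1) MW])
  show "\<bar>c\<bar> \<le> ?M * edge_weight e x0 x1 (x, s)" by (rule order_trans[OF bM(2) MW])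
  show "((\<lambda>x. m + b * (fst (x, s) - x0) + c * snd (x, s)) has_real_derivative b) (at x)"
    "((\<lambda>s. m + b * (fst (x, s) - x0) + c * snd (x, s)) has_real_derivative c) (at s)"
    by (auto intro!: derivative_eq_intros)
  { assume xs: "x0 \<le> x" "x \<le> x1" "0 \<le> s" "s \<le> 1"
    have "\<bar>b\<bar> * \<bar>x - x0\<bar> \<le> \<bar>b\<bar> * L" using xs L by (intro mult_left_mono) auto
    moreover have "\<bar>c\<bar> * \<bar>s\<bar> \<le> \<bar>c\<bar> * 1" using xs by (intro mult_left_mono) auto
    moreover have "\<bar>m + b * (x - x0) + c * s\<bar> \<le> \<bar>m\<bar> + \<bar>b\<bar> * \<bar>x - x0\<bar> + \<bar>c\<bar> * \<bar>s\<bar>"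
      unfolding abs_mult[symmetric] by linarith
    ultimately show "\<bar>m + b * (fst (x, s) - x0) + c * snd (x, s)\<bar> \<le> ?M" using bM by simp
  }
  fix x' s' :: real
  assume xs: "x0 \<le> x" "x \<le> x1" "0 \<le> s" "s \<le> 1" "x0 \<le> x'" "x' \<le> x1" "0 \<le> s'" "s' \<le> 1"
  have "\<bar>x - x'\<bar> \<le> L powr e * \<bar>x - x'\<bar> powr (1 - e)"
    using xs L e by (intro le_powr_of_bounded) auto
  from mult_left_mono[OF this, of "\<bar>b\<bar>"]
  have 1: "\<bar>b\<bar> * \<bar>x - x'\<bar> \<le> (\<bar>b\<bar> * L powr e) * \<bar>x - x'\<bar> powr (1 - e)" by (simp add: mult.assoc)
  have 2: "\<bar>c\<bar> * \<bar>s - s'\<bar> \<le> \<bar>c\<bar> * \<bar>s - s'\<bar> powr (1 - e)"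
    using le_powr_of_bounded[of "\<bar>s - s'\<bar>" 1 e] xs e by (intro mult_left_mono) auto
  have m1: "(\<bar>b\<bar> * L powr e) * \<bar>x - x'\<bar> powr (1 - e) \<le> ?M * \<bar>x - x'\<bar> powr (1 - e)"
    using L0 by (intro mult_right_mono) (auto simp: algebra_simps)
  have m2: "\<bar>c\<bar> * \<bar>s - s'\<bar> powr (1 - e) \<le> ?M * \<bar>s - s'\<bar> powr (1 - e)"
    using bM by (intro mult_right_mono) auto
  have "\<bar>m + b * (x - x0) + c * s - (m + b * (x' - x0) + c * s')\<bar> = \<bar>b * (x - x') + c * (s - s')\<bar>"
    by (simp add: algebra_simps)
  also have "\<dots> \<le> \<bar>b\<bar> * \<bar>x - x'\<bar> + \<bar>c\<bar> * \<bar>s - s'\<bar>" unfolding abs_mult[symmetric] by (rule abs_triangle_ineq)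
  also have "\<dots> \<le> ?M * \<bar>x - x'\<bar> powr (1 - e) + ?M * \<bar>s - s'\<bar> powr (1 - e)"
    using 1 2 m1 m2 by linarith
  finally show "\<bar>m + b * (fst (x, s) - x0) + c * snd (x, s) - (m + b * (fst (x', s') - x0) + c * snd (x', s'))\<bar>
      \<le> ?M * (\<bar>x - x'\<bar> powr (1 - e) + \<bar>s - s'\<bar> powr (1 - e))"
    by (simp add: distrib_left)
qed (auto intro!: continuous_intros)

text \<open>
  An edge flow attached to the left or right edge of the rectangle: the distance from the edge is affine in the
  first coordinate.
\<close>

lemma channel_regular_along:
  assumes u: "edge_regular h e E u ut us" and E: "0 \<le> E" and e: "0 < e" "e < 1"
    and T: "\<And>x. x0 \<le> x \<Longrightarrow> x \<le> x1 \<Longrightarrow> 0 \<le> m + k * x \<and> m + k * x \<le> h"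
    and T': "\<And>x. x0 < x \<Longrightarrow> x < x1 \<Longrightarrow> 0 < m + k * x \<and> m + k * x < h"
    and W: "\<And>x s. x0 < x \<Longrightarrow> x < x1 \<Longrightarrow> 0 < s \<Longrightarrow> s < 1 \<Longrightarrow> (m + k * x) powr (- e) \<le> \<Lambda> * edge_weight e x0 x1 (x, s)"
    and \<Lambda>: "0 \<le> \<Lambda>"
  shows "channel_regular x0 x1 e (E * (\<Lambda> * (1 + \<bar>k\<bar>) + 1 + \<bar>k\<bar> powr (1 - e)))
    (\<lambda>y. u (m + k * fst y, snd y)) (\<lambda>y. k * ut (m + k * fst y, snd y)) (\<lambda>y. us (m + k * fst y, snd y))"
    (is "channel_regular x0 x1 e ?M _ _ _")
proof -
  have M1: "E \<le> ?M" "E * \<Lambda> \<le> ?M" "\<bar>k\<bar> * (E * \<Lambda>) \<le> ?M" "E * (1 + \<bar>k\<bar> powr (1 - e)) \<le> ?M"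
    using E \<Lambda> by (auto simp: algebra_simps intro!: mult_nonneg_nonneg add_nonneg_nonneg)
  have c: "continuous_on ({x0<..<x1} \<times> {0<..<1}) (\<lambda>y. f (m + k * fst y, snd y))"
    if "continuous_on ({0<..<h} \<times> UNIV) f" for f :: "real \<times> real \<Rightarrow> real"
    by (rule continuous_on_compose2[OF that]) (auto intro!: continuous_intros dest: T')
  show ?thesis
    unfolding channel_regular_def fst_conv snd_conv
  proof (intro conjI allI impI)
    fix x s :: real assume xs: "x0 < x" "x < x1" "0 < s" "s < 1"
    have ud: "((\<lambda>t. u (t, s)) has_real_derivative ut (m + k * x, s)) (at (m + k * x))"
      "((\<lambda>s. u (m + k * x, s)) has_real_derivative us (m + k * x, s)) (at s)"
      and ub: "\<bar>ut (m + k * x, s)\<bar> \<le> E * (m + k * x) powr (- e)" "\<bar>us (m + k * x, s)\<bar> \<le> E * (m + k * x) powr (- e)"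
      using u T'[OF xs(1,2)] unfolding edge_regular_def by auto
    have "((\<lambda>x. u (m + k * x, s)) has_real_derivative ut (m + k * x, s) * k) (at x)"
      by (rule DERIV_chain2[where g = "\<lambda>x. m + k * x", OF ud(1)]) (auto intro!: derivative_eq_intros)
    then show "((\<lambda>x. u (m + k * x, s)) has_real_derivative k * ut (m + k * x, s)) (at x)"
      by (simp add: mult.commute)
    show "((\<lambda>s. u (m + k * x, s)) has_real_derivative us (m + k * x, s)) (at s)" by (rule ud(2))
    have w: "0 \<le> edge_weight e x0 x1 (x, s)" using edge_weight_ge_1[of e x0 x1 "(x, s)"] by linarith
    have EW: "E * (m + k * x) powr (- e) \<le> (E * \<Lambda>) * edge_weight e x0 x1 (x, s)"
      using mult_left_mono[OF W[OF xs] E] by (simp add: mult.assoc)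
    have "\<bar>k\<bar> * \<bar>ut (m + k * x, s)\<bar> \<le> \<bar>k\<bar> * ((E * \<Lambda>) * edge_weight e x0 x1 (x, s))"
      using ub EW by (intro mult_left_mono) auto
    also have "\<dots> \<le> ?M * edge_weight e x0 x1 (x, s)"
      using mult_right_mono[OF M1(3) w] by (simp add: mult.assoc)
    finally show "\<bar>k * ut (m + k * x, s)\<bar> \<le> ?M * edge_weight e x0 x1 (x, s)" by (simp add: abs_mult)
    show "\<bar>us (m + k * x, s)\<bar> \<le> ?M * edge_weight e x0 x1 (x, s)"
      using ub(2) EW mult_right_mono[OF M1(2) w] by linarith
  next
    show "continuous_on ({x0<..<x1} \<times> {0<..<1}) (\<lambda>y. k * ut (m + k * fst y, snd y))"
      "continuous_on ({x0<..<x1} \<times> {0<..<1}) (\<lambda>y. us (m + k * fst y, snd y))"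
      using u by (auto intro!: continuous_on_mult_left c simp: edge_regular_def)
  next
    fix x s :: real assume xs: "x0 \<le> x" "x \<le> x1" "0 \<le> s" "s \<le> 1"
    have "\<bar>u (m + k * x, s)\<bar> \<le> E" using u T[OF xs(1,2)] unfolding edge_regular_def by auto
    then show "\<bar>u (m + k * x, s)\<bar> \<le> ?M" using M1(1) by linarith
  next
    fix x s x' s' :: real assume xs: "x0 \<le> x" "x \<le> x1" "0 \<le> s" "s \<le> 1" "x0 \<le> x'" "x' \<le> x1" "0 \<le> s'" "s' \<le> 1"
    have "\<bar>u (m + k * x, s) - u (m + k * x', s')\<bar> \<le> E * (\<bar>m + k * x - (m + k * x')\<bar> powr (1 - e) + \<bar>s - s'\<bar> powr (1 - e))"
      using u T[OF xs(1,2)] T[OF xs(5,6)] unfolding edge_regular_def by blast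
    also have "\<bar>m + k * x - (m + k * x')\<bar> = \<bar>k\<bar> * \<bar>x - x'\<bar>" by (simp add: abs_mult[symmetric] right_diff_distrib)
    also have "E * ((\<bar>k\<bar> * \<bar>x - x'\<bar>) powr (1 - e) + \<bar>s - s'\<bar> powr (1 - e)) \<le>
      E * (1 + \<bar>k\<bar> powr (1 - e)) * (\<bar>x - x'\<bar> powr (1 - e) + \<bar>s - s'\<bar> powr (1 - e))"
      using E unfolding mult.assoc powr_mult
      by (intro mult_left_mono) (auto simp: algebra_simps powr_mult)
    also have "\<dots> \<le> ?M * (\<bar>x - x'\<bar> powr (1 - e) + \<bar>s - s'\<bar> powr (1 - e))"
      using M1(4) by (intro mult_right_mono) auto
    finally show "\<bar>u (m + k * x, s) - u (m + k * x', s')\<bar> \<le> ?M * (\<bar>x - x'\<bar> powr (1 - e) + \<bar>s - s'\<bar> powr (1 - e))" .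
  qed
qed

text \<open>
  An edge flow attached to the upper edge: the second coordinate is now the distance, and the first one runs along
  the edge.
\<close>

lemma channel_regular_across:
  assumes u: "edge_regular h e E u ut us" and E: "0 \<le> E" and e: "0 < e" "e < 1"
    and T: "\<And>s. 0 \<le> s \<Longrightarrow> s \<le> 1 \<Longrightarrow> 0 \<le> m + k * s \<and> m + k * s \<le> h"
    and T': "\<And>s. 0 < s \<Longrightarrow> s < 1 \<Longrightarrow> 0 < m + k * s \<and> m + k * s < h"
    and W: "\<And>x s. x0 < x \<Longrightarrow> x < x1 \<Longrightarrow> 0 < s \<Longrightarrow> s < 1 \<Longrightarrow> (m + k * s) powr (- e) \<le> \<Lambda> * edge_weight e x0 x1 (x, s)"
    and \<Lambda>: "0 \<le> \<Lambda>"
  shows "channel_regular x0 x1 e (E * (\<Lambda> * (\<bar>k\<bar> + \<bar>j\<bar>) + 1 + \<bar>k\<bar> powr (1 - e) + \<bar>j\<bar> powr (1 - e)))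
    (\<lambda>y. u (m + k * snd y, n + j * fst y)) (\<lambda>y. j * us (m + k * snd y, n + j * fst y))
    (\<lambda>y. k * ut (m + k * snd y, n + j * fst y))"
    (is "channel_regular x0 x1 e ?M _ _ _")
proof -
  have M1: "E \<le> ?M" "\<bar>j\<bar> * (E * \<Lambda>) \<le> ?M" "\<bar>k\<bar> * (E * \<Lambda>) \<le> ?M" "E * (\<bar>k\<bar> powr (1 - e) + \<bar>j\<bar> powr (1 - e)) \<le> ?M"
    using E \<Lambda> by (auto simp: algebra_simps intro!: mult_nonneg_nonneg add_nonneg_nonneg)
  have c: "continuous_on ({x0<..<x1} \<times> {0<..<1}) (\<lambda>y. f (m + k * snd y, n + j * fst y))"
    if "continuous_on ({0<..<h} \<times> UNIV) f" for f :: "real \<times> real \<Rightarrow> real"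
    by (rule continuous_on_compose2[OF that]) (auto intro!: continuous_intros dest: T')
  show ?thesis
    unfolding channel_regular_def fst_conv snd_conv
  proof (intro conjI allI impI)
    fix x s :: real assume xs: "x0 < x" "x < x1" "0 < s" "s < 1"
    define t where "t = m + k * s"
    define r where "r = n + j * x"
    have ud: "((\<lambda>t. u (t, r)) has_real_derivative ut (t, r)) (at (m + k * s))"
      "((\<lambda>s. u (t, s)) has_real_derivative us (t, r)) (at (n + j * x))"
      and ub: "\<bar>ut (t, r)\<bar> \<le> E * t powr (- e)" "\<bar>us (t, r)\<bar> \<le> E * t powr (- e)"
      using u T'[OF xs(3,4)] unfolding edge_regular_def t_def r_def by auto
    have "((\<lambda>x. u (t, n + j * x)) has_real_derivative us (t, r) * j) (at x)"
      by (rule DERIV_chain2[where g = "\<lambda>x. n + j * x", OF ud(2)]) (auto intro!: derivative_eq_intros)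
    then show "((\<lambda>x. u (m + k * s, n + j * x)) has_real_derivative j * us (m + k * s, n + j * x)) (at x)"
      by (simp add: mult.commute t_def r_def)
    have "((\<lambda>s. u (m + k * s, r)) has_real_derivative ut (t, r) * k) (at s)"
      by (rule DERIV_chain2[where g = "\<lambda>s. m + k * s", OF ud(1)]) (auto intro!: derivative_eq_intros)
    then show "((\<lambda>s. u (m + k * s, n + j * x)) has_real_derivative k * ut (m + k * s, n + j * x)) (at s)"
      by (simp add: mult.commute t_def r_def)
    have w: "0 \<le> edge_weight e x0 x1 (x, s)" using edge_weight_ge_1[of e x0 x1 "(x, s)"] by linarith
    have EW: "E * t powr (- e) \<le> (E * \<Lambda>) * edge_weight e x0 x1 (x, s)"
      using mult_left_mono[OF W[OF xs] E] by (simp add: mult.assoc t_def)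
    have "\<bar>k\<bar> * \<bar>ut (t, r)\<bar> \<le> \<bar>k\<bar> * ((E * \<Lambda>) * edge_weight e x0 x1 (x, s))"
      using ub EW by (intro mult_left_mono) auto
    also have "\<dots> \<le> ?M * edge_weight e x0 x1 (x, s)"
      using mult_right_mono[OF M1(3) w] by (simp add: mult.assoc)
    finally show "\<bar>k * ut (m + k * s, n + j * x)\<bar> \<le> ?M * edge_weight e x0 x1 (x, s)" by (simp add: abs_mult t_def r_def)
    have "\<bar>j\<bar> * \<bar>us (t, r)\<bar> \<le> \<bar>j\<bar> * ((E * \<Lambda>) * edge_weight e x0 x1 (x, s))"
      using ub EW by (intro mult_left_mono) auto
    also have "\<dots> \<le> ?M * edge_weight e x0 x1 (x, s)"
      using mult_right_mono[OF M1(2) w] by (simp add: mult.assoc)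
    finally show "\<bar>j * us (m + k * s, n + j * x)\<bar> \<le> ?M * edge_weight e x0 x1 (x, s)" by (simp add: abs_mult t_def r_def)
  next
    show "continuous_on ({x0<..<x1} \<times> {0<..<1}) (\<lambda>y. j * us (m + k * snd y, n + j * fst y))"
      "continuous_on ({x0<..<x1} \<times> {0<..<1}) (\<lambda>y. k * ut (m + k * snd y, n + j * fst y))"
      using u by (auto intro!: continuous_on_mult_left c simp: edge_regular_def)
  next
    fix x s :: real assume xs: "x0 \<le> x" "x \<le> x1" "0 \<le> s" "s \<le> 1"
    have "\<bar>u (m + k * s, n + j * x)\<bar> \<le> E" using u T[OF xs(3,4)] unfolding edge_regular_def by auto
    then show "\<bar>u (m + k * s, n + j * x)\<bar> \<le> ?M" using M1(1) by linarith
  next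
    fix x s x' s' :: real assume xs: "x0 \<le> x" "x \<le> x1" "0 \<le> s" "s \<le> 1" "x0 \<le> x'" "x' \<le> x1" "0 \<le> s'" "s' \<le> 1"
    have "\<bar>u (m + k * s, n + j * x) - u (m + k * s', n + j * x')\<bar> \<le>
        E * (\<bar>m + k * s - (m + k * s')\<bar> powr (1 - e) + \<bar>n + j * x - (n + j * x')\<bar> powr (1 - e))"
      using u T[OF xs(3,4)] T[OF xs(7,8)] unfolding edge_regular_def by blast
    also have "\<bar>m + k * s - (m + k * s')\<bar> = \<bar>k\<bar> * \<bar>s - s'\<bar>" by (simp add: abs_mult[symmetric] right_diff_distrib)
    also have "\<bar>n + j * x - (n + j * x')\<bar> = \<bar>j\<bar> * \<bar>x - x'\<bar>" by (simp add: abs_mult[symmetric] right_diff_distrib)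
    also have "E * ((\<bar>k\<bar> * \<bar>s - s'\<bar>) powr (1 - e) + (\<bar>j\<bar> * \<bar>x - x'\<bar>) powr (1 - e)) \<le>
      E * (\<bar>k\<bar> powr (1 - e) + \<bar>j\<bar> powr (1 - e)) * (\<bar>x - x'\<bar> powr (1 - e) + \<bar>s - s'\<bar> powr (1 - e))"
      using E unfolding mult.assoc powr_mult
      by (intro mult_left_mono) (auto simp: algebra_simps powr_mult)
    also have "\<dots> \<le> ?M * (\<bar>x - x'\<bar> powr (1 - e) + \<bar>s - s'\<bar> powr (1 - e))"
      using M1(4) by (intro mult_right_mono) auto
    finally show "\<bar>u (m + k * s, n + j * x) - u (m + k * s', n + j * x')\<bar> \<le>
      ?M * (\<bar>x - x'\<bar> powr (1 - e) + \<bar>s - s'\<bar> powr (1 - e))" .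
  qed
qed

text \<open>
  The system \<open>\<partial>\<^sub>2 p + q \<partial>\<^sub>1 \<theta> = 0\<close>, \<open>\<partial>\<^sub>2 \<theta> - a \<partial>\<^sub>1 p = F\<close> with \<open>p\<close> prescribed on the vertical edges and \<open>\<theta>\<close> on
  the horizontal ones.  For a potential with \<open>p = - \<partial>\<^sub>1 \<Phi>\<close> and \<open>q \<theta> = \<partial>\<^sub>2 \<Phi>\<close> this is a Neumann problem.
\<close>

definition channel_flow :: "real \<Rightarrow> real \<Rightarrow> real \<Rightarrow> real \<Rightarrow> real \<Rightarrow> real \<Rightarrow> real \<Rightarrow>
    (real \<Rightarrow> real) \<Rightarrow> (real \<Rightarrow> real) \<Rightarrow> (real \<Rightarrow> real) \<Rightarrow> (real \<times> real \<Rightarrow> real) \<Rightarrow> (real \<times> real \<Rightarrow> real) \<Rightarrow>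
    (real \<times> real \<Rightarrow> real) \<Rightarrow> (real \<times> real \<Rightarrow> real) \<Rightarrow> (real \<times> real \<Rightarrow> real) \<Rightarrow> (real \<times> real \<Rightarrow> real) \<Rightarrow> bool" where
  "channel_flow a q x0 x1 e M F gl gr gt p \<theta> px py \<theta>x \<theta>y \<longleftrightarrow>
     (\<forall>s\<in>{0..1}. p (x0, s) = gl s \<and> p (x1, s) = gr s) \<and>
     (\<forall>x\<in>{x0..x1}. \<theta> (x, 0) = 0 \<and> \<theta> (x, 1) = gt x) \<and>
     (\<forall>y. py y + q * \<theta>x y = 0 \<and> \<theta>y y - a * px y = F) \<and>
     channel_regular x0 x1 e M p px py \<and> channel_regular x0 x1 e M \<theta> \<theta>x \<theta>y"

lemma edge_weight_dominates:
  assumes "0 \<le> k"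
  shows "(k * (x - x0)) powr (- e) \<le> k powr (- e) * edge_weight e x0 x1 (x, s)"
    and "(k * (x1 - x)) powr (- e) \<le> k powr (- e) * edge_weight e x0 x1 (x, s)"
    and "(k * (1 - s)) powr (- e) \<le> k powr (- e) * edge_weight e x0 x1 (x, s)"
  using assms by (auto simp: powr_mult edge_weight_def intro!: mult_left_mono)

text \<open>
  An affine flow \<open>p = ml + b (x - x0)\<close>, \<open>\<theta> = c s\<close> carries the mean values of the three sets of data.  It solves the
  system when \<open>c - a b = F\<close>, which is the compatibility hypothesis divided by the width.  The remaining data have mean
  zero; each set is met by an edge flow, which leaves the data on the other three edges untouched.  The
  stretching by \<open>\<nu> = sqrt (q a)\<close> turns the system into the Cauchy-Riemann equations.  A lower and an upper bound for the
  width bound the depths of the three strips from below, and so the constant is uniform.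
\<close>

lemma channel_flow_exists:
  fixes a q \<delta> L e :: real
  assumes a: "a > 0" and q: "q > 0" and \<delta>: "0 < \<delta>" and L: "0 < L" and e: "0 < e" "e < 1"
  obtains K where "0 \<le> K"
    "\<And>x0 x1 gl gl' gl'' gr gr' gr'' gt gt' gt'' F B. \<delta> \<le> x1 - x0 \<Longrightarrow> x1 - x0 \<le> L \<Longrightarrow>
       C2_bound {0..1} gl gl' gl'' B \<Longrightarrow> C2_bound {0..1} gr gr' gr'' B \<Longrightarrow> C2_bound {x0..x1} gt gt' gt'' B \<Longrightarrow>
       integral {x0..x1} gt - a * (integral {0..1} gr - integral {0..1} gl) = F * (x1 - x0) \<Longrightarrow>
       \<exists>p \<theta> px py \<theta>x \<theta>y. channel_flow a q x0 x1 e (K * B) F gl gr gt p \<theta> px py \<theta>x \<theta>y"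
proof -
  define \<nu> where "\<nu> = sqrt (q * a)"
  have \<nu>: "\<nu> > 0" "\<nu> * \<nu> = q * a" using a q by (auto simp: \<nu>_def)
  define h0 where "h0 = min (\<delta> / \<nu>) (\<nu> / L)"
  have h0: "h0 > 0" using \<delta> L \<nu> by (simp add: h0_def)
  obtain C where C0: "0 \<le> C" and C: "\<And>h g g' g'' B. h0 \<le> h \<Longrightarrow> C2_bound {0..1} g g' g'' B \<Longrightarrow> integral {0..1} g = 0 \<Longrightarrow>
       \<exists>u v ut us. edge_flow h e (C * B) g u v ut us"
    using edge_flow_exists[OF h0 e] by blast
  define Q where "Q = 1 + L + L * L"
  have Q1: "Q \<ge> 1" using L by (simp add: Q_def)
  define \<Lambda> where "\<Lambda> = (1 / \<nu>) powr (- e) + (\<nu> / L) powr (- e)"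
  have \<Lambda>0: "\<Lambda> \<ge> 0" by (simp add: \<Lambda>_def)
  define Ha where "Ha = \<Lambda> * (1 + 1 / \<nu>) + 1 + (1 / \<nu>) powr (1 - e)"
  define Hb where "Hb = \<Lambda> * (\<nu> / \<delta> + 1 / \<delta>) + 1 + (\<nu> / \<delta>) powr (1 - e) + (1 / \<delta>) powr (1 - e)"
  define H where "H = Ha + Hb"
  have H12: "Ha \<le> H" "Hb \<le> H" "0 \<le> H" using \<Lambda>0 \<nu> \<delta> by (auto simp: H_def Ha_def Hb_def)
  define A0 where "A0 = 1 + 2 / \<delta> * (1 + L + L powr e)"
  have A0: "A0 \<ge> 1" using \<delta> L by (simp add: A0_def)
  define K where "K = A0 + C * (2 * Q) * H * (3 + \<nu> / a + 2 * (\<nu> / q))"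
  show ?thesis
  proof (rule that[of K])
    show "0 \<le> K" using A0 C0 Q1 H12 a q \<nu> by (simp add: K_def)
    fix x0 x1 gl gl' gl'' gr gr' gr'' gt gt' gt'' F B
    assume d: "\<delta> \<le> x1 - x0" "x1 - x0 \<le> L"
      and gl: "C2_bound {0..1} gl gl' gl'' B" and gr: "C2_bound {0..1} gr gr' gr'' B"
      and gt: "C2_bound {x0..x1} gt gt' gt'' B"
      and compat: "integral {x0..x1} gt - a * (integral {0..1} gr - integral {0..1} gl) = F * (x1 - x0)"
    define l where "l = x1 - x0"
    have l: "l > 0" "\<delta> \<le> l" "l \<le> L" "x1 = x0 + l" using d \<delta> by (auto simp: l_def)
    have B0: "B \<ge> 0" using C2_bound_nonneg[OF gl] by simp
    define ml where "ml = integral {0..1} gl"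
    define mr where "mr = integral {0..1} gr"
    define c where "c = integral {x0..x1} gt / l"
    \<comment> \<open>slope of the affine part of the pressure\<close>
    define b where "b = (mr - ml) / l"
    have mlb: "\<bar>ml\<bar> \<le> B" using mean_bound[OF C2_bound_continuous[OF gl], of B] gl by (auto simp: ml_def C2_bound_def)
    have mrb: "\<bar>mr\<bar> \<le> B" using mean_bound[OF C2_bound_continuous[OF gr], of B] gr by (auto simp: mr_def C2_bound_def)
    have "\<bar>integral {x0..x1} gt\<bar> \<le> B * (x1 - x0)"
      using mean_bound[OF C2_bound_continuous[OF gt], of B] gt l by (auto simp: C2_bound_def)
    then have cb: "\<bar>c\<bar> \<le> B" using l by (simp add: c_def l_def[symmetric] pos_divide_le_eq)
    have bb: "\<bar>b\<bar> \<le> 2 * B / \<delta>"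
    proof -
      have "\<bar>mr - ml\<bar> \<le> 2 * B" using mlb mrb by linarith
      then have "\<bar>mr - ml\<bar> / l \<le> 2 * B / \<delta>" using l \<delta> by (intro frac_le) auto
      then show ?thesis using l by (simp add: b_def)
    qed
    have cab: "c - a * b = F"
      using compat l by (simp add: c_def b_def ml_def mr_def l_def[symmetric] diff_divide_distrib[symmetric] field_simps)
    define E where "E = C * (2 * Q * B)"
    have E0: "E \<ge> 0" using C0 Q1 B0 by (simp add: E_def)
    have QB: "2 * B \<le> 2 * Q * B" using Q1 B0 mult_right_mono[of 1 Q B] by simp
    have zl: "integral {0..1} (\<lambda>s. gl s - ml) = 0" "integral {0..1} (\<lambda>s. gr s - mr) = 0"
      using integral_diff[OF integrable_continuous_real[OF C2_bound_continuous[OF gl]] integrable_const_ivl[of ml 0 1]]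
        integral_diff[OF integrable_continuous_real[OF C2_bound_continuous[OF gr]] integrable_const_ivl[of mr 0 1]]
      by (simp_all add: ml_def mr_def)
    have hl: "h0 \<le> l / \<nu>" "h0 \<le> \<nu> / l"
    proof -
      have "\<delta> / \<nu> \<le> l / \<nu>" "\<nu> / L \<le> \<nu> / l" using l \<nu> \<delta> by (auto intro!: divide_right_mono divide_left_mono)
      then show "h0 \<le> l / \<nu>" "h0 \<le> \<nu> / l" by (auto simp: h0_def)
    qed
    obtain ua v1 t1 s1 where E1: "edge_flow (l / \<nu>) e E (\<lambda>s. gl s - ml) ua v1 t1 s1"
      using C[OF hl(1) C2_bound_mono[OF C2_bound_diff_const[OF gl mlb] QB] zl(1)] unfolding E_def by blast
    obtain ub v2 t2 s2 where E2: "edge_flow (l / \<nu>) e E (\<lambda>s. gr s - mr) ub v2 t2 s2"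
      using C[OF hl(1) C2_bound_mono[OF C2_bound_diff_const[OF gr mrb] QB] zl(2)] unfolding E_def by blast
    note rs = C2_bound_rescale[OF gt[unfolded l(4)] l(1,3)]
    have cQ: "\<bar>c\<bar> \<le> (1 + L + L * L) * B" using cb QB unfolding Q_def[symmetric] by linarith
    have zt: "integral {0..1} (\<lambda>s. gt (x0 + l * s) - c) = 0"
      using integral_diff[OF integrable_continuous_real[OF C2_bound_continuous[OF rs(1)]] integrable_const_ivl[of c 0 1]]
        rs(2) by (simp add: c_def l(4))
    obtain uc v3 t3 s3 where E3: "edge_flow (\<nu> / l) e E (\<lambda>s. gt (x0 + l * s) - c) uc v3 t3 s3"
      using C[OF hl(2) C2_bound_diff_const[OF rs(1) cQ] zt] unfolding E_def Q_def by (auto simp: mult_ac)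
    note R1 = edge_flow_regular[OF E1] and R2 = edge_flow_regular[OF E2] and R3 = edge_flow_regular[OF E3]
    have \<Lambda>1: "(1 / \<nu>) powr (- e) \<le> \<Lambda>" "(\<nu> / l) powr (- e) \<le> \<Lambda>"
    proof -
      have "(\<nu> / l) powr (- e) \<le> (\<nu> / L) powr (- e)"
        using l \<nu> L e by (intro powr_mono2') (auto intro!: divide_left_mono)
      then show "(\<nu> / l) powr (- e) \<le> \<Lambda>" by (simp add: \<Lambda>_def add_increasing)
      show "(1 / \<nu>) powr (- e) \<le> \<Lambda>" by (simp add: \<Lambda>_def)
    qed
    have W: "w powr (- e) \<le> \<Lambda> * edge_weight e x0 x1 y"
      if "w powr (- e) \<le> k * edge_weight e x0 x1 y" "k \<le> \<Lambda>" for w k y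
      using that mult_right_mono[OF that(2), of "edge_weight e x0 x1 y"] edge_weight_ge_1[of e x0 x1 y] by linarith
    have EH: "E * Ha \<le> E * H" "E * Hb \<le> E * H" using E0 H12 by (auto intro: mult_left_mono)
    have arg1: "- x0 / \<nu> + 1 / \<nu> * x = 1 / \<nu> * (x - x0)" "x1 / \<nu> + - 1 / \<nu> * x = 1 / \<nu> * (x1 - x)" for x
      by (simp_all add: diff_divide_distrib)
    have arg2: "\<nu> / l + - \<nu> / l * s = \<nu> / l * (1 - s)" for s by (simp add: right_diff_distrib)
    have range_left: "0 \<le> - x0 / \<nu> + 1 / \<nu> * x \<and> - x0 / \<nu> + 1 / \<nu> * x \<le> l / \<nu>" if "x0 \<le> x" "x \<le> x1" for x
      using that divide_right_mono[of "x - x0" l \<nu>] \<nu> l unfolding arg1 by simp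
    have range_left': "0 < - x0 / \<nu> + 1 / \<nu> * x \<and> - x0 / \<nu> + 1 / \<nu> * x < l / \<nu>" if "x0 < x" "x < x1" for x
      using that divide_strict_right_mono[of "x - x0" l \<nu>] \<nu> l unfolding arg1 by simp
    have range_right: "0 \<le> x1 / \<nu> + - 1 / \<nu> * x \<and> x1 / \<nu> + - 1 / \<nu> * x \<le> l / \<nu>" if "x0 \<le> x" "x \<le> x1" for x
      using that divide_right_mono[of "x1 - x" l \<nu>] \<nu> l unfolding arg1 by simp
    have range_right': "0 < x1 / \<nu> + - 1 / \<nu> * x \<and> x1 / \<nu> + - 1 / \<nu> * x < l / \<nu>" if "x0 < x" "x < x1" for x
      using that divide_strict_right_mono[of "x1 - x" l \<nu>] \<nu> l unfolding arg1 by simp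
    have range_top: "0 \<le> \<nu> / l + - \<nu> / l * s \<and> \<nu> / l + - \<nu> / l * s \<le> \<nu> / l" if "0 \<le> s" "s \<le> 1" for s
      using that mult_left_mono[of "1 - s" 1 "\<nu> / l"] \<nu> l unfolding arg2 by simp
    have range_top': "0 < \<nu> / l + - \<nu> / l * s \<and> \<nu> / l + - \<nu> / l * s < \<nu> / l" if "0 < s" "s < 1" for s
      using that mult_strict_left_mono[of "1 - s" 1 "\<nu> / l"] \<nu> l unfolding arg2 by simp
    have left: "channel_regular x0 x1 e (E * H) (\<lambda>y. u (- x0 / \<nu> + 1 / \<nu> * fst y, snd y))
       (\<lambda>y. 1 / \<nu> * ut (- x0 / \<nu> + 1 / \<nu> * fst y, snd y)) (\<lambda>y. us (- x0 / \<nu> + 1 / \<nu> * fst y, snd y))"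
      if u: "edge_regular (l / \<nu>) e E u ut us" for u ut us
    proof (rule channel_regular_mono[OF channel_regular_along[OF u E0 e _ _ _ \<Lambda>0]])
      show "(- x0 / \<nu> + 1 / \<nu> * x) powr (- e) \<le> \<Lambda> * edge_weight e x0 x1 (x, s)" for x s
        unfolding arg1 by (rule W[OF edge_weight_dominates(1) \<Lambda>1(1)]) (use \<nu> in simp)
      show "E * (\<Lambda> * (1 + \<bar>1 / \<nu>\<bar>) + 1 + \<bar>1 / \<nu>\<bar> powr (1 - e)) \<le> E * H"
        using EH \<nu> by (simp add: Ha_def)
    qed (rule range_left range_left'; assumption)+
    have right: "channel_regular x0 x1 e (E * H) (\<lambda>y. u (x1 / \<nu> + - 1 / \<nu> * fst y, snd y))
       (\<lambda>y. - 1 / \<nu> * ut (x1 / \<nu> + - 1 / \<nu> * fst y, snd y)) (\<lambda>y. us (x1 / \<nu> + - 1 / \<nu> * fst y, snd y))"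
      if u: "edge_regular (l / \<nu>) e E u ut us" for u ut us
    proof (rule channel_regular_mono[OF channel_regular_along[OF u E0 e _ _ _ \<Lambda>0]])
      show "(x1 / \<nu> + - 1 / \<nu> * x) powr (- e) \<le> \<Lambda> * edge_weight e x0 x1 (x, s)" for x s
        unfolding arg1 by (rule W[OF edge_weight_dominates(2) \<Lambda>1(1)]) (use \<nu> in simp)
      show "E * (\<Lambda> * (1 + \<bar>- 1 / \<nu>\<bar>) + 1 + \<bar>- 1 / \<nu>\<bar> powr (1 - e)) \<le> E * H"
        using EH \<nu> by (simp add: Ha_def)
    qed (rule range_right range_right'; assumption)+
    have top: "channel_regular x0 x1 e (E * H) (\<lambda>y. u (\<nu> / l + - \<nu> / l * snd y, - x0 / l + 1 / l * fst y))
       (\<lambda>y. 1 / l * us (\<nu> / l + - \<nu> / l * snd y, - x0 / l + 1 / l * fst y))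
       (\<lambda>y. - \<nu> / l * ut (\<nu> / l + - \<nu> / l * snd y, - x0 / l + 1 / l * fst y))"
      if u: "edge_regular (\<nu> / l) e E u ut us" for u ut us
    proof (rule channel_regular_mono[OF channel_regular_across[OF u E0 e _ _ _ \<Lambda>0]])
      show "(\<nu> / l + - \<nu> / l * s) powr (- e) \<le> \<Lambda> * edge_weight e x0 x1 (x, s)" for x s
        unfolding arg2 by (rule W[OF edge_weight_dominates(3) \<Lambda>1(2)]) (use \<nu> l in simp)
      have "\<nu> / l \<le> \<nu> / \<delta>" "1 / l \<le> 1 / \<delta>" using l \<nu> \<delta> by (auto intro!: divide_left_mono)
      then have "\<Lambda> * (\<nu> / l + 1 / l) + 1 + (\<nu> / l) powr (1 - e) + (1 / l) powr (1 - e) \<le> Hb"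
        unfolding Hb_def using \<Lambda>0 \<nu> l e by (intro add_mono mult_left_mono powr_mono2) auto
      then have "E * (\<Lambda> * (\<nu> / l + 1 / l) + 1 + (\<nu> / l) powr (1 - e) + (1 / l) powr (1 - e)) \<le> E * Hb"
        using E0 by (rule mult_left_mono)
      then show "E * (\<Lambda> * (\<bar>- \<nu> / l\<bar> + \<bar>1 / l\<bar>) + 1 + \<bar>- \<nu> / l\<bar> powr (1 - e) + \<bar>1 / l\<bar> powr (1 - e)) \<le> E * H"
        using EH(2) \<nu> l by simp
    qed (rule range_top range_top'; assumption)+
    define p where "p y = ml + b * (fst y - x0) + 0 * snd y + ua (- x0 / \<nu> + 1 / \<nu> * fst y, snd y) +
           ub (x1 / \<nu> + - 1 / \<nu> * fst y, snd y) + \<nu> / a * v3 (\<nu> / l + - \<nu> / l * snd y, - x0 / l + 1 / l * fst y)" for y :: "real \<times> real"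
    define px where "px y = b + 1 / \<nu> * t1 (- x0 / \<nu> + 1 / \<nu> * fst y, snd y) +
           - 1 / \<nu> * t2 (x1 / \<nu> + - 1 / \<nu> * fst y, snd y) +
           \<nu> / a * (1 / l * - t3 (\<nu> / l + - \<nu> / l * snd y, - x0 / l + 1 / l * fst y))" for y :: "real \<times> real"
    define py where "py y = 0 + s1 (- x0 / \<nu> + 1 / \<nu> * fst y, snd y) + s2 (x1 / \<nu> + - 1 / \<nu> * fst y, snd y) +
           \<nu> / a * (- \<nu> / l * s3 (\<nu> / l + - \<nu> / l * snd y, - x0 / l + 1 / l * fst y))" for y :: "real \<times> real"
    define \<theta> where "\<theta> y = 0 + 0 * (fst y - x0) + c * snd y + - \<nu> / q * v1 (- x0 / \<nu> + 1 / \<nu> * fst y, snd y) +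
           \<nu> / q * v2 (x1 / \<nu> + - 1 / \<nu> * fst y, snd y) + uc (\<nu> / l + - \<nu> / l * snd y, - x0 / l + 1 / l * fst y)" for y :: "real \<times> real"
    define \<theta>x where "\<theta>x y = 0 + - \<nu> / q * (1 / \<nu> * s1 (- x0 / \<nu> + 1 / \<nu> * fst y, snd y)) +
           \<nu> / q * (- 1 / \<nu> * s2 (x1 / \<nu> + - 1 / \<nu> * fst y, snd y)) +
           1 / l * s3 (\<nu> / l + - \<nu> / l * snd y, - x0 / l + 1 / l * fst y)" for y :: "real \<times> real"
    define \<theta>y where "\<theta>y y = c + - \<nu> / q * - t1 (- x0 / \<nu> + 1 / \<nu> * fst y, snd y) +
           \<nu> / q * - t2 (x1 / \<nu> + - 1 / \<nu> * fst y, snd y) +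
           - \<nu> / l * t3 (\<nu> / l + - \<nu> / l * snd y, - x0 / l + 1 / l * fst y)" for y :: "real \<times> real"
    have p_reg: "channel_regular x0 x1 e
        (\<bar>ml\<bar> + \<bar>b\<bar> * (1 + L + L powr e) + \<bar>0\<bar> + E * H + E * H + \<bar>\<nu> / a\<bar> * (E * H))
        p
        px
        py"
      unfolding p_def[abs_def] px_def[abs_def] py_def[abs_def]
      using l by (intro channel_regular_add channel_regular_affine channel_regular_scale e
         left[OF R1(1)] right[OF R2(1)] top[OF R3(2)]) auto
    have \<theta>_reg: "channel_regular x0 x1 e
        (\<bar>0\<bar> + \<bar>0\<bar> * (1 + L + L powr e) + \<bar>c\<bar> + \<bar>- \<nu> / q\<bar> * (E * H) + \<bar>\<nu> / q\<bar> * (E * H) + E * H)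
        \<theta>
        \<theta>x
        \<theta>y"
      unfolding \<theta>_def[abs_def] \<theta>x_def[abs_def] \<theta>y_def[abs_def]
      using l by (intro channel_regular_add channel_regular_affine channel_regular_scale e
         left[OF R1(2)] right[OF R2(2)] top[OF R3(1)]) auto
    have KB: "K * B = A0 * B + (E * H) * (3 + \<nu> / a + 2 * (\<nu> / q))"
      by (simp add: K_def E_def algebra_simps)
    have EH0: "0 \<le> E * H" using E0 H12 by simp
    have "\<bar>b\<bar> * (1 + L + L powr e) \<le> 2 * B / \<delta> * (1 + L + L powr e)"
      using bb L by (intro mult_right_mono) auto
    then have aff: "\<bar>ml\<bar> + \<bar>b\<bar> * (1 + L + L powr e) \<le> A0 * B" "\<bar>c\<bar> \<le> A0 * B"
    proof -
      show "\<bar>ml\<bar> + \<bar>b\<bar> * (1 + L + L powr e) \<le> A0 * B" if "\<bar>b\<bar> * (1 + L + L powr e) \<le> 2 * B / \<delta> * (1 + L + L powr e)"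
      proof -
        have "A0 * B = B + 2 * B / \<delta> * (1 + L + L powr e)" using \<delta> by (simp add: A0_def field_simps)
        then show ?thesis using that mlb by linarith
      qed
      show "\<bar>c\<bar> \<le> A0 * B" using cb mult_right_mono[OF A0 B0] by simp
    qed
    have Ka: "0 \<le> (E * H) * (\<nu> / a)" "0 \<le> (E * H) * (\<nu> / q)"
      using EH0 \<nu> a q by simp_all
    have Mp: "\<bar>ml\<bar> + \<bar>b\<bar> * (1 + L + L powr e) + \<bar>0\<bar> + E * H + E * H + \<bar>\<nu> / a\<bar> * (E * H) \<le> K * B"
    proof -
      have "A + X + X + y * X \<le> D + X * (3 + y + 2 * z)" if "A \<le> D" "0 \<le> X" "0 \<le> X * y" "0 \<le> X * z" for A D X y z :: real
        using that by (simp add: algebra_simps)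
      from this[OF aff(1) EH0 Ka] show ?thesis unfolding KB using \<nu> a by simp
    qed
    have M\<theta>: "\<bar>0\<bar> + \<bar>0\<bar> * (1 + L + L powr e) + \<bar>c\<bar> + \<bar>- \<nu> / q\<bar> * (E * H) + \<bar>\<nu> / q\<bar> * (E * H) + E * H \<le> K * B"
    proof -
      have "A + y * X + y * X + X \<le> D + X * (3 + z + 2 * y)" if "A \<le> D" "0 \<le> X" "0 \<le> X * z" "0 \<le> X * y" for A D X y z :: real
        using that by (simp add: algebra_simps)
      from this[OF aff(2) EH0 Ka] show ?thesis unfolding KB using \<nu> q by simp
    qed
    have e1: "\<nu> / q = a / \<nu>" using \<nu> q by (simp add: field_simps)
    have e2: "\<nu> / a * (\<nu> / l) = q / l" using \<nu> a by (simp add: field_simps)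
    show "\<exists>p \<theta> px py \<theta>x \<theta>y. channel_flow a q x0 x1 e (K * B) F gl gr gt p \<theta> px py \<theta>x \<theta>y"
    proof (rule exI[of _ p], rule exI[of _ \<theta>], rule exI[of _ px], rule exI[of _ py], rule exI[of _ \<theta>x],
        rule exI[of _ \<theta>y], unfold channel_flow_def, intro conjI ballI allI)
      show "channel_regular x0 x1 e (K * B) p px py" by (rule channel_regular_mono[OF p_reg Mp])
      show "channel_regular x0 x1 e (K * B) \<theta> \<theta>x \<theta>y" by (rule channel_regular_mono[OF \<theta>_reg M\<theta>])
    next
      fix s :: real assume s: "s \<in> {0..1}"
      have x0: "- x0 / \<nu> + 1 / \<nu> * x0 = 0" "x1 / \<nu> + - 1 / \<nu> * x0 = l / \<nu>" "- x0 / l + 1 / l * x0 = 0"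
       and x1: "- x0 / \<nu> + 1 / \<nu> * x1 = l / \<nu>" "x1 / \<nu> + - 1 / \<nu> * x1 = 0" "- x0 / l + 1 / l * x1 = 1"
        using l(1) by (simp_all add: l(4) add_divide_distrib)
      have "\<nu> / l + - \<nu> / l * s \<in> {0..\<nu> / l}" using range_top[of s] s by simp
      then have v3: "v3 (\<nu> / l + - \<nu> / l * s, 0) = 0" "v3 (\<nu> / l + - \<nu> / l * s, 1) = 0"
        using E3 unfolding edge_flow_def by blast+
      have ub: "ua (0, s) = gl s - ml" "ua (l / \<nu>, s) = 0" "ub (0, s) = gr s - mr" "ub (l / \<nu>, s) = 0"
        using E1 E2 s unfolding edge_flow_def by blast+
      show "p (x0, s) = gl s"
        unfolding p_def fst_conv snd_conv x0 v3 ub by simp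
      have "b * (x1 - x0) = mr - ml" using l by (simp add: b_def)
      then show "p (x1, s) = gr s"
        unfolding p_def fst_conv snd_conv x1 v3 ub by simp
    next
      fix x assume x: "x \<in> {x0..x1}"
      have "- x0 / \<nu> + 1 / \<nu> * x \<in> {0..l / \<nu>}" "x1 / \<nu> + - 1 / \<nu> * x \<in> {0..l / \<nu>}"
        using range_left[of x] range_right[of x] x by simp_all
      then have v: "v1 (- x0 / \<nu> + 1 / \<nu> * x, 0) = 0" "v1 (- x0 / \<nu> + 1 / \<nu> * x, 1) = 0"
         "v2 (x1 / \<nu> + - 1 / \<nu> * x, 0) = 0" "v2 (x1 / \<nu> + - 1 / \<nu> * x, 1) = 0"
        using E1 E2 unfolding edge_flow_def by blast+
      have X: "- x0 / l + 1 / l * x = (x - x0) / l" by (simp add: diff_divide_distrib)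
      have "(x - x0) / l \<in> {0..1}" using x l by (auto simp: pos_divide_le_eq)
      then have u: "uc (0, (x - x0) / l) = gt (x0 + l * ((x - x0) / l)) - c" "uc (\<nu> / l, (x - x0) / l) = 0"
        using E3 unfolding edge_flow_def by blast+
      show "\<theta> (x, 0) = 0"
        unfolding \<theta>_def fst_conv snd_conv X v by (simp add: u)
      show "\<theta> (x, 1) = gt x"
        unfolding \<theta>_def fst_conv snd_conv X v using u(1) l by simp
    next
      fix y :: "real \<times> real"
      have "S1 + S2 + \<nu> / a * (- \<nu> / l * S3) + q * (- \<nu> / q * (1 / \<nu> * S1) + \<nu> / q * (- 1 / \<nu> * S2) + 1 / l * S3) = 0" for S1 S2 S3
      proof -
        have "\<nu> / a * (- \<nu> / l * S3) = - (q / l * S3)" using arg_cong[OF e2, of "\<lambda>x. x * S3"] by simp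
        then show ?thesis using \<nu> q by (simp add: distrib_left right_diff_distrib)
      qed
      then show "py y + q * \<theta>x y = 0"
        unfolding py_def \<theta>x_def add_0 by blast
      have "c + - \<nu> / q * - S1 + \<nu> / q * - S2 + - \<nu> / l * S3 -
          a * (b + 1 / \<nu> * S1 + - 1 / \<nu> * S2 + \<nu> / a * (1 / l * - S3)) = F" for S1 S2 S3
      proof -
        have "a * (\<nu> / a * (1 / l * - S3)) = - \<nu> / l * S3" using a by simp
        then show ?thesis unfolding minus_divide_left[symmetric] e1
          using cab by (simp add: distrib_left right_diff_distrib)
      qed
      then show "\<theta>y y - a * px y = F"
        unfolding \<theta>y_def px_def by blast
    qed
  qed
qed

section \<open>Background states\<close>

text \<open>
  With unit mass flux the squared Mach number is \<open>q / (\<gamma> p)\<close>.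
\<close>

lemma background_state:
  assumes g: "gam N > 1" and p: "pr V > 0" and m: "rho N V * sp V = 1"
  shows "rho N V > 0" "sp V > 0" "rho N V = 1 / sp V" "acoef N V = 1 / sp V - 1 / (gam N * pr V)"
    and "mach N V < 1 \<Longrightarrow> acoef N V > 0" "mach N V > 1 \<Longrightarrow> acoef N V < 0"
proof -
  show r: "rho N V > 0" using rho_state_equation(1)[OF g p] .
  show q: "sp V > 0" using r m by (metis zero_less_mult_pos zero_less_one)
  show re: "rho N V = 1 / sp V" using m q by (simp add: field_simps)
  have s0: "sound N V > 0" using g p r by (simp add: sound_def)
  have M0: "mach N V > 0" using q s0 by (simp add: mach_def)
  have "(sound N V)\<^sup>2 = gam N * pr V * sp V" using g p q by (simp add: sound_def re)
  then have M2: "(mach N V)\<^sup>2 = sp V / (gam N * pr V)"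
    using q by (simp add: mach_def power_divide power2_eq_square)
  have ac: "acoef N V = (1 - (mach N V)\<^sup>2) / sp V"
    using q by (simp add: acoef_def re power2_eq_square)
  show "acoef N V = 1 / sp V - 1 / (gam N * pr V)"
    unfolding ac M2 using q by (simp add: diff_divide_distrib)
  show "acoef N V > 0" if "mach N V < 1"
    unfolding ac using that M0 q by (simp add: power_less_one_iff)
  show "acoef N V < 0" if "mach N V > 1"
    unfolding ac using that q one_less_power[OF that, of 2] by (simp add: divide_less_0_iff)
qed

section \<open>Travelling waves\<close>

lemma C2_holder_imp_bound:
  assumes f: "C2_holder \<alpha> I f f' f''" and sub: "{c..d} \<subseteq> I" and \<alpha>: "\<alpha> > 0"
  obtains B where "0 \<le> B" "C2_bound {c..d} f f' f'' B"
proof -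
  obtain H where H: "\<And>x y. x \<in> I \<Longrightarrow> y \<in> I \<Longrightarrow> \<bar>f'' x - f'' y\<bar> \<le> H * \<bar>x - y\<bar> powr \<alpha>"
    using f unfolding C2_holder_def by blast
  have der: "\<And>x. x \<in> {c..d} \<Longrightarrow> (f has_real_derivative f' x) (at x within {c..d})"
    "\<And>x. x \<in> {c..d} \<Longrightarrow> (f' has_real_derivative f'' x) (at x within {c..d})"
    by (rule DERIV_subset[OF _ sub]; use f sub in \<open>unfold C2_holder_def, blast\<close>)+
  have c2: "continuous_on {c..d} f''"
  proof (rule continuous_on_holder[where M = H and \<alpha> = \<alpha>])
    fix x y assume "x \<in> {c..d}" "y \<in> {c..d}"
    then show "\<bar>f'' x - f'' y\<bar> \<le> H * dist x y powr \<alpha>"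
      unfolding dist_real_def using sub by (intro H) blast+
  qed (rule \<alpha>)
  have "\<exists>B. \<forall>s\<in>{c..d}. \<bar>k s\<bar> \<le> B" if "continuous_on {c..d} k" for k :: "real \<Rightarrow> real"
    using compact_imp_bounded[OF compact_continuous_image[OF that]] by (auto simp: bounded_iff)
  from this[OF DERIV_continuous_on[OF der(1)]] this[OF DERIV_continuous_on[OF der(2)]] this[OF c2]
  obtain B0 B1 B2 where B: "\<And>s. s \<in> {c..d} \<Longrightarrow> \<bar>f s\<bar> \<le> B0" "\<And>s. s \<in> {c..d} \<Longrightarrow> \<bar>f' s\<bar> \<le> B1"
      "\<And>s. s \<in> {c..d} \<Longrightarrow> \<bar>f'' s\<bar> \<le> B2" by blast
  show ?thesis
  proof (rule that[of "\<bar>B0\<bar> + \<bar>B1\<bar> + \<bar>B2\<bar>"])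
    have "\<bar>f s\<bar> \<le> \<bar>B0\<bar> + \<bar>B1\<bar> + \<bar>B2\<bar> \<and> \<bar>f' s\<bar> \<le> \<bar>B0\<bar> + \<bar>B1\<bar> + \<bar>B2\<bar> \<and> \<bar>f'' s\<bar> \<le> \<bar>B0\<bar> + \<bar>B1\<bar> + \<bar>B2\<bar>"
      if "s \<in> {c..d}" for s
      using B[OF that] by linarith
    then show "C2_bound {c..d} f f' f'' (\<bar>B0\<bar> + \<bar>B1\<bar> + \<bar>B2\<bar>)"
      using der c2 unfolding C2_bound_def by blast
  qed simp
qed

text \<open>
  Waves that enter through \<open>y\<^sub>1 = 0\<close> carry the value zero.  Since the profile of the wall vanishes to second
  order at 0, its continuation by zero keeps two Hoelder continuous derivatives.
\<close>

definition zero_extension :: "(real \<Rightarrow> real) \<Rightarrow> real \<Rightarrow> real" where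
  "zero_extension f t = (if t < 0 then 0 else f t)"

lemma zero_extension_deriv:
  assumes f: "\<And>x. x \<in> {0..L} \<Longrightarrow> (f has_real_derivative f' x) (at x within {0..L})"
    and z: "f 0 = 0" "f' 0 = 0" and t: "t < L" "0 < L"
  shows "(zero_extension f has_real_derivative zero_extension f' t) (at t)"
proof -
  consider "t < 0" | "t = 0" | "0 < t" by linarith
  then show ?thesis
  proof cases
    case 1
    have "((\<lambda>t. 0) has_real_derivative 0) (at t)" by simp
    then have "(zero_extension f has_real_derivative 0) (at t)"
      by (rule has_field_derivative_transform_within_open[where S = "{..<0}"])
         (use 1 in \<open>auto simp: zero_extension_def\<close>)
    then show ?thesis using 1 by (simp add: zero_extension_def)
  next
    case 3
    have "(f has_real_derivative f' t) (at t)"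
      using f[of t] 3 t at_within_Icc_at[of 0 t L] by auto
    then have "(zero_extension f has_real_derivative f' t) (at t)"
      by (rule has_field_derivative_transform_within_open[where S = "{0<..}"])
         (use 3 in \<open>auto simp: zero_extension_def\<close>)
    then show ?thesis using 3 by (simp add: zero_extension_def)
  next
    case 2
    have "(f has_real_derivative 0) (at_right 0)"
      using f[of 0] z t at_within_Icc_at_right[of 0 L] by simp
    then have "((\<lambda>y. (f y - f 0) / (y - 0)) \<longlongrightarrow> 0) (at_right 0)"
      unfolding has_field_derivative_iff .
    then have "((\<lambda>y. (zero_extension f y - zero_extension f 0) / (y - 0)) \<longlongrightarrow> 0) (at_right 0)"
      by (rule Lim_transform_eventually)
         (auto simp: zero_extension_def eventually_at_filter intro!: always_eventually)
    moreover have "((\<lambda>y. (zero_extension f y - zero_extension f 0) / (y - 0)) \<longlongrightarrow> 0) (at_left 0)"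
      by (rule Lim_transform_eventually[OF tendsto_const])
         (use z in \<open>auto simp: zero_extension_def eventually_at_filter intro!: always_eventually\<close>)
    ultimately show ?thesis
      unfolding has_field_derivative_iff 2
      by (auto intro: filterlim_split_at simp: zero_extension_def z)
  qed
qed

lemma zero_extension_holder:
  assumes h: "\<And>x y. x \<in> {0..L} \<Longrightarrow> y \<in> {0..L} \<Longrightarrow> \<bar>f x - f y\<bar> \<le> H * \<bar>x - y\<bar> powr \<alpha>" "f 0 = 0" "0 \<le> H" "0 < \<alpha>"
    and st: "s < L" "t < L" "0 < L"
  shows "\<bar>zero_extension f s - zero_extension f t\<bar> \<le> H * \<bar>s - t\<bar> powr \<alpha>"
proof -
  have neg: "\<bar>f t\<bar> \<le> H * \<bar>s - t\<bar> powr \<alpha>" if "s < 0" "0 \<le> t" "t < L" for s t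
  proof -
    have "\<bar>f t\<bar> \<le> H * \<bar>t\<bar> powr \<alpha>" using h(1)[of t 0] h(2) that by simp
    also have "\<dots> \<le> H * \<bar>s - t\<bar> powr \<alpha>" using that h by (intro mult_left_mono powr_mono2) auto
    finally show ?thesis .
  qed
  show ?thesis
    using neg[of s t] neg[of t s] h(1)[of s t] h(3) st
    by (auto simp: zero_extension_def abs_minus_commute)
qed

text \<open>
  The wall profile is given on the length of the channel only.  The arguments of all waves have to stay below \<open>L\<close>,
  and there is no restriction to the left, where the profile is continued by zero.
\<close>

locale wave_profile =
  fixes L \<alpha> G :: real and g g' g'' :: "real \<Rightarrow> real"
  assumes \<alpha>: "0 < \<alpha>" "\<alpha> < 1" and G: "0 \<le> G" and L: "0 < L"
    and g: "\<And>t. t < L \<Longrightarrow> (g has_real_derivative g' t) (at t)"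
    and g': "\<And>t. t < L \<Longrightarrow> (g' has_real_derivative g'' t) (at t)"
    and gb: "\<And>t. t < L \<Longrightarrow> \<bar>g t\<bar> \<le> G" "\<And>t. t < L \<Longrightarrow> \<bar>g' t\<bar> \<le> G" "\<And>t. t < L \<Longrightarrow> \<bar>g'' t\<bar> \<le> G"
    and gh: "\<And>s t. s < L \<Longrightarrow> t < L \<Longrightarrow> \<bar>g'' s - g'' t\<bar> \<le> G * \<bar>s - t\<bar> powr \<alpha>"
begin

text \<open>
  The linear term is the response to the constant heat source.
\<close>

definition wave :: "real \<Rightarrow> 'i set \<Rightarrow> ('i \<Rightarrow> real) \<Rightarrow> ('i \<Rightarrow> real) \<Rightarrow> ('i \<Rightarrow> real) \<Rightarrow> real \<times> real \<Rightarrow> real" where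
  "wave m I w c r y = m * fst y + (\<Sum>i\<in>I. w i * g (fst y + c i * snd y + r i))"

definition wave_d :: "real \<times> real \<Rightarrow> real \<Rightarrow> 'i set \<Rightarrow> ('i \<Rightarrow> real) \<Rightarrow> ('i \<Rightarrow> real) \<Rightarrow> ('i \<Rightarrow> real) \<Rightarrow> real \<times> real \<Rightarrow> real" where
  "wave_d e m I w c r y = m * fst e + (\<Sum>i\<in>I. w i * ((fst e + c i * snd e) * g' (fst y + c i * snd y + r i)))"

definition wave_dd :: "real \<times> real \<Rightarrow> real \<times> real \<Rightarrow> 'i set \<Rightarrow> ('i \<Rightarrow> real) \<Rightarrow> ('i \<Rightarrow> real) \<Rightarrow> ('i \<Rightarrow> real) \<Rightarrow> real \<times> real \<Rightarrow> real" where
  "wave_dd e e' I w c r y =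
     (\<Sum>i\<in>I. w i * ((fst e + c i * snd e) * ((fst e' + c i * snd e') * g'' (fst y + c i * snd y + r i))))"

lemma profile_deriv_along:
  assumes "\<And>t. t < L \<Longrightarrow> (k has_real_derivative k' t) (at t)" "fst y + c * snd y + r < L"
  shows "((\<lambda>t. k (fst (y + t *\<^sub>R e) + c * snd (y + t *\<^sub>R e) + r)) has_real_derivative
    (fst e + c * snd e) * k' (fst y + c * snd y + r)) (at 0)"
proof -
  have "((\<lambda>t. k (fst (y + t *\<^sub>R e) + c * snd (y + t *\<^sub>R e) + r)) has_real_derivative
    k' (fst y + c * snd y + r) * (fst e + c * snd e)) (at 0)"
    by (rule DERIV_chain2[where f = k])
       (use assms in \<open>auto intro!: derivative_eq_intros\<close>)
  then show ?thesis by (simp add: mult.commute)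
qed

lemma wave_deriv:
  assumes "\<And>i. i \<in> I \<Longrightarrow> fst y + c i * snd y + r i < L"
  shows "((\<lambda>t. wave m I w c r (y + t *\<^sub>R e)) has_real_derivative wave_d e m I w c r y) (at 0)"
  unfolding wave_def wave_d_def
  by (intro DERIV_add DERIV_sum DERIV_cmult profile_deriv_along g assms) (auto intro!: derivative_eq_intros)

lemma wave_deriv2:
  assumes "\<And>i. i \<in> I \<Longrightarrow> fst y + c i * snd y + r i < L"
  shows "((\<lambda>t. wave_d e m I w c r (y + t *\<^sub>R e')) has_real_derivative wave_dd e e' I w c r y) (at 0)"
proof -
  have "((\<lambda>t. wave_d e m I w c r (y + t *\<^sub>R e')) has_real_derivative 0 + wave_dd e e' I w c r y) (at 0)"
    unfolding wave_d_def wave_dd_def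
    by (intro DERIV_add DERIV_sum DERIV_cmult profile_deriv_along g' assms) (auto intro!: derivative_eq_intros)
  then show ?thesis by simp
qed

lemma sum_bound:
  assumes "\<And>i. i \<in> I \<Longrightarrow> \<bar>w i\<bar> \<le> W" "\<And>i. i \<in> I \<Longrightarrow> \<bar>x i\<bar> \<le> X" "0 \<le> W"
  shows "\<bar>\<Sum>i\<in>I. w i * x i\<bar> \<le> real (card I) * (W * X)"
proof -
  have "\<bar>\<Sum>i\<in>I. w i * x i\<bar> \<le> (\<Sum>i\<in>I. \<bar>w i * x i\<bar>)" by (rule sum_abs)
  also have "\<dots> \<le> real (card I) * (W * X)"
    by (rule sum_bounded_above) (use assms in \<open>auto simp: abs_mult intro!: mult_mono\<close>)
  finally show ?thesis .
qed

lemma basis_factor_bound: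
  fixes e :: "real \<times> real"
  assumes "e \<in> Basis" "\<bar>c\<bar> \<le> cmax"
  shows "\<bar>fst e + c * snd e\<bar> \<le> 1 + cmax"
  using assms by (auto simp: Basis_real2)

text \<open>
  A common bound for \<open>k\<close> waves with weights up to \<open>W\<close> and slopes up to \<open>cmax\<close>: every derivative, and the Hoelder
  estimate of the second ones, costs at most a factor \<open>1 + cmax\<close>.
\<close>

definition wave_bound :: "nat \<Rightarrow> real \<Rightarrow> real \<Rightarrow> real \<Rightarrow> real" where
  "wave_bound k W cmax m = \<bar>m\<bar> * (1 + L) + real k * (W * ((1 + cmax) ^ 3 * G))"

context
  fixes I :: "'i set" and w c r :: "'i \<Rightarrow> real" and W cmax :: real and S :: "(real \<times> real) set"
  assumes w: "\<And>i. i \<in> I \<Longrightarrow> \<bar>w i\<bar> \<le> W" and c: "\<And>i. i \<in> I \<Longrightarrow> \<bar>c i\<bar> \<le> cmax" and W: "0 \<le> W" and cmax: "0 \<le> cmax"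
    and S: "\<And>y. y \<in> S \<Longrightarrow> 0 \<le> fst y \<and> fst y < L"
    and arg: "\<And>y i. y \<in> S \<Longrightarrow> i \<in> I \<Longrightarrow> fst y + c i * snd y + r i < L"
begin

lemma wave_bound_nonneg: "0 \<le> wave_bound (card I) W cmax m"
  unfolding wave_bound_def using L W cmax G by (intro add_nonneg_nonneg mult_nonneg_nonneg) auto

lemma le_wave_bound:
  assumes "n \<le> 3" "\<bar>x\<bar> \<le> \<bar>m\<bar> * (1 + L) + real (card I) * (W * ((1 + cmax) ^ n * G))"
  shows "\<bar>x\<bar> \<le> wave_bound (card I) W cmax m"
proof -
  have "(1 + cmax) ^ n \<le> (1 + cmax) ^ 3" using assms cmax by (intro power_increasing) auto
  then have "real (card I) * (W * ((1 + cmax) ^ n * G)) \<le> real (card I) * (W * ((1 + cmax) ^ 3 * G))"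
    using W G by (intro mult_left_mono mult_right_mono) auto
  then show ?thesis using assms unfolding wave_bound_def by linarith
qed

lemma wave_abs: "y \<in> S \<Longrightarrow> \<bar>wave m I w c r y\<bar> \<le> wave_bound (card I) W cmax m"
proof (rule le_wave_bound[of 0])
  assume y: "y \<in> S"
  have "\<bar>\<Sum>i\<in>I. w i * g (fst y + c i * snd y + r i)\<bar> \<le> real (card I) * (W * G)"
    by (rule sum_bound) (use w W gb arg y in auto)
  moreover have "\<bar>m * fst y\<bar> \<le> \<bar>m\<bar> * (1 + L)"
    unfolding abs_mult using S[OF y] by (intro mult_left_mono) auto
  ultimately show "\<bar>wave m I w c r y\<bar> \<le> \<bar>m\<bar> * (1 + L) + real (card I) * (W * ((1 + cmax) ^ 0 * G))"
    unfolding wave_def by (intro order_trans[OF abs_triangle_ineq] add_mono) auto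
qed simp

lemma wave_d_abs: "y \<in> S \<Longrightarrow> e \<in> Basis \<Longrightarrow> \<bar>wave_d e m I w c r y\<bar> \<le> wave_bound (card I) W cmax m"
proof (rule le_wave_bound[of 1])
  assume y: "y \<in> S" and e: "e \<in> Basis"
  have "\<bar>\<Sum>i\<in>I. w i * ((fst e + c i * snd e) * g' (fst y + c i * snd y + r i))\<bar> \<le> real (card I) * (W * ((1 + cmax) * G))"
    by (rule sum_bound)
       (use w W gb arg y basis_factor_bound[OF e c] cmax in \<open>auto simp: abs_mult intro!: mult_mono\<close>)
  moreover have "\<bar>m * fst e\<bar> \<le> \<bar>m\<bar> * (1 + L)"
    unfolding abs_mult using e L by (intro mult_left_mono) (auto simp: Basis_real2)
  ultimately show "\<bar>wave_d e m I w c r y\<bar> \<le> \<bar>m\<bar> * (1 + L) + real (card I) * (W * ((1 + cmax) ^ 1 * G))"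
    unfolding wave_d_def by (intro order_trans[OF abs_triangle_ineq] add_mono) auto
qed simp

lemma wave_dd_abs: "y \<in> S \<Longrightarrow> e \<in> Basis \<Longrightarrow> e' \<in> Basis \<Longrightarrow> \<bar>wave_dd e e' I w c r y\<bar> \<le> wave_bound (card I) W cmax m"
proof (rule le_wave_bound[of 2])
  assume y: "y \<in> S" and e: "e \<in> Basis" "e' \<in> Basis"
  have "\<bar>wave_dd e e' I w c r y\<bar> \<le> real (card I) * (W * ((1 + cmax) * ((1 + cmax) * G)))"
    unfolding wave_dd_def
    by (rule sum_bound)
       (use w W gb arg y basis_factor_bound[OF e(1) c] basis_factor_bound[OF e(2) c] cmax in
         \<open>auto simp: abs_mult intro!: mult_mono\<close>)
  moreover have "0 \<le> \<bar>m\<bar> * (1 + L)" using L by simp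
  ultimately show "\<bar>wave_dd e e' I w c r y\<bar> \<le> \<bar>m\<bar> * (1 + L) + real (card I) * (W * ((1 + cmax) ^ 2 * G))"
    by (simp add: power2_eq_square mult.assoc)
qed simp

lemma wave_dd_holder:
  assumes y: "y \<in> S" "z \<in> S" and e: "e \<in> Basis" "e' \<in> Basis"
  shows "\<bar>wave_dd e e' I w c r y - wave_dd e e' I w c r z\<bar> \<le> wave_bound (card I) W cmax m * dist y z powr \<alpha>"
proof -
  define D where "D = 1 + cmax"
  have D: "D \<ge> 1" using cmax by (simp add: D_def)
  have d: "\<bar>g'' (fst y + c i * snd y + r i) - g'' (fst z + c i * snd z + r i)\<bar> \<le> D * G * dist y z powr \<alpha>"
    if i: "i \<in> I" for i
  proof -
    have "\<bar>g'' (fst y + c i * snd y + r i) - g'' (fst z + c i * snd z + r i)\<bar> \<le>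
       G * \<bar>(fst y - fst z) + c i * (snd y - snd z)\<bar> powr \<alpha>"
      using gh[OF arg[OF y(1) i] arg[OF y(2) i]] by (simp add: algebra_simps)
    also have "\<bar>(fst y - fst z) + c i * (snd y - snd z)\<bar> \<le> D * dist y z"
    proof -
      have "\<bar>c i * (snd y - snd z)\<bar> \<le> cmax * dist y z"
        unfolding abs_mult using c[OF i] dist_snd_le[of y z] cmax by (intro mult_mono) (auto simp: dist_real_def)
      moreover have "\<bar>fst y - fst z\<bar> \<le> dist y z" using dist_fst_le[of y z] by (simp add: dist_real_def)
      moreover have "D * dist y z = dist y z + cmax * dist y z" by (simp add: D_def algebra_simps)
      ultimately show ?thesis by linarith
    qed
    then have "G * \<bar>(fst y - fst z) + c i * (snd y - snd z)\<bar> powr \<alpha> \<le> G * (D * dist y z) powr \<alpha>"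
      using \<alpha> G by (intro mult_left_mono powr_mono2) auto
    also have "\<dots> = G * (D powr \<alpha> * dist y z powr \<alpha>)" using D by (simp add: powr_mult)
    also have "\<dots> \<le> G * (D * dist y z powr \<alpha>)"
      using powr_mono[of \<alpha> 1 D] D \<alpha> G by (intro mult_left_mono mult_right_mono) auto
    finally show ?thesis by (simp add: mult_ac)
  qed
  have "wave_dd e e' I w c r y - wave_dd e e' I w c r z =
    (\<Sum>i\<in>I. w i * ((fst e + c i * snd e) * ((fst e' + c i * snd e') *
       (g'' (fst y + c i * snd y + r i) - g'' (fst z + c i * snd z + r i)))))"
    unfolding wave_dd_def sum_subtractf[symmetric] by (rule sum.cong) (auto simp: algebra_simps)
  also have "\<bar>\<dots>\<bar> \<le> real (card I) * (W * (D * (D * (D * G * dist y z powr \<alpha>))))"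
    by (rule sum_bound)
       (use w W d basis_factor_bound[OF e(1) c] basis_factor_bound[OF e(2) c] D in
         \<open>auto simp: abs_mult D_def intro!: mult_mono\<close>)
  also have "\<dots> = real (card I) * (W * (D ^ 3 * G)) * dist y z powr \<alpha>"
    by (simp add: power3_eq_cube)
  also have "\<dots> \<le> wave_bound (card I) W cmax m * dist y z powr \<alpha>"
    unfolding wave_bound_def D_def using L by (intro mult_right_mono) auto
  finally show ?thesis .
qed

lemma wave_holder_norm:
  assumes "open S"
  shows "holder_norm 2 \<alpha> S (wave m I w c r) \<le> ennreal (11 * wave_bound (card I) W cmax m)"
proof (rule holder_norm_2_le[where F = "\<lambda>e. wave_d e m I w c r" and G = "\<lambda>e e'. wave_dd e e' I w c r"])
  show "((\<lambda>t. wave m I w c r (y + t *\<^sub>R e)) has_real_derivative wave_d e m I w c r y) (at 0)" if "y \<in> S" for e y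
    by (rule wave_deriv[OF arg[OF that]])
  show "((\<lambda>t. wave_d e m I w c r (y + t *\<^sub>R e')) has_real_derivative wave_dd e e' I w c r y) (at 0)" if "y \<in> S" for e e' y
    by (rule wave_deriv2[OF arg[OF that]])
qed (fact assms wave_bound_nonneg | erule wave_abs wave_d_abs wave_dd_abs wave_dd_holder; assumption)+

lemma wave_trace_C2:
  assumes "\<And>s. s \<in> {0..1} \<Longrightarrow> (\<xi>, s) \<in> S"
  shows "C2_bound {0..1} (\<lambda>s. wave m I w c r (\<xi>, s)) (\<lambda>s. wave_d (0, 1) m I w c r (\<xi>, s))
    (\<lambda>s. wave_dd (0, 1) (0, 1) I w c r (\<xi>, s)) (wave_bound (card I) W cmax m)"
proof -
  have e: "(0, 1) \<in> (Basis :: (real \<times> real) set)" by (auto simp: Basis_real2)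
  have "continuous_on {0..1} (\<lambda>s. wave_dd (0, 1) (0, 1) I w c r (\<xi>, s))"
  proof (rule continuous_on_holder[where M = "wave_bound (card I) W cmax 0" and \<alpha> = \<alpha>])
    fix s t :: real assume "s \<in> {0..1}" "t \<in> {0..1}"
    then show "\<bar>wave_dd (0, 1) (0, 1) I w c r (\<xi>, s) - wave_dd (0, 1) (0, 1) I w c r (\<xi>, t)\<bar> \<le> wave_bound (card I) W cmax 0 * dist s t powr \<alpha>"
      using wave_dd_holder[OF assms assms e e, of s t 0] by (simp add: dist_Pair_Pair)
  qed (rule \<alpha>)
  moreover have "((\<lambda>s. wave m I w c r (\<xi>, s)) has_real_derivative wave_d (0, 1) m I w c r (\<xi>, s)) (at s within {0..1})"
      "((\<lambda>s. wave_d (0, 1) m I w c r (\<xi>, s)) has_real_derivative wave_dd (0, 1) (0, 1) I w c r (\<xi>, s)) (at s within {0..1})"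
    if "s \<in> {0..1}" for s
    by (rule has_field_derivative_at_within, subst partial_derivative_shift(2)[symmetric],
        rule wave_deriv wave_deriv2, rule arg[OF assms[OF that]], assumption)+
  ultimately show ?thesis
    unfolding C2_bound_def using wave_abs[OF assms] wave_d_abs[OF assms e] wave_dd_abs[OF assms e e] by blast
qed

lemma wave_differentiable: "y \<in> S \<Longrightarrow> wave m I w c r differentiable (at y)"
proof -
  assume y: "y \<in> S"
  have "(\<lambda>y. g (fst y + c i * snd y + r i)) differentiable (at y)" if "i \<in> I" for i
  proof (rule differentiable_compose[where f = g])
    show "g differentiable at (fst y + c i * snd y + r i)"
      using g[OF arg[OF y that]] by (auto simp: real_differentiable_def)
    show "(\<lambda>y. fst y + c i * snd y + r i) differentiable at y"
      unfolding differentiable_def by (rule exI) (auto intro!: derivative_eq_intros)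
  qed
  moreover have "(\<lambda>y. m * fst y) differentiable (at y)"
    unfolding differentiable_def by (rule exI) (auto intro!: derivative_eq_intros)
  ultimately have "(\<lambda>y. m * fst y + (\<Sum>i\<in>I. w i * g (fst y + c i * snd y + r i))) differentiable (at y)"
    by (cases "finite I") (auto intro!: differentiable_add differentiable_sum differentiable_mult)
  then show ?thesis by (simp add: wave_def[abs_def])
qed

end

end

section \<open>The supersonic flow\<close>

text \<open>
  Ahead of the shock \<open>a = acoef\<close> is negative and the system is hyperbolic with slopes \<open>\<plusminus> c\<close>, \<open>c = sqrt (- a q)\<close>.  The
  source alone has the solution \<open>p = - \<kappa> f1 y\<^sub>1 / a\<close>, \<open>\<theta> = 0\<close>.  The wave emitted by the upper wall is
  reflected at the two walls in turn.  The waves that meet at the lower wall cancel in \<open>\<theta>\<close>; on the upper wall the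
  sum for \<open>\<theta>\<close> telescopes to the wall profile minus the wave after \<open>n\<close> round trips, which has not entered the channel
  when \<open>2 c n > L\<close>.  So finitely many waves are enough, and their number does not depend on \<open>\<xi>\<close>.  The last
  conclusion, on the mean pressure ahead of the shock, comes from the same telescoping for a primitive of the profile.
\<close>

lemma supersonic_exists:
  assumes gas: "gas N" and bg: "background N" and bd: "boundary_data \<alpha> N" and \<alpha>: "0 < \<alpha>" "\<alpha> < 1"
  obtains C where "0 \<le> C"
    "\<And>\<sigma> \<kappa> \<xi>. 0 < \<sigma> \<Longrightarrow> 0 < \<kappa> \<Longrightarrow> 0 < \<xi> \<Longrightarrow> \<xi> < len N \<Longrightarrow>
       \<exists>U p' p'' \<theta>' \<theta>''. supersonic_problem N \<sigma> \<kappa> \<xi> U \<and> norm_m \<alpha> \<xi> U \<le> ennreal (C * (\<sigma> + \<kappa>)) \<and>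
         C2_bound {0..1} (\<lambda>s. pr (U (\<xi>, s))) p' p'' (C * (\<sigma> + \<kappa>)) \<and>
         C2_bound {0..1} (\<lambda>s. th (U (\<xi>, s))) \<theta>' \<theta>'' (C * (\<sigma> + \<kappa>)) \<and>
         (\<forall>s. sp (U (\<xi>, s)) = - pr (U (\<xi>, s)) \<and> en (U (\<xi>, s)) = \<kappa> * f4 N (bgm N) * \<xi> \<and>
            mf (U (\<xi>, s)) = - \<kappa> * f5 N (bgm N) * \<xi>) \<and>
         acoef N (bgm N) * integral {0..1} (\<lambda>s. pr (U (\<xi>, s))) =
           \<sigma> * integral {0..\<xi>} (Theta N) - \<kappa> * f1 N (bgm N) * \<xi>"
proof -
  define V where "V = bgm N"
  define L where "L = len N"
  have L: "0 < L" using gas by (simp add: gas_def L_def)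
  have gam: "gam N > 1" using gas by (simp add: gas_def)
  have V: "pr V > 0" "mach N V > 1" "rho N V * sp V = 1" using bg by (simp_all add: background_def V_def)
  note bs = background_state[OF gam V(1,3)]
  define a where "a = acoef N V"
  define b where "b = - a"
  define q where "q = sp V"
  have b: "b > 0" using bs(6)[OF V(2)] by (simp add: a_def b_def)
  have q: "q > 0" using bs(2) by (simp add: q_def)
  define c where "c = sqrt (b * q)"
  have c: "c > 0" "c * c = b * q" using b q by (auto simp: c_def)
  obtain \<Theta>' \<Theta>'' where \<Theta>: "C2_holder \<alpha> {0..L} (Theta N) \<Theta>' \<Theta>''" "Theta N 0 = 0" "\<Theta>' 0 = 0" "\<Theta>'' 0 = 0"
    using bd unfolding boundary_data_def L_def by blast
  obtain B where B: "0 \<le> B" "C2_bound {0..L} (Theta N) \<Theta>' \<Theta>'' B"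
    using C2_holder_imp_bound[OF \<Theta>(1) order_refl \<alpha>(1)] .
  obtain H where H: "\<And>x y. x \<in> {0..L} \<Longrightarrow> y \<in> {0..L} \<Longrightarrow> \<bar>\<Theta>'' x - \<Theta>'' y\<bar> \<le> H * \<bar>x - y\<bar> powr \<alpha>"
    using \<Theta>(1) unfolding C2_holder_def by blast
  define G where "G = B + \<bar>H\<bar>"
  have G: "0 \<le> G" "B \<le> G" "H \<le> G" using B by (auto simp: G_def)
  have \<Theta>c: "continuous_on {0..L} (Theta N)" using B(2) by (rule C2_bound_continuous)
  define g where "g = zero_extension (Theta N)"
  have gd: "(g has_real_derivative zero_extension \<Theta>' t) (at t)" if "t < L" for t
    unfolding g_def by (rule zero_extension_deriv) (use B(2) \<Theta> that L in \<open>auto simp: C2_bound_def\<close>)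
  interpret P: wave_profile L \<alpha> G g "zero_extension \<Theta>'" "zero_extension \<Theta>''"
  proof
    fix t assume t: "t < L"
    show "(g has_real_derivative zero_extension \<Theta>' t) (at t)" by (rule gd[OF t])
    show "(zero_extension \<Theta>' has_real_derivative zero_extension \<Theta>'' t) (at t)"
      by (rule zero_extension_deriv) (use B(2) \<Theta> t L in \<open>auto simp: C2_bound_def\<close>)
    show "\<bar>g t\<bar> \<le> G" "\<bar>zero_extension \<Theta>' t\<bar> \<le> G" "\<bar>zero_extension \<Theta>'' t\<bar> \<le> G"
      using B(2) t G unfolding g_def zero_extension_def C2_bound_def by (auto intro: order_trans)
  next
    fix s t assume st: "s < L" "t < L"
    show "\<bar>zero_extension \<Theta>'' s - zero_extension \<Theta>'' t\<bar> \<le> G * \<bar>s - t\<bar> powr \<alpha>"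
    proof (rule zero_extension_holder)
      show "\<bar>\<Theta>'' x - \<Theta>'' y\<bar> \<le> G * \<bar>x - y\<bar> powr \<alpha>" if "x \<in> {0..L}" "y \<in> {0..L}" for x y
        using H[OF that] mult_right_mono[OF G(3), of "\<bar>x - y\<bar> powr \<alpha>"] by simp
    qed (use \<Theta> G \<alpha> st L in auto)
  qed (use \<alpha> G L in auto)
  define Gi where "Gi = zero_extension (\<lambda>t. integral {0..t} (Theta N))"
  have Gid: "(Gi has_real_derivative g t) (at t)" if "t < L" for t
    unfolding Gi_def g_def
    by (rule zero_extension_deriv) (use \<Theta>c \<Theta>(2) that L in \<open>auto intro!: integral_has_real_derivative\<close>)
  \<comment> \<open>after \<open>n\<close> round trips a wave would have started from a negative abscissa\<close>
  obtain n where n: "L < real n * (2 * c)" using reals_Archimedean3[of "2 * c"] c by auto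
  define I where "I = {..<n} \<times> (UNIV :: bool set)"
  \<comment> \<open>\<open>(k, True)\<close> is the \<open>k\<close>-th wave on its way down, \<open>(k, False)\<close> the same wave on its way up\<close>
  define cc where "cc j = (if snd j then c else - c)" for j :: "nat \<times> bool"
  define rr where "rr j = - c * (2 * real (fst j) + 1)" for j :: "nat \<times> bool"
  have sumI: "(\<Sum>j\<in>I. F j) = (\<Sum>k<n. F (k, True) + F (k, False))" for F :: "nat \<times> bool \<Rightarrow> real"
  proof -
    have "(\<Sum>j\<in>I. F j) = (\<Sum>k<n. \<Sum>t\<in>UNIV. F (k, t))"
      unfolding I_def by (simp add: sum.cartesian_product)
    then show ?thesis by (simp add: UNIV_bool add.commute)
  qed
  have arg: "x + cc j * s + rr j \<le> x" if "0 \<le> s" "s \<le> 1" for x j s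
  proof -
    have "c * s \<le> c * 1" "0 \<le> c * s" using that c by (intro mult_left_mono mult_nonneg_nonneg; simp)+
    then have "cc j * s \<le> c" using c by (simp add: cc_def)
    moreover have "c * 1 \<le> c * (2 * real (fst j) + 1)" using c by (intro mult_left_mono) auto
    ultimately show ?thesis by (simp add: rr_def)
  qed
  define mm where "mm i = (if i = 1 then - (f1 N V / a) else if i = 3 then f1 N V / a else if i = 4 then f4 N V
      else if i = 2 then 0 else - f5 N V)" for i :: 5
  define ww where "ww i j = (if i = 1 then - (c / b) else if i = 3 then c / b else if i = 2 then (if snd j then 1 else - 1) else 0)"
    for i :: 5 and j :: "nat \<times> bool"
  define m0 where "m0 = \<bar>f1 N V / a\<bar> + \<bar>f4 N V\<bar> + \<bar>f5 N V\<bar>"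
  define w0 where "w0 = 1 + c / b"
  have m0: "\<bar>mm i\<bar> \<le> m0" for i by (auto simp: mm_def m0_def)
  have w0: "\<bar>ww i j\<bar> \<le> w0" "0 \<le> w0" for i j using b c by (auto simp: ww_def w0_def)
  define C0 where "C0 = m0 * (1 + L) + real (card I) * (w0 * ((1 + c) ^ 3 * G))"
  have m00: "0 \<le> m0" by (simp add: m0_def)
  have C00: "0 \<le> C0" unfolding C0_def using m00 L w0 c G by (intro add_nonneg_nonneg mult_nonneg_nonneg) auto
  define C where "C = 5 * (11 * C0)"
  have C0C: "C0 \<le> C" "0 \<le> C" using C00 by (auto simp: C_def)
  show ?thesis
  proof (rule that[OF C0C(2)])
    fix \<sigma> \<kappa> \<xi> :: real assume \<sigma>: "0 < \<sigma>" and \<kappa>: "0 < \<kappa>" and \<xi>: "0 < \<xi>" "\<xi> < len N"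
    define S where "S = {0..\<xi>} \<times> {0..1::real}"
    have clS: "closure (Omega_m \<xi>) = S" using \<xi> by (simp add: Omega_m_def S_def closure_Times)
    have OS: "Omega_m \<xi> \<subseteq> S" by (auto simp: Omega_m_def S_def)
    have opn: "open (Omega_m \<xi>)" by (auto simp: Omega_m_def intro: open_Times)
    have S1: "0 \<le> fst y \<and> fst y < L" if "y \<in> S" for y using that \<xi> by (auto simp: S_def L_def)
    have S2: "fst y + cc j * snd y + rr j < L" if "y \<in> S" for y j
      using arg[of "snd y" "fst y" j] that \<xi> by (auto simp: S_def L_def)
    have wb: "\<bar>\<sigma> * ww i j\<bar> \<le> \<sigma> * w0" for i j using w0 \<sigma> by (simp add: abs_mult)
    have W0: "0 \<le> \<sigma> * w0" using w0 \<sigma> by simp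
    have ccb: "\<bar>cc j\<bar> \<le> c" for j using c by (simp add: cc_def)
    have c0: "0 \<le> c" using c by simp
    define u where "u i y = P.wave (\<kappa> * mm i) I (\<lambda>j. \<sigma> * ww i j) cc rr y" for i y
    define U where "U y = (\<chi> i. u i y)" for y :: "real \<times> real"
    have Ui: "U y $ i = u i y" for y i by (simp add: U_def)
    have bound: "P.wave_bound (card I) (\<sigma> * w0) c (\<kappa> * mm i) \<le> C0 * (\<sigma> + \<kappa>)" for i
    proof -
      have "\<bar>\<kappa> * mm i\<bar> * (1 + L) \<le> (\<kappa> * m0) * (1 + L)"
        using m0[of i] \<kappa> L by (intro mult_right_mono) (auto simp: abs_mult)
      moreover have "real (card I) * (\<sigma> * w0 * ((1 + c) ^ 3 * G)) = \<sigma> * (real (card I) * (w0 * ((1 + c) ^ 3 * G)))"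
        by simp
      moreover have "0 \<le> \<sigma> * (m0 * (1 + L))" "0 \<le> \<kappa> * (real (card I) * (w0 * ((1 + c) ^ 3 * G)))"
        using m00 \<sigma> \<kappa> L w0 c G by simp_all
      ultimately show ?thesis
        unfolding P.wave_bound_def C0_def by (simp add: algebra_simps)
    qed
    have diff: "u i differentiable (at y)" if "y \<in> S" for i y
      unfolding u_def[abs_def]
      by (rule P.wave_differentiable[where S = S and W = "\<sigma> * w0" and cmax = c]) (use wb ccb W0 c0 S1 S2 that in auto)
    have hn: "holder_norm 2 \<alpha> (Omega_m \<xi>) (u i) \<le> ennreal (11 * (C0 * (\<sigma> + \<kappa>)))" for i
    proof -
      have "holder_norm 2 \<alpha> (Omega_m \<xi>) (u i) \<le> ennreal (11 * P.wave_bound (card I) (\<sigma> * w0) c (\<kappa> * mm i))"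
        unfolding u_def[abs_def]
        by (rule P.wave_holder_norm[where W = "\<sigma> * w0" and cmax = c]) (use wb ccb W0 c0 S1 S2 OS opn in auto)
      also have "\<dots> \<le> ennreal (11 * (C0 * (\<sigma> + \<kappa>)))" using bound[of i] by (intro ennreal_leI) simp
      finally show ?thesis .
    qed
    have tr: "C2_bound {0..1} (\<lambda>s. u i (\<xi>, s)) (\<lambda>s. P.wave_d (0, 1) (\<kappa> * mm i) I (\<lambda>j. \<sigma> * ww i j) cc rr (\<xi>, s))
        (\<lambda>s. P.wave_dd (0, 1) (0, 1) I (\<lambda>j. \<sigma> * ww i j) cc rr (\<xi>, s)) (C * (\<sigma> + \<kappa>))" for i
    proof (rule C2_bound_mono)
      show "C2_bound {0..1} (\<lambda>s. u i (\<xi>, s)) (\<lambda>s. P.wave_d (0, 1) (\<kappa> * mm i) I (\<lambda>j. \<sigma> * ww i j) cc rr (\<xi>, s))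
        (\<lambda>s. P.wave_dd (0, 1) (0, 1) I (\<lambda>j. \<sigma> * ww i j) cc rr (\<xi>, s)) (P.wave_bound (card I) (\<sigma> * w0) c (\<kappa> * mm i))"
        unfolding u_def[abs_def]
        by (rule P.wave_trace_C2[where S = S and W = "\<sigma> * w0" and cmax = c]) (use wb ccb W0 c0 S1 S2 \<xi> in \<open>auto simp: S_def\<close>)
      show "P.wave_bound (card I) (\<sigma> * w0) c (\<kappa> * mm i) \<le> C * (\<sigma> + \<kappa>)"
        by (rule order_trans[OF bound]) (use C0C \<sigma> \<kappa> in \<open>auto intro!: mult_right_mono\<close>)
    qed
    have dd: "dir_deriv e (\<lambda>y. U y $ i) y = P.wave_d e (\<kappa> * mm i) I (\<lambda>j. \<sigma> * ww i j) cc rr y"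
      if "y \<in> Omega_m \<xi>" for e i y
      unfolding Ui u_def by (rule dir_deriv_eq, rule P.wave_deriv) (use S2 OS that in auto)
    have n5: "(1::5) \<noteq> 2" "(1::5) \<noteq> 3" "(1::5) \<noteq> 4" "(2::5) \<noteq> 3" "(2::5) \<noteq> 4" "(3::5) \<noteq> 4"
      "(5::5) \<noteq> 1" "(5::5) \<noteq> 2" "(5::5) \<noteq> 3" "(5::5) \<noteq> 4" by simp_all
    note n5' = n5 n5[symmetric]
    have sup: "supersonic_problem N \<sigma> \<kappa> \<xi> U"
      unfolding supersonic_problem_def Let_def V_def[symmetric] clS
    proof (intro conjI ballI)
      show "continuous_on S U"
        unfolding U_def[abs_def]
        by (intro continuous_on_vec_lambda continuous_at_imp_continuous_on ballI differentiable_imp_continuous_within diff)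
      show "U differentiable_on Omega_m \<xi>"
        unfolding differentiable_on_def
      proof
        fix y assume y: "y \<in> Omega_m \<xi>"
        have "U differentiable (at y)"
          unfolding differentiable_componentwise_within[of U y UNIV]
          using diff[OF subsetD[OF OS y]] by (auto simp: Basis_vec_def inner_axis Ui)
        then show "U differentiable (at y within Omega_m \<xi>)" by (rule differentiable_at_withinI)
      qed
    next
      fix y assume y: "y \<in> Omega_m \<xi>"
      \<comment> \<open>these two identities hold for each wave and use \<open>c\<^sup>2 = b q\<close>\<close>
      have e1: "\<sigma> * ww 1 j * (cc j * z) = - q * (\<sigma> * ww 2 j * z)" for j z
        using c b n5' by (auto simp: ww_def cc_def field_simps)
      have e2: "\<sigma> * ww 2 j * (cc j * z) = a * (\<sigma> * ww 1 j * z)" for j z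
        using c b n5' by (auto simp: ww_def cc_def b_def field_simps)
      have e3: "ww 3 j = - ww 1 j" "mm 3 = - mm 1" for j using n5' by (auto simp: ww_def mm_def)
      show "d2 (\<lambda>y. U y $ 1) y + sp V * d1 (\<lambda>y. U y $ 2) y = 0"
        unfolding dd[OF y] P.wave_d_def using n5'
        by (simp add: e1 mm_def q_def[symmetric] sum_distrib_left[symmetric] sum_negf)
      show "d2 (\<lambda>y. U y $ 2) y - acoef N V * d1 (\<lambda>y. U y $ 1) y = \<kappa> * f1 N V"
        unfolding dd[OF y] P.wave_d_def a_def[symmetric] using n5' b
        by (simp add: e2 mm_def b_def sum_distrib_left[symmetric] distrib_left right_diff_distrib)
      show "rho N V * sp V * d1 (\<lambda>y. U y $ 3) y + d1 (\<lambda>y. U y $ 1) y = 0"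
        unfolding dd[OF y] P.wave_d_def V(3) by (simp add: e3 sum_negf)
      show "d1 (\<lambda>y. U y $ 4) y = \<kappa> * f4 N V"
        unfolding dd[OF y] P.wave_d_def using n5' by (simp add: mm_def ww_def)
      show "d1 (\<lambda>y. U y $ 5) y = - \<kappa> * f5 N V"
        unfolding dd[OF y] P.wave_d_def using n5' by (simp add: mm_def ww_def)
    next
      fix s :: real assume s: "s \<in> {0<..<1}"
      have "g (0 + cc j * s + rr j) = 0" for j
        using arg[of s 0 j] s \<Theta>(2) by (auto simp: g_def zero_extension_def)
      then show "U (0, s) = 0"
        unfolding vec_eq_iff Ui u_def P.wave_def by simp
    next
      fix x assume x: "x \<in> {0<..<\<xi>}"
      show "U (x, 0) $ 2 = 0"
        unfolding Ui u_def P.wave_def sumI using n5' by (simp add: mm_def ww_def rr_def)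
      have "(\<Sum>j\<in>I. \<sigma> * ww 2 j * g (x + cc j * 1 + rr j)) = (\<Sum>k<n. \<sigma> * g (x - 2 * c * real k) - \<sigma> * g (x - 2 * c * real (Suc k)))"
        unfolding sumI using n5' by (intro sum.cong) (auto simp: ww_def cc_def rr_def algebra_simps)
      also have "\<dots> = \<sigma> * g (x - 2 * c * real 0) - \<sigma> * g (x - 2 * c * real n)"
        by (rule sum_lessThan_telescope')
      also have "g (x - 2 * c * real n) = 0"
        using n x \<xi> by (simp add: g_def zero_extension_def L_def algebra_simps)
      finally show "U (x, 1) $ 2 = \<sigma> * Theta N x"
        unfolding Ui u_def P.wave_def using n5' x by (simp add: mm_def g_def zero_extension_def)
    qed
    have nm: "norm_m \<alpha> \<xi> U \<le> ennreal (C * (\<sigma> + \<kappa>))"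
    proof -
      have "norm_m \<alpha> \<xi> U \<le> of_nat (card (UNIV :: 5 set)) * ennreal (11 * (C0 * (\<sigma> + \<kappa>)))"
        unfolding norm_m_def Ui by (rule sum_bounded_above) (rule hn)
      also have "\<dots> = ennreal (C * (\<sigma> + \<kappa>))"
        using C00 \<sigma> \<kappa> by (simp add: C_def ennreal_mult' mult.assoc)
      finally show ?thesis .
    qed
    have comp: "sp (U (\<xi>, s)) = - pr (U (\<xi>, s)) \<and> en (U (\<xi>, s)) = \<kappa> * f4 N V * \<xi> \<and> mf (U (\<xi>, s)) = - \<kappa> * f5 N V * \<xi>" for s
      unfolding Ui u_def P.wave_def using n5' by (simp add: mm_def ww_def sum_negf)
    \<comment> \<open>dividing by the slope \<open>cc j\<close> integrates each wave along the shock\<close>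
    have "((\<lambda>s. \<Sum>j\<in>I. g (\<xi> + cc j * s + rr j)) has_integral
        (\<Sum>j\<in>I. Gi (\<xi> + cc j * 1 + rr j) / cc j) - (\<Sum>j\<in>I. Gi (\<xi> + cc j * 0 + rr j) / cc j)) {0..1}"
    proof (rule fundamental_theorem_of_calculus)
      fix s :: real assume s: "s \<in> {0..1}"
      have "((\<lambda>s. Gi (\<xi> + cc j * s + rr j) / cc j) has_real_derivative g (\<xi> + cc j * s + rr j)) (at s within {0..1})" for j
      proof -
        have "cc j \<noteq> 0" using c by (simp add: cc_def)
        moreover have "((\<lambda>s. Gi (\<xi> + cc j * s + rr j)) has_real_derivative g (\<xi> + cc j * s + rr j) * cc j) (at s within {0..1})"
          by (rule DERIV_chain2[where f = Gi, OF Gid])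
             (use arg[of s \<xi> j] s \<xi> in \<open>auto intro!: derivative_eq_intros simp: L_def\<close>)
        ultimately show ?thesis using DERIV_cdivide[of _ "g (\<xi> + cc j * s + rr j) * cc j" s "{0..1}" "cc j"] by simp
      qed
      then have "((\<lambda>s. \<Sum>j\<in>I. Gi (\<xi> + cc j * s + rr j) / cc j) has_real_derivative (\<Sum>j\<in>I. g (\<xi> + cc j * s + rr j))) (at s within {0..1})"
        by (intro DERIV_sum)
      then show "((\<lambda>s. \<Sum>j\<in>I. Gi (\<xi> + cc j * s + rr j) / cc j) has_vector_derivative (\<Sum>j\<in>I. g (\<xi> + cc j * s + rr j))) (at s within {0..1})"
        by (simp add: has_real_derivative_iff_has_vector_derivative)
    qed simp
    moreover have "(\<Sum>j\<in>I. Gi (\<xi> + cc j * 1 + rr j) / cc j) - (\<Sum>j\<in>I. Gi (\<xi> + cc j * 0 + rr j) / cc j) = Gi \<xi> / c"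
    proof -
      have "(\<Sum>j\<in>I. Gi (\<xi> + cc j * 1 + rr j) / cc j) - (\<Sum>j\<in>I. Gi (\<xi> + cc j * 0 + rr j) / cc j) =
         (\<Sum>k<n. Gi (\<xi> - 2 * c * real k) / c - Gi (\<xi> - 2 * c * real (Suc k)) / c)"
        unfolding sumI sum_subtractf[symmetric] by (intro sum.cong) (auto simp: cc_def rr_def algebra_simps)
      also have "\<dots> = Gi (\<xi> - 2 * c * real 0) / c - Gi (\<xi> - 2 * c * real n) / c"
        by (rule sum_lessThan_telescope')
      also have "Gi (\<xi> - 2 * c * real n) = 0"
        using n \<xi> by (simp add: Gi_def zero_extension_def L_def algebra_simps)
      finally show ?thesis by simp
    qed
    ultimately have hi: "((\<lambda>s. \<Sum>j\<in>I. g (\<xi> + cc j * s + rr j)) has_integral Gi \<xi> / c) {0..1}" by simp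
    have "((\<lambda>s. A + k * (\<Sum>j\<in>I. g (\<xi> + cc j * s + rr j))) has_integral A + k * (Gi \<xi> / c)) {0..1}" for A k
      using has_integral_add[OF has_integral_const_real[of A 0 1] has_integral_mult_right[OF hi, of k]] by simp
    note this[of "\<kappa> * mm 1 * \<xi>" "\<sigma> * - (c / b)"]
    moreover have "pr (U (\<xi>, s)) = \<kappa> * mm 1 * \<xi> + (\<sigma> * - (c / b)) * (\<Sum>j\<in>I. g (\<xi> + cc j * s + rr j))" for s
      unfolding Ui u_def P.wave_def by (simp add: ww_def sum_distrib_left)
    ultimately have "integral {0..1} (\<lambda>s. pr (U (\<xi>, s))) = \<kappa> * mm 1 * \<xi> + (\<sigma> * - (c / b)) * (Gi \<xi> / c)"
      by (simp add: integral_unique)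
    then have int: "acoef N V * integral {0..1} (\<lambda>s. pr (U (\<xi>, s))) = \<sigma> * integral {0..\<xi>} (Theta N) - \<kappa> * f1 N V * \<xi>"
      unfolding a_def[symmetric] using \<xi> b c by (simp add: mm_def Gi_def zero_extension_def b_def field_simps)
    show "\<exists>U p' p'' \<theta>' \<theta>''. supersonic_problem N \<sigma> \<kappa> \<xi> U \<and> norm_m \<alpha> \<xi> U \<le> ennreal (C * (\<sigma> + \<kappa>)) \<and>
         C2_bound {0..1} (\<lambda>s. pr (U (\<xi>, s))) p' p'' (C * (\<sigma> + \<kappa>)) \<and>
         C2_bound {0..1} (\<lambda>s. th (U (\<xi>, s))) \<theta>' \<theta>'' (C * (\<sigma> + \<kappa>)) \<and>
         (\<forall>s. sp (U (\<xi>, s)) = - pr (U (\<xi>, s)) \<and> en (U (\<xi>, s)) = \<kappa> * f4 N (bgm N) * \<xi> \<and>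
            mf (U (\<xi>, s)) = - \<kappa> * f5 N (bgm N) * \<xi>) \<and>
         acoef N (bgm N) * integral {0..1} (\<lambda>s. pr (U (\<xi>, s))) =
           \<sigma> * integral {0..\<xi>} (Theta N) - \<kappa> * f1 N (bgm N) * \<xi>"
      using sup nm tr[of 1, folded Ui] tr[of 2, folded Ui] comp int unfolding V_def by blast
  qed
qed

section \<open>Linearized shock relations\<close>

lemma grad_inner:
  fixes f :: "real ^ 'n \<Rightarrow> real"
  assumes "(f has_derivative f') (at x)"
  shows "grad f x \<bullet> v = f' v"
proof -
  have lin: "linear f'" using assms by (rule has_derivative_linear)
  have "grad f x \<bullet> v = (\<Sum>i\<in>UNIV. f' (axis i 1) * v $ i)"
    unfolding grad_def frechet_derivative_at[OF assms, symmetric] by (simp add: inner_vec_def)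
  also have "\<dots> = f' (\<Sum>i\<in>UNIV. v $ i *\<^sub>R axis i 1)"
    by (simp add: linear_sum[OF lin] linear_scale[OF lin] mult.commute)
  also have "(\<Sum>i\<in>UNIV. v $ i *\<^sub>R axis i 1) = v"
    using basis_expansion[of v] by (simp add: scalar_mult_eq_scaleR)
  finally show ?thesis .
qed

lemma component_has_derivative: "((\<lambda>U. U $ i) has_derivative (\<lambda>h. h $ i)) (at (V :: real ^ 'n))"
  by (rule bounded_linear_imp_has_derivative[OF bounded_linear_vec_nth])

lemma rho_has_derivative:
  assumes "gam N > 1" "cv N > 0" "pr V > 0"
  shows "(rho N has_derivative (\<lambda>h. rho N V * (pr h / (gam N * pr V) - en h / (gam N * cv N)))) (at V)"
proof -
  define P where "P = (\<lambda>U. pr U / ((gam N - 1) * exp (en U / cv N)))"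
  have P0: "P V > 0" using assms by (simp add: P_def)
  have "(P has_derivative (\<lambda>h. P V * (pr h / pr V - en h / cv N))) (at V)"
    unfolding P_def
  proof -
    define X where "X = (gam N - 1) * exp (en V / cv N)"
    have X: "X > 0" using assms by (simp add: X_def)
    have "((\<lambda>U. exp (en U / cv N)) has_derivative (\<lambda>h. en h / cv N * exp (en V / cv N))) (at V)"
    proof -
      have "(exp has_derivative (\<lambda>h. h * exp (en V / cv N))) (at (en V / cv N))"
        using DERIV_exp[of "en V / cv N"] by (simp add: has_field_derivative_def mult_commute_abs)
      from has_derivative_compose[OF bounded_linear.has_derivative[OF bounded_linear_divide component_has_derivative] this]
      show ?thesis .
    qed
    from has_derivative_divide[OF component_has_derivative has_derivative_mult_right[OF this, of "gam N - 1"], of 1]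
    have "((\<lambda>U. pr U / ((gam N - 1) * exp (en U / cv N))) has_derivative
      (\<lambda>h. - pr V * (inverse X * ((gam N - 1) * (en h / cv N * exp (en V / cv N))) * inverse X) + pr h / X)) (at V)"
      using assms(1) by (simp add: X_def)
    moreover have "- pr V * (inverse X * ((gam N - 1) * (en h / cv N * exp (en V / cv N))) * inverse X) + pr h / X =
      pr V / X * (pr h / pr V - en h / cv N)" for h
    proof -
      have 1: "(gam N - 1) * (en h / cv N * exp (en V / cv N)) = X * (en h / cv N)" by (simp add: X_def)
      show ?thesis unfolding 1 using X assms by (simp add: field_simps)
    qed
    ultimately show "((\<lambda>U. pr U / ((gam N - 1) * exp (en U / cv N))) has_derivative
       (\<lambda>h. pr V / ((gam N - 1) * exp (en V / cv N)) * (pr h / pr V - en h / cv N))) (at V)"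
      by (simp add: X_def)
  qed
  then have "((\<lambda>U. P U powr (1 / gam N)) has_derivative
     (\<lambda>h. P V powr (1 / gam N) * (0 * ln (P V) + (P V * (pr h / pr V - en h / cv N)) * (1 / gam N) / P V))) (at V)"
    by (intro has_derivative_powr has_derivative_const) (use P0 in auto)
  moreover have "P V powr (1 / gam N) * (0 * ln (P V) + (P V * (pr h / pr V - en h / cv N)) * (1 / gam N) / P V) =
     rho N V * (pr h / (gam N * pr V) - en h / (gam N * cv N))" for h
  proof -
    have "rho N V = P V powr (1 / gam N)" by (simp add: rho_def P_def)
    then show ?thesis using P0 assms by (simp add: diff_divide_distrib mult.commute)
  qed
  ultimately show ?thesis by (simp add: rho_def[abs_def] P_def)
qed

lemma u_has_derivative:
  assumes "th V = 0"
  shows "(u1 has_derivative (\<lambda>h. sp h)) (at V)" "(u2 has_derivative (\<lambda>h. sp V * th h)) (at V)"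
  unfolding u1_def[abs_def] u2_def[abs_def]
  by (rule derivative_eq_intros component_has_derivative refl | use assms in simp)+

text \<open>
  The differential of the mass flux \<open>\<rho> u\<^sub>1\<close> at \<open>V\<close>, simplified with \<open>\<rho> q = 1\<close>.
\<close>

definition flux_deriv :: "nozzle \<Rightarrow> state \<Rightarrow> state \<Rightarrow> real" where
  "flux_deriv N V h = sp h / sp V + pr h / (gam N * pr V) - en h / (gam N * cv N)"

context
  fixes N :: nozzle and V :: state
  assumes gam: "gam N > 1" and cv: "cv N > 0" and p: "pr V > 0" and t: "th V = 0" and m: "rho N V * sp V = 1"
begin

lemma mass_flux_has_derivative:
  "((\<lambda>U. rho N U * u1 U) has_derivative flux_deriv N V) (at V)"
proof -
  note bs = background_state(1-3)[OF gam p m]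
  have "((\<lambda>U. rho N U * u1 U) has_derivative
     (\<lambda>h. rho N V * sp h + (rho N V * (pr h / (gam N * pr V) - en h / (gam N * cv N))) * u1 V)) (at V)"
    by (intro has_derivative_mult rho_has_derivative[OF gam cv p] u_has_derivative(1)[OF t])
  moreover have "rho N V * sp h + (rho N V * (pr h / (gam N * pr V) - en h / (gam N * cv N))) * u1 V = flux_deriv N V h" for h
    using bs t by (simp add: u1_def flux_deriv_def)
  ultimately show ?thesis by (simp add: fun_eq_iff flux_deriv_def[abs_def])
qed

lemma mass_flux_at: "rho N V * u1 V = 1" "u1 V = sp V" "u2 V = 0"
  using t m by (simp_all add: u1_def u2_def)

lemma inverse_flux_has_derivative:
  "((\<lambda>U. 1 / (rho N U * u1 U)) has_derivative (\<lambda>h. - flux_deriv N V h)) (at V)"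
proof -
  have "((\<lambda>U. 1 / (rho N U * u1 U)) has_derivative
     (\<lambda>h. - 1 * (inverse (rho N V * u1 V) * flux_deriv N V h * inverse (rho N V * u1 V)) + 0 / (rho N V * u1 V))) (at V)"
    by (rule has_derivative_divide[OF has_derivative_const mass_flux_has_derivative]) (simp only: mass_flux_at(1))
  then show ?thesis unfolding mass_flux_at(1) by simp
qed

lemma momentum_has_derivative:
  "((\<lambda>U. u1 U + pr U / (rho N U * u1 U)) has_derivative (\<lambda>h. sp h + pr h - pr V * flux_deriv N V h)) (at V)"
proof -
  have "((\<lambda>U. u1 U + pr U * (1 / (rho N U * u1 U))) has_derivative
     (\<lambda>h. sp h + (pr V * - flux_deriv N V h + pr h * (1 / (rho N V * u1 V))))) (at V)"
    by (intro has_derivative_add has_derivative_mult component_has_derivative inverse_flux_has_derivative u_has_derivative(1)[OF t])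
  moreover have "(\<lambda>h. sp h + (pr V * - flux_deriv N V h + pr h * (1 / (rho N V * u1 V)))) =
      (\<lambda>h. sp h + pr h - pr V * flux_deriv N V h)"
    unfolding mass_flux_at(1) by (simp add: fun_eq_iff)
  ultimately show ?thesis by simp
qed

lemma slope_has_derivative:
  obtains D where "((\<lambda>U. u2 U / u1 U) has_derivative D) (at V)"
proof -
  have "u1 V \<noteq> 0" using mass_flux_at(2) background_state(2)[OF gam p m] by simp
  from has_derivative_divide[OF u_has_derivative(2)[OF t] u_has_derivative(1)[OF t] this] show thesis by (rule that)
qed

lemma pressure_slope_has_derivative:
  obtains D where "((\<lambda>U. pr U * u2 U / u1 U) has_derivative D) (at V)"
proof -
  have "u1 V \<noteq> 0" using mass_flux_at(2) background_state(2)[OF gam p m] by simp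
  from has_derivative_divide[OF has_derivative_mult[OF component_has_derivative u_has_derivative(2)[OF t]] u_has_derivative(1)[OF t] this]
  show thesis by (rule that)
qed

lemma bernoulli_has_derivative:
  "(bernoulli N has_derivative (\<lambda>h. sp V * (sp h + pr h) + temp N V * en h)) (at V)"
proof -
  note bs = background_state(1-3)[OF gam p m]
  have "((\<lambda>U. (sp U)\<^sup>2 / 2 + gam N / (gam N - 1) * (pr U / rho N U)) has_derivative
    (\<lambda>h. sp V * sp h + gam N / (gam N - 1) *
       (- pr V * (inverse (rho N V) * (rho N V * (pr h / (gam N * pr V) - en h / (gam N * cv N))) * inverse (rho N V)) + pr h / rho N V))) (at V)"
    by (intro has_derivative_add has_derivative_mult_right has_derivative_divide component_has_derivative rho_has_derivative[OF gam cv p])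
       (use bs in \<open>auto intro!: derivative_eq_intros component_has_derivative\<close>)
  moreover have "sp V * sp h + gam N / (gam N - 1) *
       (- pr V * (inverse (rho N V) * (rho N V * (pr h / (gam N * pr V) - en h / (gam N * cv N))) * inverse (rho N V)) + pr h / rho N V) =
       sp V * (sp h + pr h) + temp N V * en h" for h
  proof -
    have q: "sp V > 0" by (rule bs(2))
    have "- pr V * (inverse (rho N V) * (rho N V * (pr h / (gam N * pr V) - en h / (gam N * cv N))) * inverse (rho N V)) + pr h / rho N V =
       sp V * ((1 - 1 / gam N) * pr h + pr V * en h / (gam N * cv N))"
      using q p gam cv unfolding bs(3) by (simp add: field_simps)
    also have "gam N / (gam N - 1) * \<dots> = sp V * (pr h + pr V / ((gam N - 1) * cv N) * en h)"
    proof -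
      have 1: "gam N / (gam N - 1) * (1 - 1 / gam N) = 1" using gam by (simp add: field_simps)
      have 2: "gam N / (gam N - 1) * (pr V * en h / (gam N * cv N)) = pr V / ((gam N - 1) * cv N) * en h"
        using gam by simp
      have "k * (s * (x * y + z)) = s * ((k * x) * y + k * z)" for k s x y z :: real
        by (simp add: algebra_simps)
      from this[of "gam N / (gam N - 1)" "sp V" "1 - 1 / gam N" "pr h" "pr V * en h / (gam N * cv N)"]
      show ?thesis unfolding 1 2 mult_1_left .
    qed
    also have "\<dots> = sp V * pr h + temp N V * en h"
      unfolding temp_def bs(3) by (simp add: distrib_left mult.commute)
    finally show ?thesis by (simp add: distrib_left)
  qed
  moreover have "(\<lambda>U. (sp U)\<^sup>2 / 2 + gam N / (gam N - 1) * (pr U / rho N U)) = bernoulli N"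
    by (simp add: fun_eq_iff bernoulli_def)
  ultimately show ?thesis by simp
qed

end

text \<open>
  All jumps but that of the pressure vanish at the background, so only the differential of \<open>[A]\<close> survives, times
  the jump of the pressure.
\<close>

lemma lin_jump_product:
  assumes G: "\<And>X Y. G X Y = (A X - A Y) * (pr X - pr Y) + (B X - B Y) * (D X - D Y)"
    and eq: "A V = A W" "B V = B W" "D V = D W" and VW: "V = bgp N" "W = bgm N"
    and A: "(A has_derivative A1) (at V)" "(A has_derivative A2) (at W)"
    and B: "(B has_derivative B1) (at V)" "(B has_derivative B2) (at W)"
    and D: "(D has_derivative D1) (at V)" "(D has_derivative D2) (at W)"
  shows "lin_jump N G v w = (A1 v - A2 w) * (pr V - pr W)"
proof -
  have "((\<lambda>X. G X W) has_derivative (\<lambda>h. (A V - A W) * (pr h - 0) + (A1 h - 0) * (pr V - pr W) +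
      ((B V - B W) * (D1 h - 0) + (B1 h - 0) * (D V - D W)))) (at V)"
    unfolding G by (intro has_derivative_add has_derivative_mult has_derivative_diff has_derivative_const A B D component_has_derivative)
  from grad_inner[OF this] have 1: "grad (\<lambda>X. G X W) V \<bullet> v = A1 v * (pr V - pr W)" by (simp add: eq)
  have "((\<lambda>Y. G V Y) has_derivative (\<lambda>h. (A V - A W) * (0 - pr h) + (0 - A2 h) * (pr V - pr W) +
      ((B V - B W) * (0 - D2 h) + (0 - B2 h) * (D V - D W)))) (at W)"
    unfolding G by (intro has_derivative_add has_derivative_mult has_derivative_diff has_derivative_const A B D component_has_derivative)
  from grad_inner[OF this] have 2: "grad (\<lambda>Y. G V Y) W \<bullet> w = - A2 w * (pr V - pr W)" by (simp add: eq)
  show ?thesis unfolding lin_jump_def VW[symmetric] 1 2 by (simp add: algebra_simps)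
qed

lemma lin_jump_jump:
  assumes G: "\<And>X Y. G X Y = A X - A Y" and A: "(A has_derivative A1) (at (bgp N))" "(A has_derivative A2) (at (bgm N))"
  shows "lin_jump N G v w = A1 v - A2 w"
proof -
  have "((\<lambda>X. G X (bgm N)) has_derivative (\<lambda>h. A1 h - 0)) (at (bgp N))"
    unfolding G by (intro has_derivative_diff has_derivative_const A)
  note 1 = grad_inner[OF this]
  have "((\<lambda>Y. G (bgp N) Y) has_derivative (\<lambda>h. 0 - A2 h)) (at (bgm N))"
    unfolding G by (intro has_derivative_diff has_derivative_const A)
  note 2 = grad_inner[OF this]
  show ?thesis unfolding lin_jump_def 1 2 by simp
qed

text \<open>
  Equal pressures would mean equal speeds, by conservation of momentum with unit mass flux, and then the flow could
  not be subsonic on one side and supersonic on the other.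
\<close>

lemma background_jump_nonzero:
  assumes "gas N" "background N"
  shows "pr (bgp N) \<noteq> pr (bgm N)"
proof
  assume eq: "pr (bgp N) = pr (bgm N)"
  let ?V = "bgp N" and ?W = "bgm N"
  have gam: "gam N > 1" using assms by (simp add: gas_def)
  have V: "pr ?V > 0" "rho N ?V * sp ?V = 1" "mach N ?V < 1" and W: "pr ?W > 0" "rho N ?W * sp ?W = 1" "mach N ?W > 1"
    and mom: "rho N ?W * (sp ?W)\<^sup>2 + pr ?W = rho N ?V * (sp ?V)\<^sup>2 + pr ?V"
    using assms by (simp_all add: background_def)
  have "rho N ?W * (sp ?W)\<^sup>2 = sp ?W" "rho N ?V * (sp ?V)\<^sup>2 = sp ?V"
    using V(2) W(2) by (simp_all add: power2_eq_square mult.assoc[symmetric])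
  then have "sp ?V = sp ?W" using mom eq by simp
  then have "acoef N ?V = acoef N ?W"
    using background_state(4)[OF gam V(1,2)] background_state(4)[OF gam W(1,2)] eq by simp
  then show False
    using background_state(5)[OF gam V(1,2,3)] background_state(6)[OF gam W] by simp
qed

text \<open>
  Let \<open>\<mu>\<close> be the perturbation of the mass flux ahead of the shock.  The first relation says that it is the same
  behind the shock, the second that \<open>[dq + dp] = [p] \<mu>\<close>, and the third equates the perturbations
  \<open>q (dq + dp) + T dS\<close> of the Bernoulli function.  As \<open>dq + dp = 0\<close> ahead of the shock, these give speed and entropy
  behind it, and with them the flux equation becomes an equation for the pressure; there the factor \<open>1 - K1\<close> arises.
\<close>

lemma linearized_shock_relations:
  fixes v w :: state
  assumes gas: "gas N" and bg: "background N"
  defines "V \<equiv> bgp N" and "W \<equiv> bgm N"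
  defines "\<mu> \<equiv> - acoef N W * pr w - en w / (gam N * cv N)"
  assumes w: "sp w = - pr w"
    and pv: "acoef N V * pr v = (1 - K1 N) * (acoef N W * pr w + en w / (gam N * cv N)) -
       temp N W * en w / (temp N V * gam N * cv N)"
    and sv: "sp v = (pr V - pr W) * \<mu> - pr v"
    and ev: "en v = (temp N W * en w - sp V * (pr V - pr W) * \<mu>) / temp N V"
    and zv: "mf v = mf w"
  shows "lin_jump N (G1 N) v w = 0" "lin_jump N (G2 N) v w = 0" "lin_jump N (G3 N) v w = 0" "lin_jump N G4 v w = 0"
    and "lin_jump N (G5 0) v w = sp V * th v - sp W * th w"
proof -
  have gam: "gam N > 1" and cv: "cv N > 0" using gas by (simp_all add: gas_def)
  have V: "pr V > 0" "th V = 0" "rho N V * sp V = 1" and W: "pr W > 0" "th W = 0" "rho N W * sp W = 1"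
    and mom: "rho N W * (sp W)\<^sup>2 + pr W = rho N V * (sp V)\<^sup>2 + pr V"
    using bg by (simp_all add: background_def V_def W_def)
  note bV = background_state[OF gam V(1,3)] and bW = background_state[OF gam W(1,3)]
  note ctV = gam cv V and ctW = gam cv W
  have rq: "rho N W * (sp W)\<^sup>2 = sp W" "rho N V * (sp V)\<^sup>2 = sp V"
    using V(3) W(3) by (simp_all add: power2_eq_square mult.assoc[symmetric])
  have TV: "temp N V = pr V * sp V / ((gam N - 1) * cv N)"
    unfolding temp_def bV(3) by simp
  have TV0: "temp N V > 0" unfolding TV using V bV(2) gam cv by simp
  have mW: "flux_deriv N W w = \<mu>"
    unfolding flux_deriv_def \<mu>_def w bW(4) by (simp add: algebra_simps)
  have mV: "flux_deriv N V v = \<mu>"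
  proof -
    define T where "T = temp N W * en w / (temp N V * gam N * cv N)"
    have T1: "en v / (gam N * cv N) = T - sp V * (pr V - pr W) * \<mu> / (temp N V * gam N * cv N)"
      unfolding ev T_def by (simp add: diff_divide_distrib mult.assoc)
    have T2: "sp V / (temp N V * gam N * cv N) = (gam N - 1) / (gam N * pr V)"
      unfolding TV using V bV(2) gam cv by (simp add: field_simps)
    have K1: "K1 N = (pr V - pr W) * ((gam N - 1) / (gam N * pr V) + 1 / sp V)"
      unfolding K1_def V_def[symmetric] W_def[symmetric] rq ..
    have "flux_deriv N V v = (pr V - pr W) * \<mu> / sp V - acoef N V * pr v - en v / (gam N * cv N)"
      unfolding flux_deriv_def sv bV(4) by (simp add: algebra_simps diff_divide_distrib add_divide_distrib)
    also have "acoef N V * pr v = - (1 - K1 N) * \<mu> - T"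
      unfolding pv T_def \<mu>_def by (simp add: algebra_simps diff_divide_distrib)
    also have "en v / (gam N * cv N) = T - (pr V - pr W) * \<mu> * ((gam N - 1) / (gam N * pr V))"
      unfolding T1 T2[symmetric] by (simp add: mult_ac)
    finally show ?thesis unfolding K1 by (simp add: algebra_simps)
  qed
  note at = mass_flux_at[OF ctV] mass_flux_at[OF ctW]
  obtain D1 where D1: "((\<lambda>U. u2 U / u1 U) has_derivative D1) (at V)" using slope_has_derivative[OF ctV] .
  obtain D2 where D2: "((\<lambda>U. u2 U / u1 U) has_derivative D2) (at W)" using slope_has_derivative[OF ctW] .
  obtain E1 where E1: "((\<lambda>U. pr U * u2 U / u1 U) has_derivative E1) (at V)" using pressure_slope_has_derivative[OF ctV] .
  obtain E2 where E2: "((\<lambda>U. pr U * u2 U / u1 U) has_derivative E2) (at W)" using pressure_slope_has_derivative[OF ctW] .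
  have VW: "V = bgp N" "W = bgm N" by (simp_all add: V_def W_def)
  have "lin_jump N (G1 N) v w = (- flux_deriv N V v - - flux_deriv N W w) * (pr V - pr W)"
  proof (rule lin_jump_product[OF _ _ _ _ VW inverse_flux_has_derivative[OF ctV] inverse_flux_has_derivative[OF ctW]
        D1 D2 u_has_derivative(2)[OF V(2)] u_has_derivative(2)[OF W(2)]])
    show "G1 N X Y = (1 / (rho N X * u1 X) - 1 / (rho N Y * u1 Y)) * (pr X - pr Y) + (u2 X / u1 X - u2 Y / u1 Y) * (u2 X - u2 Y)" for X Y
      by (simp add: G1_def jump_def)
  qed (simp_all only: at V(3) W(3))
  then show "lin_jump N (G1 N) v w = 0" by (simp add: mV mW)
  have "lin_jump N (G2 N) v w = ((sp v + pr v - pr V * flux_deriv N V v) - (sp w + pr w - pr W * flux_deriv N W w)) * (pr V - pr W)"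
  proof (rule lin_jump_product[OF _ _ _ _ VW momentum_has_derivative[OF ctV] momentum_has_derivative[OF ctW]
        E1 E2 u_has_derivative(2)[OF V(2)] u_has_derivative(2)[OF W(2)]])
    show "G2 N X Y = (u1 X + pr X / (rho N X * u1 X) - (u1 Y + pr Y / (rho N Y * u1 Y))) * (pr X - pr Y) +
        (pr X * u2 X / u1 X - pr Y * u2 Y / u1 Y) * (u2 X - u2 Y)" for X Y
      by (simp add: G2_def jump_def)
    show "u1 V + pr V / (rho N V * u1 V) = u1 W + pr W / (rho N W * u1 W)"
      unfolding at V(3) W(3) using mom rq by simp
  qed (simp_all add: at V(3) W(3))
  then show "lin_jump N (G2 N) v w = 0" unfolding mV mW sv w by (simp add: algebra_simps)
  have "lin_jump N (G3 N) v w = (sp V * (sp v + pr v) + temp N V * en v) - (sp W * (sp w + pr w) + temp N W * en w)"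
    by (rule lin_jump_jump[where A = "bernoulli N"])
       (auto simp: G3_def jump_def V_def[symmetric] W_def[symmetric] intro!: bernoulli_has_derivative ctV ctW)
  then show "lin_jump N (G3 N) v w = 0" unfolding sv ev w using TV0 by simp
  have "lin_jump N G4 v w = mf v - mf w"
    by (rule lin_jump_jump[where A = mf]) (auto simp: G4_def jump_def intro!: component_has_derivative)
  then show "lin_jump N G4 v w = 0" using zv by simp
  show "lin_jump N (G5 0) v w = sp V * th v - sp W * th w"
    by (rule lin_jump_jump[where A = u2])
       (auto simp: G5_def jump_def V_def[symmetric] W_def[symmetric] intro!: u_has_derivative V W)
qed

section \<open>Traces, Sobolev norms and solvability\<close>

text \<open>
  For \<open>e = 1 / (2 \<beta>)\<close> this is sufficient for membership in the trace space on the shock.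
\<close>

definition holder_trace :: "real \<Rightarrow> real \<Rightarrow> (real \<Rightarrow> real) \<Rightarrow> bool" where
  "holder_trace e M h \<longleftrightarrow>
     (\<forall>s\<in>{0..1}. \<bar>h s\<bar> \<le> M) \<and> (\<forall>s\<in>{0..1}. \<forall>t\<in>{0..1}. \<bar>h s - h t\<bar> \<le> M * \<bar>s - t\<bar> powr (1 - e))"

lemma holder_trace_const: "holder_trace e \<bar>c\<bar> (\<lambda>s. c)"
  by (simp add: holder_trace_def)

lemma holder_trace_add:
  assumes "holder_trace e M h" "holder_trace e M' k"
  shows "holder_trace e (M + M') (\<lambda>s. h s + k s)"
  unfolding holder_trace_def
proof (intro conjI ballI)
  fix s t :: real assume s: "s \<in> {0..1}" and t: "t \<in> {0..1}"
  have "\<bar>h s - h t\<bar> \<le> M * \<bar>s - t\<bar> powr (1 - e)" "\<bar>k s - k t\<bar> \<le> M' * \<bar>s - t\<bar> powr (1 - e)"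
    using assms s t by (auto simp: holder_trace_def)
  then show "\<bar>h s + k s - (h t + k t)\<bar> \<le> (M + M') * \<bar>s - t\<bar> powr (1 - e)"
    unfolding distrib_right by linarith
next
  fix s :: real assume s: "s \<in> {0..1}"
  have "\<bar>h s\<bar> \<le> M" "\<bar>k s\<bar> \<le> M'" using assms s by (auto simp: holder_trace_def)
  then show "\<bar>h s + k s\<bar> \<le> M + M'" by linarith
qed

lemma holder_trace_scale:
  assumes "holder_trace e M h"
  shows "holder_trace e (\<bar>c\<bar> * M) (\<lambda>s. c * h s)"
  using assms unfolding holder_trace_def
  by (auto simp: abs_mult mult.assoc right_diff_distrib[symmetric] intro!: mult_left_mono)

lemma holder_trace_mono:
  assumes "holder_trace e M h" "M \<le> M'"
  shows "holder_trace e M' h"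
  unfolding holder_trace_def
proof (intro conjI ballI)
  fix s t :: real assume s: "s \<in> {0..1}" and t: "t \<in> {0..1}"
  have "\<bar>h s - h t\<bar> \<le> M * \<bar>s - t\<bar> powr (1 - e)" using assms s t by (auto simp: holder_trace_def)
  also have "\<dots> \<le> M' * \<bar>s - t\<bar> powr (1 - e)" using assms by (intro mult_right_mono) auto
  finally show "\<bar>h s - h t\<bar> \<le> M' * \<bar>s - t\<bar> powr (1 - e)" .
next
  fix s :: real assume "s \<in> {0..1}"
  then show "\<bar>h s\<bar> \<le> M'" using assms by (auto simp: holder_trace_def intro: order_trans)
qed

lemma holder_trace_C2:
  assumes g: "C2_bound {0..1} g g' g'' B" and e: "0 < e" "e < 1"
  shows "holder_trace e B g"
  unfolding holder_trace_def
proof (intro conjI ballI)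
  fix s t :: real assume s: "s \<in> {0..1}" and t: "t \<in> {0..1}"
  have "norm (g s - g t) \<le> B * norm (s - t)"
    by (rule field_differentiable_bound[where S = "{0..1}" and f' = g'])
       (use g s t in \<open>auto simp: C2_bound_def\<close>)
  also have "norm (s - t) \<le> \<bar>s - t\<bar> powr (1 - e)"
    using le_powr_of_bounded[of "\<bar>s - t\<bar>" 1 e] s t e by auto
  then have "B * norm (s - t) \<le> B * \<bar>s - t\<bar> powr (1 - e)"
    using C2_bound_nonneg[OF g] by (intro mult_left_mono) auto
  finally show "\<bar>g s - g t\<bar> \<le> B * \<bar>s - t\<bar> powr (1 - e)" by simp
qed (use g in \<open>auto simp: C2_bound_def\<close>)

lemma holder_trace_continuous:
  assumes "holder_trace e M h" "e < 1"
  shows "continuous_on {0..1} h"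
  by (rule continuous_on_holder[where M = M and \<alpha> = "1 - e"]) (use assms in \<open>auto simp: holder_trace_def dist_real_def\<close>)

lemma norm_shock_trace:
  assumes "\<beta> > 1" "holder_trace (1 / (2 * \<beta>)) M h"
  shows "norm_shock \<beta> h \<le> ennreal ((1 + 4 powr (1 / \<beta>)) * M)"
proof (rule norm_shock_le)
  have "\<bar>h 0\<bar> \<le> M" using assms(2) by (simp add: holder_trace_def)
  then show "0 \<le> M" by linarith
qed (use assms in \<open>auto simp: holder_trace_def\<close>)

lemma channel_regular_trace:
  assumes "channel_regular x0 x1 e M f fx fy" "x0 \<le> x1" "e < 1"
  shows "holder_trace e M (\<lambda>s. f (x0, s))"
proof -
  have "\<bar>f (x0, s) - f (x0, t)\<bar> \<le> M * (\<bar>x0 - x0\<bar> powr (1 - e) + \<bar>s - t\<bar> powr (1 - e))" if "s \<in> {0..1}" "t \<in> {0..1}" for s t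
    using assms that unfolding channel_regular_def atLeastAtMost_iff by blast
  then show ?thesis using assms by (simp add: holder_trace_def channel_regular_def)
qed

lemma channel_regular_continuous:
  assumes f: "channel_regular x0 x1 e M f fx fy" and e: "e < 1" and M: "0 \<le> M"
  shows "continuous_on ({x0..x1} \<times> {0..1}) f"
proof (rule continuous_on_holder[where M = "2 * M" and \<alpha> = "1 - e"])
  fix y z :: "real \<times> real" assume "y \<in> {x0..x1} \<times> {0..1}" "z \<in> {x0..x1} \<times> {0..1}"
  then have "\<bar>f (fst y, snd y) - f (fst z, snd z)\<bar> \<le>
      M * (\<bar>fst y - fst z\<bar> powr (1 - e) + \<bar>snd y - snd z\<bar> powr (1 - e))"
    using f unfolding channel_regular_def mem_Times_iff atLeastAtMost_iff by blast
  also have "\<dots> \<le> M * (dist y z powr (1 - e) + dist y z powr (1 - e))"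
    using dist_fst_le[of y z] dist_snd_le[of y z] M e
    by (intro mult_left_mono add_mono powr_mono2) (auto simp: dist_real_def)
  finally show "\<bar>f y - f z\<bar> \<le> 2 * M * dist y z powr (1 - e)" by simp
qed (use e in auto)

lemma channel_regular_weak:
  assumes f: "channel_regular x0 x1 e M f fx fy" and e: "e < 1" and M: "0 \<le> M"
  defines "\<Omega> \<equiv> {x0<..<x1} \<times> {0<..<1}"
  shows "continuous_on \<Omega> f" "continuous_on \<Omega> fx" "continuous_on \<Omega> fy"
    and "\<And>y. y \<in> \<Omega> \<Longrightarrow> ((\<lambda>t. f (y + t *\<^sub>R (1, 0))) has_real_derivative fx y) (at 0)"
    and "\<And>y. y \<in> \<Omega> \<Longrightarrow> ((\<lambda>t. f (y + t *\<^sub>R (0, 1))) has_real_derivative fy y) (at 0)"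
proof -
  show "continuous_on \<Omega> f"
    by (rule continuous_on_subset[OF channel_regular_continuous[OF f e M]]) (auto simp: \<Omega>_def)
  show "continuous_on \<Omega> fx" "continuous_on \<Omega> fy" using f by (simp_all add: channel_regular_def \<Omega>_def)
  fix y assume y: "y \<in> \<Omega>"
  have "((\<lambda>x. f (x, snd y)) has_real_derivative fx (fst y, snd y)) (at (fst y))"
       "((\<lambda>s. f (fst y, s)) has_real_derivative fy (fst y, snd y)) (at (snd y))"
    using f y unfolding channel_regular_def \<Omega>_def by auto
  then show "((\<lambda>t. f (y + t *\<^sub>R (1, 0))) has_real_derivative fx y) (at 0)"
    "((\<lambda>t. f (y + t *\<^sub>R (0, 1))) has_real_derivative fy y) (at 0)"
    unfolding partial_derivative_shift[symmetric] by simp_all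
qed

lemma sobolev_norm_channel:
  fixes \<beta> L :: real
  assumes \<beta>: "\<beta> > 1" and L: "L > 0"
  obtains K where "0 \<le> K"
    "\<And>x0 x1 f fx fy M. x0 \<le> x1 \<Longrightarrow> x1 - x0 \<le> L \<Longrightarrow> 0 \<le> M \<Longrightarrow> channel_regular x0 x1 (1 / (2 * \<beta>)) M f fx fy \<Longrightarrow>
       sobolev_norm \<beta> ({x0<..<x1} \<times> {0<..<1}) f \<le> ennreal (K * M)"
proof -
  define e where "e = 1 / (2 * \<beta>)"
  have e: "e < 1" using \<beta> by (simp add: e_def)
  have \<beta>0: "\<beta> > 0" using \<beta> by simp
  obtain K where K0: "0 \<le> K" and K: "\<And>a b f M. a \<le> b \<Longrightarrow> b - a \<le> L \<Longrightarrow> 0 \<le> M \<Longrightarrow> continuous_on ({a<..<b} \<times> {0<..<1}) f \<Longrightarrow>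
       (\<And>y. y \<in> {a<..<b} \<times> {0<..<1} \<Longrightarrow> \<bar>f y\<bar> \<le> M * edge_weight (1 / (2 * \<beta>)) a b y) \<Longrightarrow>
       Lp_norm \<beta> ({a<..<b} \<times> {0<..<1}) f \<le> ennreal (K * M)"
    using Lp_norm_edge_weight[OF \<beta>0 L] by metis
  show ?thesis
  proof (rule that[of "3 * K"])
    show "0 \<le> 3 * K" using K0 by simp
    fix x0 x1 f fx fy M
    assume x: "x0 \<le> x1" "x1 - x0 \<le> L" and M: "0 \<le> M" and f: "channel_regular x0 x1 (1 / (2 * \<beta>)) M f fx fy"
    let ?\<Omega> = "{x0<..<x1} \<times> {0::real<..<1}"
    note f' = f[folded e_def]
    note reg = channel_regular_weak[OF f' e M]
    have o: "open ?\<Omega>" by (intro open_Times) auto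
    have Lf: "Lp_norm \<beta> ?\<Omega> f \<le> ennreal (K * M)"
    proof (rule K[OF x M reg(1)])
      fix y :: "real \<times> real" assume y: "y \<in> ?\<Omega>"
      have "\<bar>f (fst y, snd y)\<bar> \<le> M" using f y unfolding channel_regular_def by auto
      also have "M * 1 \<le> M * edge_weight (1 / (2 * \<beta>)) x0 x1 y" using M edge_weight_ge_1 by (rule mult_left_mono[rotated])
      finally show "\<bar>f y\<bar> \<le> M * edge_weight (1 / (2 * \<beta>)) x0 x1 y" by simp
    qed
    have Lx: "Lp_norm \<beta> ?\<Omega> fx \<le> ennreal (K * M)" and Ly: "Lp_norm \<beta> ?\<Omega> fy \<le> ennreal (K * M)"
      by (rule K[OF x M], use reg in simp, use f in \<open>auto simp: channel_regular_def\<close>)+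
    have wx: "weak_deriv ?\<Omega> (1, 0) f fx"
      by (rule weak_deriv_classical[OF o _ reg(1,2)]) (use reg(4) in \<open>auto simp: Basis_real2\<close>)
    have wy: "weak_deriv ?\<Omega> (0, 1) f fy"
      by (rule weak_deriv_classical[OF o _ reg(1,3)]) (use reg(5) in \<open>auto simp: Basis_real2\<close>)
    have Ix: "(INF g\<in>{g. weak_deriv ?\<Omega> (1, 0) f g}. Lp_norm \<beta> ?\<Omega> g) \<le> ennreal (K * M)"
      by (rule INF_lower2[where i = fx]) (use wx Lx in simp_all)
    have Iy: "(INF g\<in>{g. weak_deriv ?\<Omega> (0, 1) f g}. Lp_norm \<beta> ?\<Omega> g) \<le> ennreal (K * M)"
      by (rule INF_lower2[where i = fy]) (use wy Ly in simp_all)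
    have "sobolev_norm \<beta> ?\<Omega> f \<le> ennreal (K * M) + (ennreal (K * M) + ennreal (K * M))"
      unfolding sobolev_norm_def Basis_real2 using Lf Ix Iy by (simp add: add_mono)
    also have "\<dots> = ennreal (3 * K * M)"
      using K0 M by (simp add: ennreal_plus[symmetric] del: ennreal_plus)
    finally show "sobolev_norm \<beta> ?\<Omega> f \<le> ennreal (3 * K * M)" .
  qed
qed

text \<open>
  The second identity says that the heat gained by the entropy equals the heat lost by the reactant.
\<close>

lemma reaction_coefficients:
  assumes gas: "gas N" and p: "pr V > 0" and m: "rho N V * sp V = 1"
  shows "f4 N V / (gam N * cv N) = f1 N V" "temp N V * f4 N V = qe N * f5 N V" "temp N V > 0"
proof -
  have gam: "gam N > 1" "cv N > 0" using gas by (simp_all add: gas_def)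
  note bs = background_state(1-3)[OF gam(1) p m]
  have r: "rho N V * (sp V)\<^sup>2 = sp V" using m by (simp add: power2_eq_square mult.assoc[symmetric])
  show T: "temp N V > 0" using gam p bs(1) by (simp add: temp_def)
  show "f4 N V / (gam N * cv N) = f1 N V" unfolding f4_def f1_def r by simp
  show "temp N V * f4 N V = qe N * f5 N V" using T by (simp add: f4_def f5_def)
qed

text \<open>
  The contributions of the heat sources behind and ahead of the shock to the solvability equation.
\<close>

lemma K2_eq:
  assumes gas: "gas N" and bg: "background N"
  shows "K2 N = f1 N (bgp N) - temp N (bgm N) / temp N (bgp N) * f1 N (bgm N)"
proof -
  have "temp N (bgm N) > 0" "temp N (bgp N) > 0"
    using reaction_coefficients(3)[OF gas] bg by (auto simp: background_def)
  moreover have "mf (bgp N) = mf (bgm N)" using bg by (simp add: background_def)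
  ultimately show ?thesis unfolding K2_def f1_def by (simp add: right_diff_distrib mult_ac)
qed

text \<open>
  In the first two regimes the equation is part of the definition of \<open>\<xi>\<close>.  In the last two it is a linear
  combination of the equations for the fixed location.
\<close>

lemma matches_imp_solvable:
  assumes bd: "boundary_data \<alpha> N" and \<alpha>: "0 < \<alpha>" and m: "matches N r \<sigma> \<kappa> \<xi>"
  shows "0 < \<xi> \<and> \<xi> < len N \<and> solvability_eq N \<sigma> \<kappa> \<xi>"
proof (cases r)
  case (H3 A \<xi>s)
  obtain P1 P2 Q1 Q2 where P: "C2_holder \<alpha> {0..} (Psig N) P1 P2" "C2_holder \<alpha> {0..} (Pkap N) Q1 Q2"
    using bd unfolding boundary_data_def by blast
  have sub: "{0..1} \<subseteq> {0::real..}" by auto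
  obtain B1 where B1: "C2_bound {0..1} (Psig N) P1 P2 B1" using C2_holder_imp_bound[OF P(1) sub \<alpha>] .
  obtain B2 where B2: "C2_bound {0..1} (Pkap N) Q1 Q2 B2" using C2_holder_imp_bound[OF P(2) sub \<alpha>] .
  note c = C2_bound_continuous[OF B1] C2_bound_continuous[OF B2]
  have "star N (PA N A) = A * star N (Psig N) + star N (Pkap N)"
    unfolding star_def PA_def[abs_def]
    by (subst integral_add) (auto intro!: integrable_continuous_real continuous_intros c simp: algebra_simps)
  then have eq: "A * Rsig N \<xi>s + Rkap N \<xi>s = A * star N (Psig N) + star N (Pkap N)"
    using m H3 by (simp add: RA_def)
  have "solvability_eq N \<sigma> \<kappa> \<xi>"
    using m H3 arg_cong[OF eq, of "\<lambda>x. \<kappa> * x"] by (simp add: solvability_eq_def distrib_left mult_ac)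
  then show ?thesis using m H3 by simp
qed (use m in \<open>auto simp: solvability_eq_def\<close>)

section \<open>Solution of the linearized problem\<close>

text \<open>
  The supersonic flow comes first.  Its pressure and entropy on the shock determine the pressure behind the shock, the
  left boundary value \<open>gl\<close> of the subsonic system.  By the formula for the mean supersonic pressure, the
  compatibility condition of that system is the solvability equation.  Entropy and reactant behind the shock grow
  linearly along streamlines, the speed follows from the Bernoulli function, and the slope of the shock from the fifth
  shock relation.  All data are of size \<open>\<sigma> + \<kappa>\<close>, and so is everything else by linear estimates; the distance of
  the shock from the exit enters only through its lower bound \<open>\<delta>\<close>.
\<close>

lemma linearized_problem_solution:
  fixes \<beta> \<delta> :: real
  assumes gas: "gas N" and bg: "background N" and bd: "boundary_data \<alpha> N" and \<alpha>: "0 < \<alpha>" "\<alpha> < 1"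
    and \<beta>: "\<beta> > 2" and \<delta>: "0 < \<delta>"
  obtains C where "0 \<le> C"
    "\<And>\<sigma> \<kappa> \<xi>. 0 < \<sigma> \<Longrightarrow> 0 < \<kappa> \<Longrightarrow> 0 < \<xi> \<Longrightarrow> \<delta> \<le> len N - \<xi> \<Longrightarrow> solvability_eq N \<sigma> \<kappa> \<xi> \<Longrightarrow>
       \<exists>Um Up \<psi>'. linearized_problem N \<sigma> \<kappa> \<xi> Um Up \<psi>' \<and>
         norm_m \<alpha> \<xi> Um + norm_p N \<beta> \<xi> Up + norm_shock \<beta> \<psi>' \<le> ennreal (C * (\<sigma> + \<kappa>))"
proof -
  define e where "e = 1 / (2 * \<beta>)"
  have e: "0 < e" "e < 1" using \<beta> by (auto simp: e_def field_simps)
  define V where "V = bgp N"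
  define W where "W = bgm N"
  define L where "L = len N"
  have gam: "gam N > 1" and cv: "cv N > 0" and L: "L > 0" using gas by (simp_all add: gas_def L_def)
  have V: "pr V > 0" "rho N V * sp V = 1" "mach N V < 1" and W: "pr W > 0" "rho N W * sp W = 1" "mach N W > 1"
    using bg by (simp_all add: background_def V_def W_def)
  note bV = background_state[OF gam V(1,2)] and bW = background_state[OF gam W(1,2)]
  note rV = reaction_coefficients[OF gas V(1,2)] and rW = reaction_coefficients[OF gas W(1,2)]
  define a where "a = acoef N V"
  define am where "am = acoef N W"
  define q where "q = sp V"
  define J where "J = pr V - pr W"
  define gc where "gc = gam N * cv N"
  have a: "a > 0" using bV(5)[OF V(3)] by (simp add: a_def)
  have q: "q > 0" using bV(2) by (simp add: q_def)
  have J: "J \<noteq> 0" using background_jump_nonzero[OF gas bg] by (simp add: J_def V_def W_def)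
  have gc: "gc > 0" using gam cv by (simp add: gc_def)
  obtain Cs where Cs0: "0 \<le> Cs" and Cs: "\<And>\<sigma> \<kappa> \<xi>. 0 < \<sigma> \<Longrightarrow> 0 < \<kappa> \<Longrightarrow> 0 < \<xi> \<Longrightarrow> \<xi> < len N \<Longrightarrow>
       \<exists>U p' p'' \<theta>' \<theta>''. supersonic_problem N \<sigma> \<kappa> \<xi> U \<and> norm_m \<alpha> \<xi> U \<le> ennreal (Cs * (\<sigma> + \<kappa>)) \<and>
         C2_bound {0..1} (\<lambda>s. pr (U (\<xi>, s))) p' p'' (Cs * (\<sigma> + \<kappa>)) \<and>
         C2_bound {0..1} (\<lambda>s. th (U (\<xi>, s))) \<theta>' \<theta>'' (Cs * (\<sigma> + \<kappa>)) \<and>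
         (\<forall>s. sp (U (\<xi>, s)) = - pr (U (\<xi>, s)) \<and> en (U (\<xi>, s)) = \<kappa> * f4 N (bgm N) * \<xi> \<and>
            mf (U (\<xi>, s)) = - \<kappa> * f5 N (bgm N) * \<xi>) \<and>
         acoef N (bgm N) * integral {0..1} (\<lambda>s. pr (U (\<xi>, s))) =
           \<sigma> * integral {0..\<xi>} (Theta N) - \<kappa> * f1 N (bgm N) * \<xi>"
    using supersonic_exists[OF gas bg bd \<alpha>] by blast
  obtain Kf where Kf0: "0 \<le> Kf" and Kf: "\<And>x0 x1 gl gl' gl'' gr gr' gr'' gt gt' gt'' F B. \<delta> \<le> x1 - x0 \<Longrightarrow> x1 - x0 \<le> L \<Longrightarrow>
       C2_bound {0..1} gl gl' gl'' B \<Longrightarrow> C2_bound {0..1} gr gr' gr'' B \<Longrightarrow> C2_bound {x0..x1} gt gt' gt'' B \<Longrightarrow>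
       integral {x0..x1} gt - a * (integral {0..1} gr - integral {0..1} gl) = F * (x1 - x0) \<Longrightarrow>
       \<exists>p \<theta> px py \<theta>x \<theta>y. channel_flow a q x0 x1 e (Kf * B) F gl gr gt p \<theta> px py \<theta>x \<theta>y"
    using channel_flow_exists[OF a q \<delta> L e] by blast
  have \<beta>1: "\<beta> > 1" using \<beta> by simp
  obtain KL where KL0: "0 \<le> KL" and KL: "\<And>x0 x1 f fx fy M. x0 \<le> x1 \<Longrightarrow> x1 - x0 \<le> L \<Longrightarrow> 0 \<le> M \<Longrightarrow>
       channel_regular x0 x1 (1 / (2 * \<beta>)) M f fx fy \<Longrightarrow>
       sobolev_norm \<beta> ({x0<..<x1} \<times> {0<..<1}) f \<le> ennreal (KL * M)"
    using sobolev_norm_channel[OF \<beta>1 L] by blast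
  obtain \<Theta>1 \<Theta>2 where \<Theta>: "C2_holder \<alpha> {0..L} (Theta N) \<Theta>1 \<Theta>2"
    using bd unfolding boundary_data_def L_def by blast
  obtain P1 P2 Q1 Q2 where P: "C2_holder \<alpha> {0..} (Psig N) P1 P2" "C2_holder \<alpha> {0..} (Pkap N) Q1 Q2"
    using bd unfolding boundary_data_def by blast
  have sub: "{0..1} \<subseteq> {0::real..}" by auto
  obtain Bt where Bt: "0 \<le> Bt" "C2_bound {0..L} (Theta N) \<Theta>1 \<Theta>2 Bt" using C2_holder_imp_bound[OF \<Theta> order_refl \<alpha>(1)] .
  obtain Bs where Bs: "0 \<le> Bs" "C2_bound {0..1} (Psig N) P1 P2 Bs" using C2_holder_imp_bound[OF P(1) sub \<alpha>(1)] .
  obtain Bk where Bk: "0 \<le> Bk" "C2_bound {0..1} (Pkap N) Q1 Q2 Bk" using C2_holder_imp_bound[OF P(2) sub \<alpha>(1)] .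
  define A where "A = (1 - K1 N) * am / a"
  define r where "r = temp N W / temp N V"
  define d where "d = ((1 - K1 N) / gc - r / gc) * f4 N W / a"
  define B0 where "B0 = \<bar>A\<bar> * Cs + \<bar>d\<bar> * L + Bs + Bk + Bt"
  have B00: "0 \<le> B0" using Cs0 Bs Bk Bt L by (simp add: B0_def)
  define M where "M = Kf * B0"
  have M0: "0 \<le> M" using Kf0 B00 by (simp add: M_def)
  define C\<mu> where "C\<mu> = \<bar>am\<bar> * Cs + \<bar>f4 N W / gc\<bar> * L"
  define Csp where "Csp = \<bar>J\<bar> * C\<mu> + M"
  define Cen where "Cen = \<bar>r * f4 N W\<bar> * L + \<bar>q * J / temp N V\<bar> * C\<mu> + \<bar>f4 N V\<bar> * L"
  define Cmf where "Cmf = \<bar>f5 N W\<bar> * L + \<bar>f5 N V\<bar> * L"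
  define X where "X = Csp + Cen + Cmf"
  define C\<psi> where "C\<psi> = \<bar>q / J\<bar> * M + \<bar>sp W / J\<bar> * Cs"
  define Q where "Q = 1 + 4 powr (1 / \<beta>)"
  have C\<mu>0: "0 \<le> C\<mu>" using Cs0 L by (simp add: C\<mu>_def)
  have X0: "0 \<le> Csp" "0 \<le> Cen" "0 \<le> Cmf" using C\<mu>0 M0 L by (simp_all add: Csp_def Cen_def Cmf_def)
  have C\<psi>0: "0 \<le> C\<psi>" using M0 Cs0 by (simp add: C\<psi>_def)
  have Q0: "0 \<le> Q" by (simp add: Q_def)
  define C where "C = Cs + (KL * M + KL * M + 3 * X + 3 * (Q * X)) + Q * C\<psi>"
  have C0: "0 \<le> C" using Cs0 KL0 M0 X0 C\<psi>0 Q0 by (simp add: C_def X_def)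
  show ?thesis
  proof (rule that[OF C0])
    fix \<sigma> \<kappa> \<xi> :: real
    assume \<sigma>: "0 < \<sigma>" and \<kappa>: "0 < \<kappa>" and \<xi>: "0 < \<xi>" "\<delta> \<le> len N - \<xi>" and sol: "solvability_eq N \<sigma> \<kappa> \<xi>"
    have \<xi>L: "\<xi> < L" using \<xi> \<delta> by (simp add: L_def)
    define z where "z = \<sigma> + \<kappa>"
    have z: "0 < z" "\<sigma> \<le> z" "\<kappa> \<le> z" using \<sigma> \<kappa> by (auto simp: z_def)
    obtain Um p' p'' \<theta>' \<theta>'' where Um: "supersonic_problem N \<sigma> \<kappa> \<xi> Um" "norm_m \<alpha> \<xi> Um \<le> ennreal (Cs * z)"
         "C2_bound {0..1} (\<lambda>s. pr (Um (\<xi>, s))) p' p'' (Cs * z)"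
         "C2_bound {0..1} (\<lambda>s. th (Um (\<xi>, s))) \<theta>' \<theta>'' (Cs * z)"
         "\<And>s. sp (Um (\<xi>, s)) = - pr (Um (\<xi>, s))" "\<And>s. en (Um (\<xi>, s)) = \<kappa> * f4 N W * \<xi>"
         "\<And>s. mf (Um (\<xi>, s)) = - \<kappa> * f5 N W * \<xi>"
         "am * integral {0..1} (\<lambda>s. pr (Um (\<xi>, s))) = \<sigma> * integral {0..\<xi>} (Theta N) - \<kappa> * f1 N W * \<xi>"
      using Cs[OF \<sigma> \<kappa> \<xi>(1)] \<xi>L unfolding L_def W_def am_def z_def by blast
    define pm where "pm s = pr (Um (\<xi>, s))" for s
    define Sm where "Sm = \<kappa> * f4 N W * \<xi>"
    note pmC = Um(3)[folded pm_def]
    have Smb: "\<bar>k * Sm\<bar> \<le> \<bar>k * f4 N W\<bar> * L * z" for k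
    proof -
      have "\<kappa> * \<xi> \<le> z * L" using z \<xi> \<xi>L \<kappa> by (intro mult_mono) auto
      then have "\<bar>k * f4 N W\<bar> * (\<kappa> * \<xi>) \<le> \<bar>k * f4 N W\<bar> * (z * L)" by (intro mult_left_mono) auto
      then show ?thesis using \<kappa> \<xi> by (simp add: Sm_def abs_mult mult_ac)
    qed
    \<comment> \<open>\<open>gl\<close> is the pressure behind the shock that the shock relations impose\<close>
    define gl where "gl s = A * pm s + (((1 - K1 N) / gc - r / gc) / a) * Sm" for s
    have aA: "a * (A * x + (((1 - K1 N) / gc - r / gc) / a) * y) = (1 - K1 N) * (am * x) + ((1 - K1 N) - r) * (y / gc)" for x y
      using a gc by (simp add: A_def field_simps)
    define gr where "gr s = \<sigma> * Psig N s + \<kappa> * Pkap N s" for s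
    define gt where "gt x = \<sigma> * Theta N x" for x
    have zB: "y \<le> z * B0" if "y \<le> z * Y" "Y \<le> B0" for y Y
      using that mult_left_mono[OF that(2), of z] z by linarith
    have parts: "0 \<le> \<bar>A\<bar> * Cs" "0 \<le> \<bar>d\<bar> * L" using Cs0 L by simp_all
    have glC: "C2_bound {0..1} gl (\<lambda>s. A * p' s) (\<lambda>s. A * p'' s) (z * B0)"
      unfolding C2_bound_def
    proof (intro conjI ballI)
      fix s :: real assume s: "s \<in> {0..1}"
      have pd: "(pm has_real_derivative p' s) (at s within {0..1})" "(p' has_real_derivative p'' s) (at s within {0..1})"
        and pb: "\<bar>pm s\<bar> \<le> Cs * z" "\<bar>p' s\<bar> \<le> Cs * z" "\<bar>p'' s\<bar> \<le> Cs * z"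
        using pmC s by (auto simp: C2_bound_def)
      show "(gl has_real_derivative A * p' s) (at s within {0..1})"
        unfolding gl_def[abs_def] using DERIV_add[OF DERIV_cmult[OF pd(1)] DERIV_const] by simp
      show "((\<lambda>s. A * p' s) has_real_derivative A * p'' s) (at s within {0..1})" by (rule DERIV_cmult[OF pd(2)])
      have Ab: "\<bar>A * y\<bar> \<le> z * (\<bar>A\<bar> * Cs)" if "\<bar>y\<bar> \<le> Cs * z" for y
        using mult_left_mono[OF that, of "\<bar>A\<bar>"] by (simp add: abs_mult mult_ac)
      have "\<bar>(((1 - K1 N) / gc - r / gc) / a) * Sm\<bar> \<le> \<bar>((1 - K1 N) / gc - r / gc) / a * f4 N W\<bar> * L * z"
        by (rule Smb)
      also have "\<dots> = z * (\<bar>d\<bar> * L)" by (simp add: d_def mult_ac)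
      finally have "\<bar>gl s\<bar> \<le> z * (\<bar>A\<bar> * Cs + \<bar>d\<bar> * L)"
        unfolding gl_def distrib_left using Ab[OF pb(1)] by linarith
      then show "\<bar>gl s\<bar> \<le> z * B0" by (rule zB) (use Bs Bk Bt in \<open>simp add: B0_def\<close>)
      show "\<bar>A * p' s\<bar> \<le> z * B0" by (rule zB[OF Ab[OF pb(2)]]) (use parts Bs Bk Bt in \<open>simp add: B0_def\<close>)
      show "\<bar>A * p'' s\<bar> \<le> z * B0" by (rule zB[OF Ab[OF pb(3)]]) (use parts Bs Bk Bt in \<open>simp add: B0_def\<close>)
    next
      show "continuous_on {0..1} (\<lambda>s. A * p'' s)"
        using pmC by (intro continuous_intros) (simp add: C2_bound_def)
    qed
    have grC: "C2_bound {0..1} gr (\<lambda>s. \<sigma> * P1 s + \<kappa> * Q1 s) (\<lambda>s. \<sigma> * P2 s + \<kappa> * Q2 s) (z * B0)"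
      unfolding C2_bound_def
    proof (intro conjI ballI)
      fix s :: real assume s: "s \<in> {0..1}"
      have pd: "(Psig N has_real_derivative P1 s) (at s within {0..1})" "(P1 has_real_derivative P2 s) (at s within {0..1})"
        "(Pkap N has_real_derivative Q1 s) (at s within {0..1})" "(Q1 has_real_derivative Q2 s) (at s within {0..1})"
        and pb: "\<bar>Psig N s\<bar> \<le> Bs" "\<bar>P1 s\<bar> \<le> Bs" "\<bar>P2 s\<bar> \<le> Bs" "\<bar>Pkap N s\<bar> \<le> Bk" "\<bar>Q1 s\<bar> \<le> Bk" "\<bar>Q2 s\<bar> \<le> Bk"
        using Bs(2) Bk(2) s by (auto simp: C2_bound_def)
      show "(gr has_real_derivative \<sigma> * P1 s + \<kappa> * Q1 s) (at s within {0..1})"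
        unfolding gr_def[abs_def] by (intro DERIV_add DERIV_cmult pd)
      show "((\<lambda>s. \<sigma> * P1 s + \<kappa> * Q1 s) has_real_derivative \<sigma> * P2 s + \<kappa> * Q2 s) (at s within {0..1})"
        by (intro DERIV_add DERIV_cmult pd)
      have Ab: "\<bar>\<sigma> * x + \<kappa> * y\<bar> \<le> z * B0" if "\<bar>x\<bar> \<le> Bs" "\<bar>y\<bar> \<le> Bk" for x y
      proof (rule zB)
        have "\<bar>\<sigma> * x\<bar> \<le> z * Bs" "\<bar>\<kappa> * y\<bar> \<le> z * Bk"
          using that z \<sigma> \<kappa> by (auto simp: abs_mult intro!: mult_mono)
        then show "\<bar>\<sigma> * x + \<kappa> * y\<bar> \<le> z * (Bs + Bk)" unfolding distrib_left by linarith
      qed (use parts Bt in \<open>simp add: B0_def\<close>)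
      show "\<bar>gr s\<bar> \<le> z * B0" "\<bar>\<sigma> * P1 s + \<kappa> * Q1 s\<bar> \<le> z * B0" "\<bar>\<sigma> * P2 s + \<kappa> * Q2 s\<bar> \<le> z * B0"
        unfolding gr_def by (intro Ab pb)+
    next
      show "continuous_on {0..1} (\<lambda>s. \<sigma> * P2 s + \<kappa> * Q2 s)"
        using Bs(2) Bk(2) by (intro continuous_intros) (simp_all add: C2_bound_def)
    qed
    have gtC: "C2_bound {\<xi>..L} gt (\<lambda>x. \<sigma> * \<Theta>1 x) (\<lambda>x. \<sigma> * \<Theta>2 x) (z * B0)"
      unfolding C2_bound_def
    proof (intro conjI ballI)
      fix x assume x: "x \<in> {\<xi>..L}"
      have xs: "x \<in> {0..L}" "{\<xi>..L} \<subseteq> {0..L}" using x \<xi> by auto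
      have td: "(Theta N has_real_derivative \<Theta>1 x) (at x within {\<xi>..L})" "(\<Theta>1 has_real_derivative \<Theta>2 x) (at x within {\<xi>..L})"
        by (rule DERIV_subset[OF _ xs(2)]; use Bt(2) xs(1) in \<open>simp add: C2_bound_def\<close>)+
      have tb: "\<bar>Theta N x\<bar> \<le> Bt" "\<bar>\<Theta>1 x\<bar> \<le> Bt" "\<bar>\<Theta>2 x\<bar> \<le> Bt"
        using Bt(2) xs(1) by (auto simp: C2_bound_def)
      show "(gt has_real_derivative \<sigma> * \<Theta>1 x) (at x within {\<xi>..L})"
        unfolding gt_def[abs_def] by (rule DERIV_cmult[OF td(1)])
      show "((\<lambda>x. \<sigma> * \<Theta>1 x) has_real_derivative \<sigma> * \<Theta>2 x) (at x within {\<xi>..L})" by (rule DERIV_cmult[OF td(2)])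
      have Ab: "\<bar>\<sigma> * y\<bar> \<le> z * B0" if "\<bar>y\<bar> \<le> Bt" for y
      proof (rule zB)
        show "\<bar>\<sigma> * y\<bar> \<le> z * Bt" using that z \<sigma> by (auto simp: abs_mult intro!: mult_mono)
      qed (use parts Bs Bk in \<open>simp add: B0_def\<close>)
      show "\<bar>gt x\<bar> \<le> z * B0" "\<bar>\<sigma> * \<Theta>1 x\<bar> \<le> z * B0" "\<bar>\<sigma> * \<Theta>2 x\<bar> \<le> z * B0"
        unfolding gt_def by (intro Ab tb)+
    next
      have "continuous_on {0..L} \<Theta>2" using Bt(2) by (simp add: C2_bound_def)
      then have "continuous_on {\<xi>..L} \<Theta>2" by (rule continuous_on_subset) (use \<xi> in auto)
      then show "continuous_on {\<xi>..L} (\<lambda>x. \<sigma> * \<Theta>2 x)" by (rule continuous_on_mult_left)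
    qed
    have compat: "integral {\<xi>..L} gt - a * (integral {0..1} gr - integral {0..1} gl) = (\<kappa> * f1 N V) * (L - \<xi>)"
    proof -
      have \<Theta>i: "(Theta N) integrable_on {0..L}"
        by (rule integrable_continuous_real[OF C2_bound_continuous[OF Bt(2)]])
      have I0: "integral {0..L} (Theta N) = integral {0..\<xi>} (Theta N) + integral {\<xi>..L} (Theta N)"
        using Henstock_Kurzweil_Integration.integral_combine[OF _ _ \<Theta>i, of \<xi>] \<xi> \<xi>L by simp
      have It: "integral {\<xi>..L} gt = \<sigma> * integral {\<xi>..L} (Theta N)"
        unfolding gt_def[abs_def] by (rule integral_mult_right)
      have Ir: "a * integral {0..1} gr = \<sigma> * star N (Psig N) + \<kappa> * star N (Pkap N)"
      proof -
        have "integral {0..1} gr = \<sigma> * integral {0..1} (Psig N) + \<kappa> * integral {0..1} (Pkap N)"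
          unfolding gr_def[abs_def]
          by (subst integral_add)
             (auto intro!: integrable_continuous_real continuous_intros C2_bound_continuous[OF Bs(2)] C2_bound_continuous[OF Bk(2)])
        then show ?thesis by (simp add: star_def a_def V_def algebra_simps)
      qed
      have "((\<lambda>s. A * pm s + (((1 - K1 N) / gc - r / gc) / a) * Sm) has_integral
          A * integral {0..1} pm + (((1 - K1 N) / gc - r / gc) / a) * Sm) {0..1}"
        using has_integral_add[OF has_integral_mult_right[OF integrable_integral[OF integrable_continuous_real[OF C2_bound_continuous[OF pmC]]]]
          has_integral_const_real[of "(((1 - K1 N) / gc - r / gc) / a) * Sm" 0 1]] by simp
      then have "integral {0..1} gl = A * integral {0..1} pm + (((1 - K1 N) / gc - r / gc) / a) * Sm"
        unfolding gl_def[abs_def] by (rule integral_unique)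
      then have "a * integral {0..1} gl = (1 - K1 N) * (am * integral {0..1} pm) + ((1 - K1 N) - r) * (Sm / gc)"
        by (simp only: aA)
      also have "am * integral {0..1} pm = \<sigma> * integral {0..\<xi>} (Theta N) - \<kappa> * f1 N W * \<xi>"
        using Um(8) by (simp add: pm_def[abs_def])
      also have "Sm / gc = \<kappa> * f1 N W * \<xi>"
        unfolding rW(1)[folded gc_def, symmetric] by (simp add: Sm_def)
      finally have Il: "a * integral {0..1} gl = (1 - K1 N) * (\<sigma> * integral {0..\<xi>} (Theta N)) - r * (\<kappa> * f1 N W * \<xi>)"
        by (simp add: algebra_simps)
      have K2: "K2 N = f1 N V - r * f1 N W" using K2_eq[OF gas bg] by (simp add: r_def V_def W_def)
      have "\<sigma> * (integral {0..L} (Theta N) - K1 N * integral {0..\<xi>} (Theta N)) + \<kappa> * (- f1 N V * L + K2 N * \<xi>) =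
        \<sigma> * star N (Psig N) + \<kappa> * star N (Pkap N)"
        using sol by (simp add: solvability_eq_def Rsig_def Rkap_def L_def V_def)
      then have "a * integral {0..1} gr = \<sigma> * (integral {0..L} (Theta N) - K1 N * integral {0..\<xi>} (Theta N)) +
         \<kappa> * (- f1 N V * L + (f1 N V - r * f1 N W) * \<xi>)"
        unfolding Ir K2 by simp
      then show ?thesis unfolding right_diff_distrib[of a] It Il I0 by (simp add: algebra_simps)
    qed
    obtain p \<theta> px py \<theta>x \<theta>y where flow: "channel_flow a q \<xi> L e (Kf * (z * B0)) (\<kappa> * f1 N V) gl gr gt p \<theta> px py \<theta>x \<theta>y"
      using Kf[OF _ _ glC grC gtC compat] \<xi> \<xi>L by (auto simp: L_def)
    have KM: "Kf * (z * B0) = M * z" by (simp add: M_def)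
    have p0: "\<And>s. s \<in> {0..1} \<Longrightarrow> p (\<xi>, s) = gl s" "\<And>s. s \<in> {0..1} \<Longrightarrow> p (L, s) = gr s"
      and \<theta>0: "\<And>x. x \<in> {\<xi>..L} \<Longrightarrow> \<theta> (x, 0) = 0" "\<And>x. x \<in> {\<xi>..L} \<Longrightarrow> \<theta> (x, 1) = gt x"
      and CR: "\<And>y. py y + q * \<theta>x y = 0" "\<And>y. \<theta>y y - a * px y = \<kappa> * f1 N V"
      and pR: "channel_regular \<xi> L e (M * z) p px py" and \<theta>R: "channel_regular \<xi> L e (M * z) \<theta> \<theta>x \<theta>y"
      using flow unfolding channel_flow_def KM by blast+
    have Mz: "0 \<le> M * z" using M0 z by simp
    \<comment> \<open>the perturbation of the mass flux; \<open>sp1\<close>, \<open>en1\<close> and \<open>mf1\<close> take the values required by the shock relations on \<open>y\<^sub>1 = \<xi>\<close>\<close>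
    define \<mu> where "\<mu> s = - am * pm s - Sm / gc" for s
    define sp1 where "sp1 y = J * \<mu> (snd y) - p y" for y :: "real \<times> real"
    define en1 where "en1 y = r * Sm - q * J / temp N V * \<mu> (snd y) + \<kappa> * f4 N V * (fst y - \<xi>)" for y :: "real \<times> real"
    define mf1 where "mf1 y = - \<kappa> * f5 N W * \<xi> - \<kappa> * f5 N V * (fst y - \<xi>)" for y :: "real \<times> real"
    define comp where "comp i y = (if i = 1 then p y else if i = 2 then \<theta> y else if i = 3 then sp1 y else if i = 4 then en1 y else mf1 y)"
      for i :: 5 and y
    define Up where "Up y = (\<chi> i. comp i y)" for y :: "real \<times> real"
    have n5: "(1::5) \<noteq> 2" "(1::5) \<noteq> 3" "(1::5) \<noteq> 4" "(2::5) \<noteq> 3" "(2::5) \<noteq> 4" "(3::5) \<noteq> 4"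
      "(5::5) \<noteq> 1" "(5::5) \<noteq> 2" "(5::5) \<noteq> 3" "(5::5) \<noteq> 4" by simp_all
    note n5' = n5 n5[symmetric]
    have Up1: "pr (Up y) = p y" "th (Up y) = \<theta> y" "sp (Up y) = sp1 y" "en (Up y) = en1 y" "mf (Up y) = mf1 y" for y
      using n5' by (simp_all add: Up_def comp_def)
    \<comment> \<open>solves the fifth shock relation; the jump of the pressure is not zero\<close>
    define \<psi> where "\<psi> s = q / J * \<theta> (\<xi>, s) + - (sp W / J) * th (Um (\<xi>, s))" for s
    have t\<mu>: "holder_trace e (C\<mu> * z) \<mu>"
    proof (rule holder_trace_mono)
      show "holder_trace e (\<bar>- am\<bar> * (Cs * z) + \<bar>- (Sm / gc)\<bar>) \<mu>"
        unfolding \<mu>_def[abs_def] diff_conv_add_uminus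
        by (intro holder_trace_add holder_trace_scale holder_trace_const holder_trace_C2[OF pmC] e)
      have "\<bar>Sm / gc\<bar> \<le> \<bar>f4 N W / gc\<bar> * L * z" using Smb[of "1 / gc"] by simp
      then show "\<bar>- am\<bar> * (Cs * z) + \<bar>- (Sm / gc)\<bar> \<le> C\<mu> * z"
        by (simp add: C\<mu>_def distrib_right mult.assoc)
    qed
    have tp: "holder_trace e (M * z) (\<lambda>s. p (\<xi>, s))" and t\<theta>: "holder_trace e (M * z) (\<lambda>s. \<theta> (\<xi>, s))"
      using channel_regular_trace[OF pR _ e(2)] channel_regular_trace[OF \<theta>R _ e(2)] \<xi>L by simp_all
    have tsp: "holder_trace e (Csp * z) (\<lambda>s. sp1 (\<xi>, s))"
    proof (rule holder_trace_mono)
      show "holder_trace e (\<bar>J\<bar> * (C\<mu> * z) + \<bar>- 1\<bar> * (M * z)) (\<lambda>s. sp1 (\<xi>, s))"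
        using holder_trace_add[OF holder_trace_scale[OF t\<mu>, of J] holder_trace_scale[OF tp, of "- 1"]]
        by (simp add: sp1_def)
    qed (simp add: Csp_def distrib_right mult.assoc)
    have ten: "holder_trace e (\<bar>r * Sm\<bar> + \<bar>- (q * J / temp N V)\<bar> * (C\<mu> * z)) (\<lambda>s. en1 (\<xi>, s))"
      using holder_trace_add[OF holder_trace_const[of e "r * Sm"] holder_trace_scale[OF t\<mu>, of "- (q * J / temp N V)"]]
      by (simp add: en1_def)
    have dist1: "\<bar>\<kappa> * k * x\<bar> \<le> \<bar>k\<bar> * L * z" if "0 \<le> x" "x \<le> L" for k x
    proof -
      have "\<kappa> * x \<le> z * L" using that z \<kappa> by (intro mult_mono) auto
      then have "\<bar>k\<bar> * (\<kappa> * x) \<le> \<bar>k\<bar> * (z * L)" by (intro mult_left_mono) auto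
      then show ?thesis using \<kappa> that by (simp add: abs_mult mult_ac)
    qed
    have tenb: "\<bar>r * Sm\<bar> + \<bar>- (q * J / temp N V)\<bar> * (C\<mu> * z) + \<bar>f4 N V\<bar> * L * z \<le> Cen * z"
      using Smb[of r] by (simp add: Cen_def distrib_right mult.assoc)
    have "0 \<le> \<bar>f4 N V\<bar> * L * z" using L z by simp
    then have ten': "holder_trace e (Cen * z) (\<lambda>s. en1 (\<xi>, s))"
      using tenb by (intro holder_trace_mono[OF ten]) linarith
    have tmf: "holder_trace e (Cmf * z) (\<lambda>s. mf1 (\<xi>, s))"
    proof (rule holder_trace_mono)
      show "holder_trace e \<bar>- \<kappa> * f5 N W * \<xi>\<bar> (\<lambda>s. mf1 (\<xi>, s))"
        using holder_trace_const[of e "- \<kappa> * f5 N W * \<xi>"] by (simp add: mf1_def)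
      have "\<bar>- \<kappa> * f5 N W * \<xi>\<bar> \<le> \<bar>f5 N W\<bar> * L * z" using dist1[of \<xi> "f5 N W"] \<xi> \<xi>L by simp
      moreover have "0 \<le> \<bar>f5 N V\<bar> * L * z" using L z by simp
      ultimately show "\<bar>- \<kappa> * f5 N W * \<xi>\<bar> \<le> Cmf * z" by (simp add: Cmf_def distrib_right)
    qed
    have t\<psi>: "holder_trace e (C\<psi> * z) \<psi>"
    proof (rule holder_trace_mono)
      show "holder_trace e (\<bar>q / J\<bar> * (M * z) + \<bar>- (sp W / J)\<bar> * (Cs * z)) \<psi>"
        unfolding \<psi>_def[abs_def]
        by (intro holder_trace_add holder_trace_scale t\<theta> holder_trace_C2[OF Um(4)] e)
      show "\<bar>q / J\<bar> * (M * z) + \<bar>- (sp W / J)\<bar> * (Cs * z) \<le> C\<psi> * z"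
        by (simp add: C\<psi>_def distrib_right mult.assoc)
    qed
    let ?R = "{\<xi>..L} \<times> {0..1::real}"
    have clR: "closure (Omega_p N \<xi>) = ?R"
      using \<xi>L by (simp add: Omega_p_def L_def closure_Times)
    have Op: "Omega_p N \<xi> = {\<xi><..<L} \<times> {0<..<1}" by (simp add: Omega_p_def L_def)
    have OR: "Omega_p N \<xi> \<subseteq> ?R" by (auto simp: Op)
    have oO: "open (Omega_p N \<xi>)" unfolding Op by (intro open_Times) auto
    have pc: "continuous_on ?R p" and \<theta>c: "continuous_on ?R \<theta>"
      using channel_regular_continuous[OF pR e(2) Mz] channel_regular_continuous[OF \<theta>R e(2) Mz] by simp_all
    have \<mu>c: "continuous_on ?R (\<lambda>y. \<mu> (snd y))"
      by (rule continuous_on_compose2[OF holder_trace_continuous[OF t\<mu> e(2)]]) (auto intro!: continuous_intros)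
    have spc: "continuous_on ?R sp1" unfolding sp1_def[abs_def] by (intro continuous_intros \<mu>c pc)
    have enc: "continuous_on ?R en1" unfolding en1_def[abs_def] by (intro continuous_intros \<mu>c)
    have mfc: "continuous_on ?R mf1" unfolding mf1_def[abs_def] by (intro continuous_intros)
    have Upc: "continuous_on ?R Up"
      unfolding Up_def[abs_def]
    proof (rule continuous_on_vec_lambda)
      fix i show "continuous_on ?R (\<lambda>y. comp i y)"
        unfolding comp_def[abs_def] using pc \<theta>c spc enc mfc
        by (cases "i = 1"; cases "i = 2"; cases "i = 3"; cases "i = 4"; simp)
    qed
    note pW = channel_regular_weak[OF pR e(2) Mz, folded Op] and \<theta>W = channel_regular_weak[OF \<theta>R e(2) Mz, folded Op]
    have subsonic: "subsonic_problem N \<sigma> \<kappa> \<xi> Up"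
      unfolding subsonic_problem_def Let_def Up1 V_def[symmetric] clR
    proof (intro conjI ballI)
      show "continuous_on ?R Up" by (rule Upc)
      show "distr_div (Omega_p N \<xi>) (\<lambda>y. sp V * \<theta> y) p 0"
      proof (rule distr_div_classical[OF oO, where ?g1.0 = "\<lambda>y. q * \<theta>x y" and ?g2.0 = py])
        show "((\<lambda>t. sp V * \<theta> (y + t *\<^sub>R (1, 0))) has_real_derivative q * \<theta>x y) (at 0)" if "y \<in> Omega_p N \<xi>" for y
          unfolding q_def by (rule DERIV_cmult[OF \<theta>W(4)[OF that]])
        show "((\<lambda>t. p (y + t *\<^sub>R (0, 1))) has_real_derivative py y) (at 0)" if "y \<in> Omega_p N \<xi>" for y
          by (rule pW(5)[OF that])
        show "q * \<theta>x y + py y = 0" for y using CR(1)[of y] by simp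
      qed (auto intro!: continuous_intros pW \<theta>W)
      show "distr_div (Omega_p N \<xi>) (\<lambda>y. - acoef N V * p y) \<theta> (\<kappa> * f1 N V)"
      proof (rule distr_div_classical[OF oO, where ?g1.0 = "\<lambda>y. - a * px y" and ?g2.0 = \<theta>y])
        show "((\<lambda>t. - acoef N V * p (y + t *\<^sub>R (1, 0))) has_real_derivative - a * px y) (at 0)" if "y \<in> Omega_p N \<xi>" for y
          unfolding a_def by (rule DERIV_cmult[OF pW(4)[OF that]])
        show "((\<lambda>t. \<theta> (y + t *\<^sub>R (0, 1))) has_real_derivative \<theta>y y) (at 0)" if "y \<in> Omega_p N \<xi>" for y
          by (rule \<theta>W(5)[OF that])
        show "- a * px y + \<theta>y y = \<kappa> * f1 N V" for y using CR(2)[of y] by simp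
      qed (auto intro!: continuous_intros pW \<theta>W)
      \<comment> \<open>as the heat terms cancel, the Bernoulli function is constant in the whole subsonic region\<close>
      have bern: "sp V * sp1 y + 1 / rho N V * p y + temp N V * en1 y + qe N * mf1 y = temp N V * (r * Sm) - qe N * (\<kappa> * f5 N W * \<xi>)" for y
      proof -
        have "temp N V * (q * J / temp N V * \<mu> (snd y)) = q * (J * \<mu> (snd y))" using rV(3) by simp
        moreover have "temp N V * (\<kappa> * f4 N V * (fst y - \<xi>)) = qe N * (\<kappa> * f5 N V * (fst y - \<xi>))"
          using arg_cong[OF rV(2), of "\<lambda>x. x * (\<kappa> * (fst y - \<xi>))"] by (simp add: mult_ac)
        moreover have "1 / rho N V = q" unfolding bV(3) q_def by simp
        ultimately show ?thesis
          unfolding en1_def sp1_def mf1_def q_def[symmetric] by (simp only: distrib_left right_diff_distrib)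
      qed
      show "distr_div (Omega_p N \<xi>) (\<lambda>y. sp V * sp1 y + 1 / rho N V * p y + temp N V * en1 y + qe N * mf1 y) (\<lambda>y. 0) 0"
        unfolding bern by (rule distr_div_classical[OF oO, where ?g1.0 = "\<lambda>y. 0" and ?g2.0 = "\<lambda>y. 0"]) auto
      show "distr_div (Omega_p N \<xi>) en1 (\<lambda>y. 0) (\<kappa> * f4 N V)"
      proof (rule distr_div_classical[OF oO, where ?g1.0 = "\<lambda>y. \<kappa> * f4 N V" and ?g2.0 = "\<lambda>y. 0"])
        show "continuous_on (Omega_p N \<xi>) en1" by (rule continuous_on_subset[OF enc OR])
        show "((\<lambda>t. en1 (y + t *\<^sub>R (1, 0))) has_real_derivative \<kappa> * f4 N V) (at 0)" for y
          unfolding en1_def by (auto intro!: derivative_eq_intros)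
      qed auto
      show "distr_div (Omega_p N \<xi>) mf1 (\<lambda>y. 0) (- \<kappa> * f5 N V)"
      proof (rule distr_div_classical[OF oO, where ?g1.0 = "\<lambda>y. - \<kappa> * f5 N V" and ?g2.0 = "\<lambda>y. 0"])
        show "continuous_on (Omega_p N \<xi>) mf1" by (rule continuous_on_subset[OF mfc OR])
        show "((\<lambda>t. mf1 (y + t *\<^sub>R (1, 0))) has_real_derivative - \<kappa> * f5 N V) (at 0)" for y
          unfolding mf1_def by (auto intro!: derivative_eq_intros)
      qed auto
    next
      fix s :: real assume "s \<in> {0<..<1}"
      then show "p (len N, s) = \<sigma> * Psig N s + \<kappa> * Pkap N s" using p0(2)[of s] by (simp add: L_def gr_def)
    next
      fix x assume "x \<in> {\<xi><..<len N}"
      then have x: "x \<in> {\<xi>..L}" by (simp add: L_def)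
      show "\<theta> (x, 0) = 0" by (rule \<theta>0(1)[OF x])
      show "\<theta> (x, 1) = \<sigma> * Theta N x" using \<theta>0(2)[OF x] by (simp add: gt_def)
    qed
    have shock: "shock_conditions N \<xi> Um Up \<psi>"
      unfolding shock_conditions_def Let_def
    proof
      fix s :: real assume "s \<in> {0<..<1}"
      then have s: "s \<in> {0..1}" by simp
      let ?v = "Up (\<xi>, s)" and ?w = "Um (\<xi>, s)"
      have w4: "en ?w = Sm" and w1: "pr ?w = pm s" using Um(6) by (simp_all add: Sm_def pm_def)
      have \<mu>w: "\<mu> s = - acoef N (bgm N) * pr ?w - en ?w / (gam N * cv N)"
        unfolding w1 w4 \<mu>_def am_def W_def gc_def ..
      have pv: "acoef N (bgp N) * pr ?v = (1 - K1 N) * (acoef N (bgm N) * pr ?w + en ?w / (gam N * cv N)) -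
         temp N (bgm N) * en ?w / (temp N (bgp N) * gam N * cv N)"
      proof -
        have "acoef N (bgp N) * pr ?v = a * gl s" using p0(1)[OF s] by (simp add: Up1 a_def V_def)
        also have "\<dots> = (1 - K1 N) * (am * pm s + Sm / gc) - r * Sm / gc"
          unfolding gl_def aA by (simp add: algebra_simps)
        finally show ?thesis unfolding w1 w4 r_def am_def W_def V_def gc_def by (simp add: mult.assoc)
      qed
      have sv: "sp ?v = (pr (bgp N) - pr (bgm N)) * (- acoef N (bgm N) * pr ?w - en ?w / (gam N * cv N)) - pr ?v"
        unfolding \<mu>w[symmetric] by (simp add: Up1 sp1_def J_def V_def W_def)
      have ev: "en ?v = (temp N (bgm N) * en ?w - sp (bgp N) * (pr (bgp N) - pr (bgm N)) *
          (- acoef N (bgm N) * pr ?w - en ?w / (gam N * cv N))) / temp N (bgp N)"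
        unfolding \<mu>w[symmetric] unfolding w4 by (simp add: Up1 en1_def J_def V_def W_def r_def q_def diff_divide_distrib)
      have zv: "mf ?v = mf ?w" using Um(7)[of s] by (simp add: Up1 mf1_def)
      note rel = linearized_shock_relations[OF gas bg Um(5) pv sv ev zv]
      have "lin_jump N (G5 0) ?v ?w = q * \<theta> (\<xi>, s) - sp W * th ?w"
        unfolding rel(5) by (simp add: Up1 q_def V_def W_def)
      moreover have "jump pr (bgp N) (bgm N) * \<psi> s = q * \<theta> (\<xi>, s) - sp W * th ?w"
        using J by (simp add: jump_def J_def[symmetric] V_def[symmetric] W_def[symmetric] \<psi>_def right_diff_distrib)
      ultimately show "lin_jump N (G1 N) ?v ?w = 0 \<and> lin_jump N (G2 N) ?v ?w = 0 \<and> lin_jump N (G3 N) ?v ?w = 0 \<and>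
        lin_jump N G4 ?v ?w = 0 \<and> lin_jump N (G5 0) ?v ?w - jump pr (bgp N) (bgm N) * \<psi> s = 0"
        using rel by simp
    qed
    have lin: "linearized_problem N \<sigma> \<kappa> \<xi> Um Up \<psi>"
      unfolding linearized_problem_def using Um(1) subsonic shock by blast
    have sob: "sobolev_norm \<beta> (Omega_p N \<xi>) p \<le> ennreal (KL * (M * z))" "sobolev_norm \<beta> (Omega_p N \<xi>) \<theta> \<le> ennreal (KL * (M * z))"
      unfolding Op by (rule KL[OF _ _ Mz], use \<xi> \<xi>L pR \<theta>R in \<open>simp_all add: e_def\<close>)+
    have XC: "Csp * z \<le> X * z" "Cen * z \<le> X * z" "Cmf * z \<le> X * z"
      using X0 z by (auto simp: X_def intro!: mult_right_mono)
    have i345: "i = 3 \<or> i = 4 \<or> i = 5" if "i \<in> {3, 4, 5}" for i :: 5 using that by auto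
    have c345: "card {3, 4, 5 :: 5} = 3" by simp
    have C0n: "C0_norm (closure (Omega_p N \<xi>)) (\<lambda>y. Up y $ i) \<le> ennreal (X * z)" if i: "i \<in> {3, 4, 5}" for i
      unfolding clR
    proof (rule C0_norm_le)
      show "continuous_on ?R (\<lambda>y. Up y $ i)" using i345[OF i] spc enc mfc by (auto simp: Up1)
      fix y assume y: "y \<in> ?R"
      have s: "snd y \<in> {0..1}" and x: "0 \<le> fst y - \<xi>" "fst y - \<xi> \<le> L" using y \<xi> by auto
      have "\<bar>sp1 y\<bar> \<le> Csp * z"
      proof -
        have "\<bar>J * \<mu> (snd y)\<bar> \<le> \<bar>J\<bar> * (C\<mu> * z)" using t\<mu> s by (auto simp: holder_trace_def abs_mult intro!: mult_left_mono)
        moreover have "\<bar>p (fst y, snd y)\<bar> \<le> M * z" using pR y unfolding channel_regular_def by auto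
        ultimately show ?thesis by (simp add: sp1_def Csp_def distrib_right mult.assoc)
      qed
      moreover have "\<bar>en1 y\<bar> \<le> Cen * z"
      proof -
        have "\<bar>en1 (\<xi>, snd y)\<bar> \<le> \<bar>r * Sm\<bar> + \<bar>- (q * J / temp N V)\<bar> * (C\<mu> * z)"
          using ten s by (auto simp: holder_trace_def)
        moreover have "en1 y = en1 (\<xi>, snd y) + \<kappa> * f4 N V * (fst y - \<xi>)" by (simp add: en1_def)
        ultimately show ?thesis using tenb dist1[OF x, of "f4 N V"] by linarith
      qed
      moreover have "\<bar>mf1 y\<bar> \<le> Cmf * z"
        using dist1[of \<xi> "f5 N W"] dist1[OF x, of "f5 N V"] \<xi> \<xi>L unfolding mf1_def Cmf_def distrib_right by simp
      ultimately show "\<bar>Up y $ i\<bar> \<le> X * z" using i345[OF i] XC by (auto simp: Up1)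
    qed
    have sh: "norm_shock \<beta> (\<lambda>s. Up (\<xi>, s) $ i) \<le> ennreal (Q * (X * z))" if i: "i \<in> {3, 4, 5}" for i
    proof -
      have "holder_trace (1 / (2 * \<beta>)) (X * z) (\<lambda>s. Up (\<xi>, s) $ i)"
        using i345[OF i] holder_trace_mono[OF tsp XC(1)] holder_trace_mono[OF ten' XC(2)] holder_trace_mono[OF tmf XC(3)]
        unfolding e_def by (auto simp: Up1)
      from norm_shock_trace[OF \<beta>1 this] show ?thesis by (simp add: Q_def)
    qed
    have Xz: "0 \<le> X * z" using X0 z by (simp add: X_def)
    have np: "norm_p N \<beta> \<xi> Up \<le> ennreal ((KL * M + KL * M + 3 * X + 3 * (Q * X)) * z)"
    proof -
      have "(\<Sum>i\<in>{3, 4, 5}. C0_norm (closure (Omega_p N \<xi>)) (\<lambda>y. Up y $ i)) \<le> of_nat (card {3, 4, 5 :: 5}) * ennreal (X * z)"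
        by (rule sum_bounded_above) (rule C0n)
      moreover have "(\<Sum>i\<in>{3, 4, 5}. norm_shock \<beta> (\<lambda>s. Up (\<xi>, s) $ i)) \<le> of_nat (card {3, 4, 5 :: 5}) * ennreal (Q * (X * z))"
        by (rule sum_bounded_above) (rule sh)
      ultimately have "norm_p N \<beta> \<xi> Up \<le> ennreal (KL * (M * z)) + ennreal (KL * (M * z)) +
         of_nat (card {3, 4, 5 :: 5}) * ennreal (X * z) + of_nat (card {3, 4, 5 :: 5}) * ennreal (Q * (X * z))"
        unfolding norm_p_def Up1 using sob by (intro add_mono)
      also have "\<dots> = ennreal (KL * (M * z) + KL * (M * z) + 3 * (X * z) + 3 * (Q * (X * z)))"
      proof -
        have "ennreal x + ennreal x' + of_nat 3 * ennreal y + of_nat 3 * ennreal w = ennreal (x + x' + 3 * y + 3 * w)"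
          if "0 \<le> x" "0 \<le> x'" "0 \<le> y" "0 \<le> w" for x x' y w
          using that by (simp add: ennreal_mult')
        from this[of "KL * (M * z)" "KL * (M * z)" "X * z" "Q * (X * z)"] show ?thesis
          unfolding c345 using KL0 Mz Xz Q0 by (simp only: mult_nonneg_nonneg)
      qed
      also have "KL * (M * z) + KL * (M * z) + 3 * (X * z) + 3 * (Q * (X * z)) = (KL * M + KL * M + 3 * X + 3 * (Q * X)) * z"
        by (simp add: algebra_simps)
      finally show ?thesis .
    qed
    have ns: "norm_shock \<beta> \<psi> \<le> ennreal (Q * C\<psi> * z)"
      using norm_shock_trace[OF \<beta>1 t\<psi>[unfolded e_def]] by (simp add: Q_def mult.assoc)
    have "norm_m \<alpha> \<xi> Um + norm_p N \<beta> \<xi> Up + norm_shock \<beta> \<psi> \<le>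
       ennreal (Cs * z) + ennreal ((KL * M + KL * M + 3 * X + 3 * (Q * X)) * z) + ennreal (Q * C\<psi> * z)"
      by (intro add_mono Um(2) np ns)
    also have "\<dots> = ennreal (Cs * z + (KL * M + KL * M + 3 * X + 3 * (Q * X)) * z + Q * C\<psi> * z)"
      using Cs0 KL0 M0 X0 Q0 C\<psi>0 z by (simp add: X_def)
    also have "Cs * z + (KL * M + KL * M + 3 * X + 3 * (Q * X)) * z + Q * C\<psi> * z = C * (\<sigma> + \<kappa>)"
      unfolding C_def z_def[symmetric] by (simp add: algebra_simps)
    finally show "\<exists>Um Up \<psi>'. linearized_problem N \<sigma> \<kappa> \<xi> Um Up \<psi>' \<and>
         norm_m \<alpha> \<xi> Um + norm_p N \<beta> \<xi> Up + norm_shock \<beta> \<psi>' \<le> ennreal (C * (\<sigma> + \<kappa>))"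
      using lin by blast
  qed
qed

theorem theorem2p3:
  fixes N :: nozzle and \<alpha> \<beta> :: real
  assumes "0 < \<alpha>" "\<alpha> < 1" "\<beta> > 2"
    and "gas N" and "background N" and "boundary_data \<alpha> N"
  shows "\<exists>C :: real \<Rightarrow> real.
    (\<forall>K. compact K \<and> K \<subseteq> {0<..<len N} \<longrightarrow> bounded (C ` K)) \<and>
    (\<forall>r :: regime. \<exists>\<epsilon>>0. \<forall>\<sigma> \<kappa> \<xi>.
       0 < \<sigma> \<and> \<sigma> < \<epsilon> \<and> 0 < \<kappa> \<and> \<kappa> < \<epsilon> \<and> matches N r \<sigma> \<kappa> \<xi> \<longrightarrow>
       (\<exists>Um Up \<psi>'.
          linearized_problem N \<sigma> \<kappa> \<xi> Um Up \<psi>' \<and>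
          norm_m \<alpha> \<xi> Um + norm_p N \<beta> \<xi> Up + norm_shock \<beta> \<psi>' \<le> ennreal (C \<xi> * (\<sigma> + \<kappa>))))"
proof -
  define solvable where "solvable C \<sigma> \<kappa> \<xi> \<longleftrightarrow> (\<exists>Um Up \<psi>'. linearized_problem N \<sigma> \<kappa> \<xi> Um Up \<psi>' \<and>
      norm_m \<alpha> \<xi> Um + norm_p N \<beta> \<xi> Up + norm_shock \<beta> \<psi>' \<le> ennreal (C * (\<sigma> + \<kappa>)))" for C \<sigma> \<kappa> \<xi>
  have "\<exists>C. \<forall>\<sigma> \<kappa> \<xi>. 0 < \<sigma> \<longrightarrow> 0 < \<kappa> \<longrightarrow> 0 < \<xi> \<longrightarrow> inverse (real (Suc n)) \<le> len N - \<xi> \<longrightarrow>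
      solvability_eq N \<sigma> \<kappa> \<xi> \<longrightarrow> solvable C \<sigma> \<kappa> \<xi>" for n
  proof -
    have "0 < inverse (real (Suc n))" by simp
    from linearized_problem_solution[OF assms(4,5,6,1,2,3) this] show ?thesis
      unfolding solvable_def by metis
  qed
  then obtain D where D: "\<And>n \<sigma> \<kappa> \<xi>. 0 < \<sigma> \<Longrightarrow> 0 < \<kappa> \<Longrightarrow> 0 < \<xi> \<Longrightarrow> inverse (real (Suc n)) \<le> len N - \<xi> \<Longrightarrow>
      solvability_eq N \<sigma> \<kappa> \<xi> \<Longrightarrow> solvable (D n) \<sigma> \<kappa> \<xi>"
    by metis
  \<comment> \<open>on a compact set of locations the distance to the exit is bounded below, so only finitely many of the constants \<open>D n\<close> occur\<close>
  define m where "m \<xi> = (LEAST n. inverse (real (Suc n)) \<le> len N - \<xi>)" for \<xi>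
  have m: "inverse (real (Suc (m \<xi>))) \<le> len N - \<xi>" if "\<xi> < len N" for \<xi>
  proof -
    have "0 < len N - \<xi>" using that by simp
    then obtain n where "inverse (real (Suc n)) < len N - \<xi>" using reals_Archimedean by blast
    then have "inverse (real (Suc n)) \<le> len N - \<xi>" by simp
    then show ?thesis unfolding m_def by (rule LeastI)
  qed
  show ?thesis
  proof (intro exI[of _ "\<lambda>\<xi>. D (m \<xi>)"] conjI allI impI)
    fix K assume K: "compact K \<and> K \<subseteq> {0<..<len N}"
    show "bounded ((\<lambda>\<xi>. D (m \<xi>)) ` K)"
    proof (cases "K = {}")
      case False
      obtain x where x: "x \<in> K" "\<And>y. y \<in> K \<Longrightarrow> y \<le> x" using compact_attains_sup[of K] K False by auto
      have "(\<lambda>\<xi>. D (m \<xi>)) ` K \<subseteq> D ` {..m x}"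
      proof (rule image_subsetI)
        fix y assume y: "y \<in> K"
        have "inverse (real (Suc (m x))) \<le> len N - y" using m[of x] x(2)[OF y] K x(1) by fastforce
        then have "m y \<le> m x" unfolding m_def[of y] by (rule Least_le)
        then show "D (m y) \<in> D ` {..m x}" by simp
      qed
      then show ?thesis by (rule bounded_subset[rotated]) (simp add: finite_imp_bounded)
    qed simp
  next
    fix r
    have "solvable (D (m \<xi>)) \<sigma> \<kappa> \<xi>" if "0 < \<sigma>" "0 < \<kappa>" "matches N r \<sigma> \<kappa> \<xi>" for \<sigma> \<kappa> \<xi>
      using matches_imp_solvable[OF assms(6,1) that(3)] m[of \<xi>] that by (intro D) auto
    then show "\<exists>\<epsilon>>0. \<forall>\<sigma> \<kappa> \<xi>. 0 < \<sigma> \<and> \<sigma> < \<epsilon> \<and> 0 < \<kappa> \<and> \<kappa> < \<epsilon> \<and> matches N r \<sigma> \<kappa> \<xi> \<longrightarrow>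
       (\<exists>Um Up \<psi>'. linearized_problem N \<sigma> \<kappa> \<xi> Um Up \<psi>' \<and>
          norm_m \<alpha> \<xi> Um + norm_p N \<beta> \<xi> Up + norm_shock \<beta> \<psi>' \<le> ennreal (D (m \<xi>) * (\<sigma> + \<kappa>)))"
      unfolding solvable_def by (intro exI[of _ 1]) auto
  qed
qed

end
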